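(* Let $G$ be a Lie group, $A$ a smooth $G$-module and $N\trianglelefteq G$ a split normal Lie subgroup. Then we have the following exact Inflation-Restriction Sequence: $$\mathbf 0\to H^1_s(G/N,A^N)\xrightarrow{I}H^1_s(G,A)\xrightarrow{R}H^1_s(N,A)^{[G]}\xrightarrow{\delta}H^2_s(G/N,A^N)\xrightarrow{I}H^2_s(G,A).$$
   Context: A Lie group is a group that is a smooth manifold modeled on a locally convex space with smooth group operations. A smooth $G$-module is an abelian Lie group $A$ (additive) with a smooth action map $G\times A\to A$ by automorphisms. A subgroup $N\subseteq G$ is a split Lie subgroup if it carries a Lie group structure for which the right multiplication action $G\times N\to G$ defines a smooth principal $N$-bundle, i.e. $G/N$ is a smooth manifold and $q:G\to G/N$ has smooth local sections. $C^p_s(G,A)$: functions $f:G^p\to A$ smooth in an identity neighborhood and vanishing if some argument is $\mathbf 1$ ($C^0_s=A$), with $(d_Gf)(g_0,\dots,g_n)=g_0.f(g_1,\dots,g_n)+\sum_{j=1}^n(-1)^jf(g_0,\dots,g_{j-1}g_j,\dots,g_n)+(-1)^{n+1}f(g_0,\dots,g_{n-1})$; $Z^p_s,B^p_s,H^p_s$ are cocycles, coboundaries, cohomology. $A^N$ is the submodule of $N$-fixed points. $C^p_s(G/N,A^N)$ consists of the functions $f:(G/N)^p\to A^N$ whose pull-back $q^*f:G^p\to A^N\subseteq A$ lies in $C^p_s(G,A)$, with the group differential $d_{G/N}$; $Z^p_s(G/N,A^N),B^p_s,H^p_s$ accordingly. $I([f])=[q^*f]$ is inflation and $R$ is induced by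 restriction of cochains to $N$. $G$ acts on $C^p_s(N,A)$ by $(g.f)(n_1,\dots,n_p)=g.f(g^{-1}n_1g,\dots,g^{-1}n_pg)$. A cocycle $f\in Z^p_s(N,A)$ is smoothly cohomologically invariant if there is a map $\theta:G\to C^{p-1}_s(N,A)$ with $d_N(\theta(g))=g.f-f$ for all $g$ such that $(g,n_1,\dots,n_{p-1})\mapsto\theta(g)(n_1,\dots,n_{p-1})$ is smooth in an identity neighborhood of $G\times N^{p-1}$. $Z^p_s(N,A)^{[G]}$ is the group of these cocycles and $H^p_s(N,A)^{[G]}=Z^p_s(N,A)^{[G]}/B^p_s(N,A)$. Connecting map $\delta$: for $f\in Z^1_s(N,A)^{[G]}$ there is $a\in C^1_s(G,A)$ with $d_N(a(g))=g.f-f$ and $a(gn)=a(g)+g.f(n)$ for $g\in G,n\in N$. Then $d_Ga$ is $A^N$-valued and constant on $(N\times N)$-cosets, hence factors to $\overline{d_Ga}\in Z^2_s(G/N,A^N)$, and $\delta([f]):=[\overline{d_Ga}]$ is well defined. *)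

theory Defs
  imports
    "HOL-Analysis.Analysis"
    "HOL-Algebra.Coset"
    "HOL-Library.Function_Algebras"
begin

section \<open>Locally convex spaces\<close>

text \<open>Real, Hausdorff, not necessarily complete.\<close>

class locally_convex_space = real_vector + topological_ab_group_add + t2_space +
  assumes tendsto_scaleR_Pair:
    "LIM x (nhds a \<times>\<^sub>F nhds b). fst x *\<^sub>R snd x :> nhds (a *\<^sub>R b)"
  assumes locally_convex_0:
    "open U \<Longrightarrow> 0 \<in> U \<Longrightarrow> \<exists>V. open V \<and> 0 \<in> V \<and> V \<subseteq> U \<and>
      (\<forall>x\<in>V. \<forall>y\<in>V. \<forall>u\<ge>0. \<forall>v\<ge>0. u + v = 1 \<longrightarrow> u *\<^sub>R x + v *\<^sub>R y \<in> V)"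

lemma open_convex_nhd_0:
  fixes U :: "'a::locally_convex_space set"
  assumes "open U" "0 \<in> U"
  shows "\<exists>V. open V \<and> convex V \<and> 0 \<in> V \<and> V \<subseteq> U"
  using locally_convex_0[OF assms] by (auto simp: convex_def)

instance real_normed_vector \<subseteq> locally_convex_space
proof
  fix a :: real and b :: 'a
  show "LIM x nhds a \<times>\<^sub>F nhds b. fst x *\<^sub>R snd x :> nhds (a *\<^sub>R b)"
    by (intro tendsto_scaleR filterlim_fst filterlim_snd)
next
  fix U :: "'a set"
  assume "open U" "0 \<in> U"
  then obtain e where "0 < e" "ball 0 e \<subseteq> U"
    by (meson open_contains_ball)
  then have "open (ball (0::'a) e)" "0 \<in> ball (0::'a) e" "ball 0 e \<subseteq> U" "convex (ball (0::'a) e)"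
    by auto
  then show "\<exists>V. open V \<and> 0 \<in> V \<and> V \<subseteq> U \<and>
      (\<forall>x\<in>V. \<forall>y\<in>V. \<forall>u\<ge>0. \<forall>v\<ge>0. u + v = 1 \<longrightarrow> u *\<^sub>R x + v *\<^sub>R y \<in> V)"
    unfolding convex_def by (intro exI[of _ "ball 0 e"] conjI)
qed

instance prod :: (topological_monoid_add, topological_monoid_add) topological_monoid_add
proof
  fix a b :: "'a \<times> 'b"
  have "((\<lambda>x. (fst (fst x) + fst (snd x), snd (fst x) + snd (snd x))) \<longlongrightarrow>
      (fst a + fst b, snd a + snd b)) (nhds a \<times>\<^sub>F nhds b)"
    by (intro tendsto_intros filterlim_fst filterlim_snd)
  then show "LIM x nhds a \<times>\<^sub>F nhds b. fst x + snd x :> nhds (a + b)"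
    by (simp add: plus_prod_def)
qed

instance prod :: (topological_group_add, topological_group_add) topological_group_add
proof
  fix a :: "'a \<times> 'b"
  have "((\<lambda>x. (- fst x, - snd x)) \<longlongrightarrow> (- fst a, - snd a)) (nhds a)"
    by (intro tendsto_intros filterlim_ident)
  then show "(uminus \<longlongrightarrow> - a) (nhds a)"
    by (simp add: uminus_prod_def[abs_def])
qed

instance prod :: (topological_ab_group_add, topological_ab_group_add) topological_ab_group_add ..

instance prod :: (locally_convex_space, locally_convex_space) locally_convex_space
proof
  fix a :: real and b :: "'a \<times> 'b"
  have 1: "((\<lambda>x. fst x *\<^sub>R fst (snd x)) \<longlongrightarrow> a *\<^sub>R fst b) (nhds a \<times>\<^sub>F nhds b)"
    by (rule filterlim_compose[OF tendsto_scaleR_Pair, of "\<lambda>x. (fst x, fst (snd x))", simplified])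
      (intro filterlim_Pair tendsto_intros filterlim_fst filterlim_snd)
  have 2: "((\<lambda>x. fst x *\<^sub>R snd (snd x)) \<longlongrightarrow> a *\<^sub>R snd b) (nhds a \<times>\<^sub>F nhds b)"
    by (rule filterlim_compose[OF tendsto_scaleR_Pair, of "\<lambda>x. (fst x, snd (snd x))", simplified])
      (intro filterlim_Pair tendsto_intros filterlim_fst filterlim_snd)
  show "LIM x nhds a \<times>\<^sub>F nhds b. fst x *\<^sub>R snd x :> nhds (a *\<^sub>R b)"
    using tendsto_Pair[OF 1 2] by (simp add: scaleR_prod_def)
next
  fix U :: "('a \<times> 'b) set"
  assume "open U" "0 \<in> U"
  then obtain A B where AB: "open A" "open B" "0 \<in> A \<times> B" "A \<times> B \<subseteq> U"
    by (metis open_prod_elim)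
  then have "0 \<in> A" "0 \<in> B" by (auto simp: zero_prod_def)
  obtain V W where "open V" "convex V" "0 \<in> V" "V \<subseteq> A" "open W" "convex W" "0 \<in> W" "W \<subseteq> B"
    using open_convex_nhd_0[OF AB(1) \<open>0 \<in> A\<close>] open_convex_nhd_0[OF AB(2) \<open>0 \<in> B\<close>] by auto
  then have "open (V \<times> W)" "convex (V \<times> W)" "0 \<in> V \<times> W" "V \<times> W \<subseteq> U"
    using AB(4) by (auto simp: open_Times convex_Times zero_prod_def)
  then show "\<exists>V. open V \<and> 0 \<in> V \<and> V \<subseteq> U \<and>
      (\<forall>x\<in>V. \<forall>y\<in>V. \<forall>u\<ge>0. \<forall>v\<ge>0. u + v = 1 \<longrightarrow> u *\<^sub>R x + v *\<^sub>R y \<in> V)"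
    unfolding convex_def by (intro exI[of _ "V \<times> W"] conjI)
qed

text \<open>The space of all families, with pointwise operations and the product topology; finite powers
  are realised inside it.\<close>

instantiation "fun" :: (type, real_vector) real_vector
begin

definition scaleR_fun :: "real \<Rightarrow> ('a \<Rightarrow> 'b) \<Rightarrow> 'a \<Rightarrow> 'b"
  where "scaleR_fun r f = (\<lambda>x. r *\<^sub>R f x)"

instance
  by standard (auto simp: scaleR_fun_def fun_eq_iff scaleR_add_left scaleR_add_right)

end

lemma open_vimage_coordinate: "open U \<Longrightarrow> open ((\<lambda>f::'a \<Rightarrow> 'b::topological_space. f i) -` U)"
  by (rule open_vimage[OF _ continuous_on_product_coordinates])

instance "fun" :: (type, t0_space) t0_space
proof
  fix f g :: "'a \<Rightarrow> 'b"
  assume "f \<noteq> g"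
  then obtain i where "f i \<noteq> g i" by auto
  from t0_space_class.t0_space[OF this] obtain U where "open U" "\<not> (f i \<in> U \<longleftrightarrow> g i \<in> U)"
    by (elim exE conjE)
  then show "\<exists>U. open U \<and> \<not> (f \<in> U \<longleftrightarrow> g \<in> U)"
    using open_vimage_coordinate[of U i] by (intro exI[of _ "(\<lambda>h. h i) -` U"]) auto
qed

instance "fun" :: (type, t1_space) t1_space
proof
  fix f g :: "'a \<Rightarrow> 'b"
  assume "f \<noteq> g"
  then obtain i where "f i \<noteq> g i" by auto
  then obtain U where "open U" "f i \<in> U" "g i \<notin> U"
    by (metis t1_space)
  then show "\<exists>U. open U \<and> f \<in> U \<and> g \<notin> U"
    using open_vimage_coordinate[of U i] by (intro exI[of _ "(\<lambda>h. h i) -` U"]) auto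
qed

instance "fun" :: (type, t2_space) t2_space
proof
  fix f g :: "'a \<Rightarrow> 'b"
  assume "f \<noteq> g"
  then obtain i where "f i \<noteq> g i" by auto
  then obtain U V where "open U" "open V" "f i \<in> U" "g i \<in> V" "U \<inter> V = {}"
    by (metis hausdorff)
  then show "\<exists>U V. open U \<and> open V \<and> f \<in> U \<and> g \<in> V \<and> U \<inter> V = {}"
    using open_vimage_coordinate[of U i] open_vimage_coordinate[of V i]
    by (intro exI[of _ "(\<lambda>h. h i) -` U"] exI[of _ "(\<lambda>h. h i) -` V"]) auto
qed

lemma tendsto_coordinatewiseI:
  fixes f :: "'c \<Rightarrow> 'a \<Rightarrow> 'b::topological_space"
  assumes "\<And>i. ((\<lambda>x. f x i) \<longlongrightarrow> l i) F"
  shows "(f \<longlongrightarrow> l) F"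
proof (rule topological_tendstoI)
  fix S :: "('a \<Rightarrow> 'b) set"
  assume "open S" "l \<in> S"
  then obtain X where X: "l \<in> Pi\<^sub>E UNIV X" "\<And>i. open (X i)" "finite {i. X i \<noteq> UNIV}" "Pi\<^sub>E UNIV X \<subseteq> S"
    using product_topology_open_contains_basis[of "\<lambda>_. euclidean" UNIV S l]
    by (auto simp: open_fun_def)
  have "\<forall>\<^sub>F x in F. \<forall>i\<in>{i. X i \<noteq> UNIV}. f x i \<in> X i"
    using X(1,2) by (intro eventually_ball_finite X(3) ballI topological_tendstoD[OF assms]) auto
  then show "\<forall>\<^sub>F x in F. f x \<in> S"
    by eventually_elim (use X(4) in \<open>fastforce simp: PiE_def\<close>)
qed

lemma tendsto_nhds_coordinate: "((\<lambda>f::'a \<Rightarrow> 'b::topological_space. f i) \<longlongrightarrow> a i) (nhds a)"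
proof -
  have "continuous_on UNIV (\<lambda>f::'a \<Rightarrow> 'b. f i)"
    by (rule continuous_on_product_coordinates)
  then show ?thesis
    by (simp add: continuous_on_def tendsto_at_iff_tendsto_nhds[of "\<lambda>f. f i" a, symmetric])
qed

instance "fun" :: (type, topological_monoid_add) topological_monoid_add
proof
  fix a b :: "'a \<Rightarrow> 'b"
  show "LIM x nhds a \<times>\<^sub>F nhds b. fst x + snd x :> nhds (a + b)"
  proof (rule tendsto_coordinatewiseI)
    fix i
    show "((\<lambda>x. (fst x + snd x) i) \<longlongrightarrow> (a + b) i) (nhds a \<times>\<^sub>F nhds b)"
      unfolding plus_fun_apply
      by (rule tendsto_add; rule filterlim_compose[OF tendsto_nhds_coordinate])
        (rule filterlim_fst filterlim_snd)+
  qed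
qed

instance "fun" :: (type, topological_group_add) topological_group_add
proof
  fix a :: "'a \<Rightarrow> 'b"
  show "(uminus \<longlongrightarrow> - a) (nhds a)"
  proof (rule tendsto_coordinatewiseI)
    fix i
    show "((\<lambda>x. (- x) i) \<longlongrightarrow> (- a) i) (nhds a)"
      using tendsto_minus[OF tendsto_nhds_coordinate[of i a]] by (simp add: fun_Compl_def)
  qed
qed

instance "fun" :: (type, topological_ab_group_add) topological_ab_group_add ..

instance "fun" :: (type, locally_convex_space) locally_convex_space
proof
  fix a :: real and b :: "'a \<Rightarrow> 'b"
  show "LIM x nhds a \<times>\<^sub>F nhds b. fst x *\<^sub>R snd x :> nhds (a *\<^sub>R b)"
  proof (rule tendsto_coordinatewiseI)
    fix i
    show "((\<lambda>x. (fst x *\<^sub>R snd x) i) \<longlongrightarrow> (a *\<^sub>R b) i) (nhds a \<times>\<^sub>F nhds b)"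
      unfolding scaleR_fun_def
      by (rule filterlim_compose[OF tendsto_scaleR_Pair, of "\<lambda>x. (fst x, snd x i)", simplified])
        (rule filterlim_Pair filterlim_fst filterlim_compose[OF tendsto_nhds_coordinate filterlim_snd])+
  qed
next
  fix U :: "('a \<Rightarrow> 'b) set"
  assume "open U" "0 \<in> U"
  then obtain X where X: "0 \<in> Pi\<^sub>E UNIV X" "\<And>i. open (X i)" "finite {i. X i \<noteq> UNIV}" "Pi\<^sub>E UNIV X \<subseteq> U"
    using product_topology_open_contains_basis[of "\<lambda>_. euclidean" UNIV U 0]
    by (auto simp: open_fun_def)
  have "\<exists>V. open V \<and> convex V \<and> 0 \<in> V \<and> V \<subseteq> X i \<and> (X i = UNIV \<longrightarrow> V = UNIV)" for i
    using open_convex_nhd_0[OF X(2)[of i]] X(1)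
    by (cases "X i = UNIV") (auto simp: PiE_def Pi_def)
  then obtain V where V: "\<And>i. open (V i)" "\<And>i. convex (V i)" "\<And>i. 0 \<in> V i" "\<And>i. V i \<subseteq> X i"
      "\<And>i. X i = UNIV \<Longrightarrow> V i = UNIV"
    by metis
  have "finite {i. V i \<noteq> UNIV}"
    by (rule finite_subset[OF _ X(3)]) (use V(5) in auto)
  then have "open (Pi\<^sub>E UNIV V)"
    using V(1) by (intro open_PiE) auto
  moreover have "convex (Pi\<^sub>E UNIV V)"
    using V(2) by (auto simp: convex_def PiE_def Pi_def scaleR_fun_def)
  moreover have "0 \<in> Pi\<^sub>E UNIV V"
    using V(3) by (simp add: PiE_def Pi_def)
  moreover have "Pi\<^sub>E UNIV V \<subseteq> U"
    using V(4) X(4) by (meson PiE_mono order_trans)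
  ultimately show "\<exists>V. open V \<and> 0 \<in> V \<and> V \<subseteq> U \<and>
      (\<forall>x\<in>V. \<forall>y\<in>V. \<forall>u\<ge>0. \<forall>v\<ge>0. u + v = 1 \<longrightarrow> u *\<^sub>R x + v *\<^sub>R y \<in> V)"
    unfolding convex_def by (intro exI[of _ "Pi\<^sub>E UNIV V"] conjI)
qed


section \<open>Smooth maps between locally convex spaces\<close>

text \<open>Model spaces are linear subspaces of a \<^class>\<open>locally_convex_space\<close> type with the induced
  topology, so that the powers of a space live in one type: the \<open>p\<close>-th power of \<open>E\<close>
  consists of the sequences in \<open>E\<close> that vanish from index \<open>p\<close> on.\<close>

definition power_space :: "nat \<Rightarrow> 'e::zero set \<Rightarrow> (nat \<Rightarrow> 'e) set"
  where "power_space p E = {v. (\<forall>i<p. v i \<in> E) \<and> (\<forall>i\<ge>p. v i = 0)}"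

text \<open>\<open>iterated_derivative f k x v\<close> is the iterated directional derivative of \<open>f\<close> at
  \<open>x\<close> in the directions \<open>v 0, \<dots>, v (k - 1)\<close>, taken in this order.\<close>

primrec iterated_derivative ::
  "('e::locally_convex_space \<Rightarrow> 'f::locally_convex_space) \<Rightarrow> nat \<Rightarrow> 'e \<Rightarrow> (nat \<Rightarrow> 'e) \<Rightarrow> 'f"
  where
    "iterated_derivative f 0 x v = f x"
  | "iterated_derivative f (Suc k) x v =
      Lim (at 0) (\<lambda>t::real. (iterated_derivative f k (x + t *\<^sub>R v k) v
        - iterated_derivative f k x v) /\<^sub>R t)"

text \<open>Smoothness in the sense of Michal and Bastiani (Keller's \<open>C\<^sup>\<infinity>\<^sub>c\<close>): all iterated
  directional derivatives exist (with values in the target space \<open>F\<close>) and are jointly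
  continuous.\<close>

definition smooth_on ::
  "'e::locally_convex_space set \<Rightarrow> 'f::locally_convex_space set \<Rightarrow> 'e set \<Rightarrow> ('e \<Rightarrow> 'f) \<Rightarrow> bool"
  where "smooth_on E F U f \<longleftrightarrow>
    openin (top_of_set E) U \<and> f ` U \<subseteq> F \<and>
    (\<forall>k. \<forall>x\<in>U. \<forall>v\<in>power_space (Suc k) E. \<exists>l\<in>F.
      ((\<lambda>t::real. (iterated_derivative f k (x + t *\<^sub>R v k) v - iterated_derivative f k x v) /\<^sub>R t)
        \<longlongrightarrow> l) (at 0)) \<and>
    (\<forall>k. continuous_on (U \<times> power_space k E) (\<lambda>(x, v). iterated_derivative f k x v))"


section \<open>Manifolds modeled on locally convex spaces\<close>

text \<open>A manifold consists of a topology, a model space and a (not necessarily maximal) atlas, whose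
  members \<open>(U, \<phi>)\<close> are charts \<open>\<phi>\<close> with domain \<open>U\<close>; the underlying set is the
  \<^const>\<open>topspace\<close> of the topology.\<close>

record ('m, 'e) manifold =
  topo :: "'m topology"
  model :: "'e set"
  atlas :: "('m set \<times> ('m \<Rightarrow> 'e)) set"

definition smooth_manifold :: "('m, 'e::locally_convex_space) manifold \<Rightarrow> bool"
  where "smooth_manifold M \<longleftrightarrow>
    Hausdorff_space (topo M) \<and> subspace (model M) \<and>
    (\<Union>(U, \<phi>)\<in>atlas M. U) = topspace (topo M) \<and>
    (\<forall>(U, \<phi>)\<in>atlas M. openin (topo M) U \<and> openin (top_of_set (model M)) (\<phi> ` U) \<and>
      homeomorphic_map (subtopology (topo M) U) (top_of_set (\<phi> ` U)) \<phi>) \<and>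
    (\<forall>(U, \<phi>)\<in>atlas M. \<forall>(V, \<psi>)\<in>atlas M.
      smooth_on (model M) (model M) (\<phi> ` (U \<inter> V)) (\<psi> \<circ> inv_into U \<phi>))"

text \<open>\<open>W\<close> is meant to be an open subset of the first manifold.\<close>

definition smooth_map_on ::
  "('m, 'e::locally_convex_space) manifold \<Rightarrow> ('n, 'f::locally_convex_space) manifold
    \<Rightarrow> 'm set \<Rightarrow> ('m \<Rightarrow> 'n) \<Rightarrow> bool"
  where "smooth_map_on M M' W f \<longleftrightarrow>
    continuous_map (subtopology (topo M) W) (topo M') f \<and>
    (\<forall>(U, \<phi>)\<in>atlas M. \<forall>(V, \<psi>)\<in>atlas M'.
      smooth_on (model M) (model M') (\<phi> ` {x \<in> U \<inter> W. f x \<in> V}) (\<psi> \<circ> f \<circ> inv_into U \<phi>))"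

definition smooth_map ::
  "('m, 'e::locally_convex_space) manifold \<Rightarrow> ('n, 'f::locally_convex_space) manifold
    \<Rightarrow> ('m \<Rightarrow> 'n) \<Rightarrow> bool"
  where "smooth_map M M' f \<longleftrightarrow> smooth_map_on M M' (topspace (topo M)) f"

definition smooth_near ::
  "('m, 'e::locally_convex_space) manifold \<Rightarrow> ('n, 'f::locally_convex_space) manifold
    \<Rightarrow> 'm \<Rightarrow> ('m \<Rightarrow> 'n) \<Rightarrow> bool"
  where "smooth_near M M' x f \<longleftrightarrow> (\<exists>W. openin (topo M) W \<and> x \<in> W \<and> smooth_map_on M M' W f)"

definition diffeomorphism_on ::
  "('m, 'e::locally_convex_space) manifold \<Rightarrow> 'm set \<Rightarrow> ('n, 'f::locally_convex_space) manifold
    \<Rightarrow> 'n set \<Rightarrow> ('m \<Rightarrow> 'n) \<Rightarrow> bool"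
  where "diffeomorphism_on M U M' U' f \<longleftrightarrow>
    openin (topo M) U \<and> openin (topo M') U' \<and> bij_betw f U U' \<and>
    smooth_map_on M M' U f \<and> smooth_map_on M' M U' (inv_into U f)"

definition prod_manifold ::
  "('m, 'e) manifold \<Rightarrow> ('n, 'f) manifold \<Rightarrow> ('m \<times> 'n, 'e \<times> 'f) manifold"
  where "prod_manifold M M' =
    \<lparr>topo = prod_topology (topo M) (topo M'),
     model = model M \<times> model M',
     atlas = {(U \<times> V, map_prod \<phi> \<psi>) | U \<phi> V \<psi>. (U, \<phi>) \<in> atlas M \<and> (V, \<psi>) \<in> atlas M'}\<rparr>"

text \<open>Tuples \<open>(x\<^sub>0, \<dots>, x\<^sub>p\<^sub>-\<^sub>1)\<close> are the functions on \<open>{..<p}\<close>, extended by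
  \<^const>\<open>undefined\<close>.\<close>

definition tuples :: "nat \<Rightarrow> 'm set \<Rightarrow> (nat \<Rightarrow> 'm) set"
  where "tuples p S = (\<Pi>\<^sub>E i\<in>{..<p}. S)"

definition power_manifold :: "nat \<Rightarrow> ('m, 'e::zero) manifold \<Rightarrow> (nat \<Rightarrow> 'm, nat \<Rightarrow> 'e) manifold"
  where "power_manifold p M =
    \<lparr>topo = product_topology (\<lambda>_. topo M) {..<p},
     model = power_space p (model M),
     atlas = {(\<Pi>\<^sub>E i\<in>{..<p}. U i, \<lambda>x i. if i < p then \<phi> i (x i) else 0) | U \<phi>.
       \<forall>i<p. (U i, \<phi> i) \<in> atlas M}\<rparr>"


section \<open>Lie groups, smooth modules and split Lie subgroups\<close>

definition lie_group :: "('g, 'x) monoid_scheme \<Rightarrow> ('g, 'e::locally_convex_space) manifold \<Rightarrow> bool"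
  where "lie_group G M \<longleftrightarrow>
    group G \<and> smooth_manifold M \<and> topspace (topo M) = carrier G \<and>
    smooth_map (prod_manifold M M) M (\<lambda>(g, h). g \<otimes>\<^bsub>G\<^esub> h) \<and>
    smooth_map M M (\<lambda>g. inv\<^bsub>G\<^esub> g)"

definition additive_group :: "'a::ab_group_add set \<Rightarrow> 'a monoid"
  where "additive_group S = \<lparr>carrier = S, mult = (+), one = 0\<rparr>"

text \<open>The abelian Lie group \<open>A\<close> is carried by the whole type \<open>'a\<close>.\<close>

definition smooth_module ::
  "('g, 'x) monoid_scheme \<Rightarrow> ('g, 'e::locally_convex_space) manifold
    \<Rightarrow> ('a::ab_group_add, 'f::locally_convex_space) manifold \<Rightarrow> ('g \<Rightarrow> 'a \<Rightarrow> 'a) \<Rightarrow> bool"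
  where "smooth_module G MG MA act \<longleftrightarrow>
    lie_group (additive_group (UNIV :: 'a set)) MA \<and>
    (\<forall>a. act \<one>\<^bsub>G\<^esub> a = a) \<and>
    (\<forall>g\<in>carrier G. \<forall>h\<in>carrier G. \<forall>a. act (g \<otimes>\<^bsub>G\<^esub> h) a = act g (act h a)) \<and>
    (\<forall>g\<in>carrier G. \<forall>a b. act g (a + b) = act g a + act g b) \<and>
    smooth_map (prod_manifold MG MA) MA (\<lambda>(g, a). act g a)"

text \<open>A smooth principal \<open>H\<close>-bundle \<open>q : P \<rightarrow> B\<close>, with right action \<open>ract\<close>: around
  each point of \<open>B\<close> there is a smooth section \<open>\<sigma>\<close> whose associated equivariant map
  \<open>(u, h) \<mapsto> \<sigma>(u).h\<close> is a local trivialization.\<close>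

definition smooth_principal_bundle ::
  "('p, 'e::locally_convex_space) manifold \<Rightarrow> ('b, 'k::locally_convex_space) manifold \<Rightarrow> ('p \<Rightarrow> 'b)
    \<Rightarrow> ('h, 'x) monoid_scheme \<Rightarrow> ('h, 'f::locally_convex_space) manifold \<Rightarrow> ('p \<Rightarrow> 'h \<Rightarrow> 'p) \<Rightarrow> bool"
  where "smooth_principal_bundle P B q H MH ract \<longleftrightarrow>
    smooth_manifold P \<and> smooth_manifold B \<and> lie_group H MH \<and>
    smooth_map P B q \<and>
    smooth_map (prod_manifold P MH) P (\<lambda>(x, h). ract x h) \<and>
    (\<forall>x\<in>topspace (topo P). ract x \<one>\<^bsub>H\<^esub> = x \<and>
      (\<forall>h\<in>carrier H. q (ract x h) = q x \<and>
        (\<forall>k\<in>carrier H. ract (ract x h) k = ract x (h \<otimes>\<^bsub>H\<^esub> k)))) \<and>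
    (\<forall>b\<in>topspace (topo B). \<exists>U \<sigma>. openin (topo B) U \<and> b \<in> U \<and>
      smooth_map_on B P U \<sigma> \<and> (\<forall>u\<in>U. q (\<sigma> u) = u) \<and>
      diffeomorphism_on (prod_manifold B MH) (U \<times> carrier H) P {x \<in> topspace (topo P). q x \<in> U}
        (\<lambda>(u, h). ract (\<sigma> u) h))"

text \<open>\<open>MN\<close> and \<open>MQ\<close> are the manifold structures on \<open>N\<close> and \<open>G/N\<close>.\<close>

definition split_lie_subgroup ::
  "('g, 'x) monoid_scheme \<Rightarrow> ('g, 'e::locally_convex_space) manifold \<Rightarrow> 'g set
    \<Rightarrow> ('g, 'h::locally_convex_space) manifold \<Rightarrow> ('g set, 'k::locally_convex_space) manifold \<Rightarrow> bool"
  where "split_lie_subgroup G MG N MN MQ \<longleftrightarrow>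
    subgroup N G \<and> lie_group (G\<lparr>carrier := N\<rparr>) MN \<and>
    topspace (topo MQ) = (\<lambda>g. g <#\<^bsub>G\<^esub> N) ` carrier G \<and>
    smooth_principal_bundle MG MQ (\<lambda>g. g <#\<^bsub>G\<^esub> N) (G\<lparr>carrier := N\<rparr>) MN (\<lambda>g n. g \<otimes>\<^bsub>G\<^esub> n)"


section \<open>Cochains and cohomology\<close>

text \<open>Cochains of degree \<open>p\<close> are functions on tuples of length \<open>p\<close>, extended by 0, so
  that they are added as functions. A 0-cochain has the empty tuple as its only argument; this
  identifies \<open>C\<^sup>0\<^sub>s(G,A)\<close> with \<open>A\<close>.\<close>

definition extend_zero :: "'t set \<Rightarrow> ('t \<Rightarrow> 'a::zero) \<Rightarrow> 't \<Rightarrow> 'a"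
  where "extend_zero T f = (\<lambda>x. if x \<in> T then f x else 0)"

definition const_cochain :: "'a::zero \<Rightarrow> (nat \<Rightarrow> 'g) \<Rightarrow> 'a"
  where "const_cochain a = extend_zero (tuples 0 UNIV) (\<lambda>_. a)"

definition sgn_power :: "nat \<Rightarrow> 'a::group_add \<Rightarrow> 'a"
  where "sgn_power j a = (if even j then a else - a)"

text \<open>The differential from degree \<open>n\<close> to degree \<open>n + 1\<close>.\<close>

definition group_diff ::
  "('g, 'x) monoid_scheme \<Rightarrow> ('g \<Rightarrow> 'a \<Rightarrow> 'a::ab_group_add) \<Rightarrow> nat
    \<Rightarrow> ((nat \<Rightarrow> 'g) \<Rightarrow> 'a) \<Rightarrow> (nat \<Rightarrow> 'g) \<Rightarrow> 'a"
  where "group_diff G act n f = extend_zero (tuples (Suc n) (carrier G)) (\<lambda>x.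
      act (x 0) (f (\<lambda>i\<in>{..<n}. x (Suc i)))
      + (\<Sum>j = 1..n. sgn_power j (f (\<lambda>i\<in>{..<n}.
          if Suc i < j then x i else if Suc i = j then x i \<otimes>\<^bsub>G\<^esub> x j else x (Suc i))))
      + sgn_power (Suc n) (f (\<lambda>i\<in>{..<n}. x i)))"

definition smooth_cochains ::
  "('g, 'x) monoid_scheme \<Rightarrow> ('g, 'e::locally_convex_space) manifold
    \<Rightarrow> ('a::ab_group_add, 'f::locally_convex_space) manifold \<Rightarrow> nat \<Rightarrow> ((nat \<Rightarrow> 'g) \<Rightarrow> 'a) set"
  where "smooth_cochains G MG MA p =
    {f. (\<forall>x. x \<notin> tuples p (carrier G) \<longrightarrow> f x = 0) \<and>
        (\<forall>x\<in>tuples p (carrier G). (\<exists>i<p. x i = \<one>\<^bsub>G\<^esub>) \<longrightarrow> f x = 0) \<and>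
        smooth_near (power_manifold p MG) MA (\<lambda>i\<in>{..<p}. \<one>\<^bsub>G\<^esub>) f}"

definition cocycles :: "(nat \<Rightarrow> 'c set) \<Rightarrow> (nat \<Rightarrow> 'c \<Rightarrow> 'c) \<Rightarrow> nat \<Rightarrow> 'c::ab_group_add set"
  where "cocycles C d p = {f \<in> C p. d p f = 0}"

definition coboundaries :: "(nat \<Rightarrow> 'c set) \<Rightarrow> (nat \<Rightarrow> 'c \<Rightarrow> 'c) \<Rightarrow> nat \<Rightarrow> 'c::ab_group_add set"
  where "coboundaries C d p = (case p of 0 \<Rightarrow> {0} | Suc n \<Rightarrow> d n ` C n)"

definition quotient_group :: "'c::ab_group_add set \<Rightarrow> 'c set \<Rightarrow> 'c set monoid"
  where "quotient_group Z B = additive_group Z Mod B"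

definition coset_of :: "'c::ab_group_add set \<Rightarrow> 'c set \<Rightarrow> 'c \<Rightarrow> 'c set"
  where "coset_of Z B f = B #>\<^bsub>additive_group Z\<^esub> f"

definition Z_s where
  "Z_s G MG MA act p = cocycles (smooth_cochains G MG MA) (group_diff G act) p"

definition B_s where
  "B_s G MG MA act p = coboundaries (smooth_cochains G MG MA) (group_diff G act) p"

definition H_s where
  "H_s G MG MA act p = quotient_group (Z_s G MG MA act p) (B_s G MG MA act p)"


subsection \<open>The quotient group\<close>

definition fixed_points :: "('g \<Rightarrow> 'a \<Rightarrow> 'a) \<Rightarrow> 'g set \<Rightarrow> 'a set"
  where "fixed_points act N = {a. \<forall>n\<in>N. act n a = a}"

text \<open>The action of \<open>G/N\<close> on \<open>A\<^sup>N\<close>; it does not depend on the chosen representative.\<close>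

definition quot_act :: "('g \<Rightarrow> 'a \<Rightarrow> 'a) \<Rightarrow> 'g set \<Rightarrow> 'a \<Rightarrow> 'a"
  where "quot_act act X a = act (SOME g. g \<in> X) a"

text \<open>The pull-back \<open>q\<^sup>*f\<close>. For normal \<open>N\<close>, left cosets are elements of \<open>G Mod N\<close>.\<close>

definition pullback ::
  "('g, 'x) monoid_scheme \<Rightarrow> 'g set \<Rightarrow> nat \<Rightarrow> ((nat \<Rightarrow> 'g set) \<Rightarrow> 'a::zero) \<Rightarrow> (nat \<Rightarrow> 'g) \<Rightarrow> 'a"
  where "pullback G N p f =
    extend_zero (tuples p (carrier G)) (\<lambda>x. f (\<lambda>i\<in>{..<p}. x i <#\<^bsub>G\<^esub> N))"

definition quot_cochains ::
  "('g, 'x) monoid_scheme \<Rightarrow> ('g, 'e::locally_convex_space) manifold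
    \<Rightarrow> ('a::ab_group_add, 'f::locally_convex_space) manifold \<Rightarrow> ('g \<Rightarrow> 'a \<Rightarrow> 'a) \<Rightarrow> 'g set
    \<Rightarrow> nat \<Rightarrow> ((nat \<Rightarrow> 'g set) \<Rightarrow> 'a) set"
  where "quot_cochains G MG MA act N p =
    {f. (\<forall>y. y \<notin> tuples p (carrier (G Mod N)) \<longrightarrow> f y = 0) \<and>
        (\<forall>y\<in>tuples p (carrier (G Mod N)). f y \<in> fixed_points act N) \<and>
        pullback G N p f \<in> smooth_cochains G MG MA p}"

definition Z_s_quot where
  "Z_s_quot G MG MA act N p =
    cocycles (quot_cochains G MG MA act N) (group_diff (G Mod N) (quot_act act)) p"

definition B_s_quot where
  "B_s_quot G MG MA act N p =
    coboundaries (quot_cochains G MG MA act N) (group_diff (G Mod N) (quot_act act)) p"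

definition H_s_quot where
  "H_s_quot G MG MA act N p = quotient_group (Z_s_quot G MG MA act N p) (B_s_quot G MG MA act N p)"


subsection \<open>Smoothly cohomologically invariant classes\<close>

definition conj_act ::
  "('g, 'x) monoid_scheme \<Rightarrow> 'g set \<Rightarrow> ('g \<Rightarrow> 'a \<Rightarrow> 'a::zero) \<Rightarrow> nat \<Rightarrow> 'g
    \<Rightarrow> ((nat \<Rightarrow> 'g) \<Rightarrow> 'a) \<Rightarrow> (nat \<Rightarrow> 'g) \<Rightarrow> 'a"
  where "conj_act G N act p g f =
    extend_zero (tuples p N) (\<lambda>x. act g (f (\<lambda>i\<in>{..<p}. inv\<^bsub>G\<^esub> g \<otimes>\<^bsub>G\<^esub> x i \<otimes>\<^bsub>G\<^esub> g)))"

text \<open>Meaningful for \<open>p \<ge> 1\<close> only.\<close>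

definition Z_s_inv ::
  "('g, 'x) monoid_scheme \<Rightarrow> ('g, 'e::locally_convex_space) manifold
    \<Rightarrow> ('a::ab_group_add, 'f::locally_convex_space) manifold \<Rightarrow> ('g \<Rightarrow> 'a \<Rightarrow> 'a)
    \<Rightarrow> 'g set \<Rightarrow> ('g, 'h::locally_convex_space) manifold \<Rightarrow> nat \<Rightarrow> ((nat \<Rightarrow> 'g) \<Rightarrow> 'a) set"
  where "Z_s_inv G MG MA act N MN p =
    {f \<in> Z_s (G\<lparr>carrier := N\<rparr>) MN MA act p. \<exists>\<theta>.
      (\<forall>g\<in>carrier G. \<theta> g \<in> smooth_cochains (G\<lparr>carrier := N\<rparr>) MN MA (p - 1) \<and>
        group_diff (G\<lparr>carrier := N\<rparr>) act (p - 1) (\<theta> g) = conj_act G N act p g f - f) \<and>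
      smooth_near (prod_manifold MG (power_manifold (p - 1) MN)) MA
        (\<one>\<^bsub>G\<^esub>, \<lambda>i\<in>{..<p - 1}. \<one>\<^bsub>G\<^esub>) (\<lambda>(g, x). \<theta> g x)}"

definition H_s_inv where
  "H_s_inv G MG MA act N MN p =
    quotient_group (Z_s_inv G MG MA act N MN p) (B_s (G\<lparr>carrier := N\<rparr>) MN MA act p)"


subsection \<open>Inflation, restriction and the connecting map\<close>

definition inflation where
  "inflation G MG MA act N p c =
    the_elem ((\<lambda>f. coset_of (Z_s G MG MA act p) (B_s G MG MA act p) (pullback G N p f)) ` c)"

definition restriction where
  "restriction G MG MA act N MN p c =
    the_elem ((\<lambda>f. coset_of (Z_s_inv G MG MA act N MN p) (B_s (G\<lparr>carrier := N\<rparr>) MN MA act p)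
      (extend_zero (tuples p N) f)) ` c)"

definition connecting_cochains ::
  "('g, 'x) monoid_scheme \<Rightarrow> ('g, 'e::locally_convex_space) manifold
    \<Rightarrow> ('a::ab_group_add, 'f::locally_convex_space) manifold \<Rightarrow> ('g \<Rightarrow> 'a \<Rightarrow> 'a)
    \<Rightarrow> 'g set \<Rightarrow> ((nat \<Rightarrow> 'g) \<Rightarrow> 'a) \<Rightarrow> ((nat \<Rightarrow> 'g) \<Rightarrow> 'a) set"
  where "connecting_cochains G MG MA act N f =
    {a \<in> smooth_cochains G MG MA 1.
      (\<forall>g\<in>carrier G.
        group_diff (G\<lparr>carrier := N\<rparr>) act 0 (const_cochain (a (\<lambda>i\<in>{..<1}. g))) = conj_act G N act 1 g f - f) \<and>
      (\<forall>g\<in>carrier G. \<forall>n\<in>N.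
        a (\<lambda>i\<in>{..<1}. g \<otimes>\<^bsub>G\<^esub> n) = a (\<lambda>i\<in>{..<1}. g) + act g (f (\<lambda>i\<in>{..<1}. n)))}"

text \<open>The cocycle on \<open>G/N\<close> induced by \<open>d\<^sub>G a\<close> is the \<open>h\<close> with \<open>q\<^sup>*h = d\<^sub>G a\<close>.\<close>

definition connecting_map where
  "connecting_map G MG MA act N c =
    the_elem {coset_of (Z_s_quot G MG MA act N 2) (B_s_quot G MG MA act N 2) h | h f a.
      f \<in> c \<and> a \<in> connecting_cochains G MG MA act N f \<and>
      h \<in> Z_s_quot G MG MA act N 2 \<and> pullback G N 2 h = group_diff G act 1 a}"

end

theory Submission
  imports Defs
begin

text \<open>The algebra is that of the classical five term sequence; what has to be supplied is a cochain
  \<open>a\<close> on \<open>G\<close> extending an invariant cocycle \<open>f\<close> on \<open>N\<close>. Let \<open>s\<close> be a section of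
  \<open>q : G \<rightarrow> G/N\<close>, smooth near the identity, and let \<open>d\<^sub>N (\<theta> g) = g.f - f\<close> with \<open>\<theta> \<one> = 0\<close>.
  Writing \<open>g = s(q g) m\<close> with \<open>m \<in> N\<close>, put \<open>a g = \<theta> (s(q g)) + s(q g).f m\<close>. The cocycle
  identity for \<open>f\<close> gives \<open>a (g n) = a g + g.f n\<close> and \<open>a (n g) = f n + n.a g\<close>; hence
  \<open>c = d\<^sub>G a\<close> is constant on cosets in both arguments, and \<open>n.c(g, h) = c(n g, h) = c(g, h)\<close>.
  Smoothness of the cochains involved is only needed near the identity and follows from the chain
  rule for Michal-Bastiani smooth maps. The chain rule rests on a mean value theorem: an increment
  over \<open>[0, 1]\<close> lies in every open convex set that contains all derivatives.\<close>

section \<open>Calculus in locally convex spaces\<close>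

text \<open>\<open>smooth_on\<close> speaks about iterated derivatives of every order with
  independent directions, so the chain rule is established for all orders at once by an explicit
  formula. There are no norms: remainder estimates become limits along filters combined with the
  mean value theorem. On the group side, the manifold structure \<open>MN\<close> is part of the
  data and is not defined by restricting charts of \<open>MG\<close>. That the N-component of g is
  smooth as a map into \<open>MN\<close> is read off from the inverse of a local trivialization. The
  section is smooth only near \<one>, which suffices because cochains are controlled only there;
  elsewhere cosets are represented by arbitrary choice. Descent to G/N is purely algebraic for a
  similar reason: a cochain on G/N is smooth, by definition, when its pull-back is. On
  representatives the connecting map depends on the choice of \<open>a\<close>, so it is handled as
  a relation, and its being well defined becomes the statement that coboundaries are related to
  coboundaries only.\<close>

abbreviation D where "D \<equiv> iterated_derivative"

lemma tendsto_scaleR_lcs: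
  fixes g :: "'c \<Rightarrow> 'e::locally_convex_space"
  assumes "(f \<longlongrightarrow> a) F" "(g \<longlongrightarrow> b) F"
  shows "((\<lambda>x. f x *\<^sub>R g x) \<longlongrightarrow> a *\<^sub>R b) F"
  using filterlim_compose[OF tendsto_scaleR_Pair filterlim_Pair[OF assms]] by simp

lemma open_convex_nhd:
  fixes l :: "'a::locally_convex_space"
  assumes "open S" "l \<in> S"
  obtains V where "open V" "convex V" "l \<in> V" "V \<subseteq> S"
proof -
  have "open ((\<lambda>x. l + x) -` S)"
    by (intro open_vimage assms) (auto intro!: continuous_intros)
  then obtain V where V: "open V" "convex V" "0 \<in> V" "V \<subseteq> (\<lambda>x. l + x) -` S"
    using open_convex_nhd_0 assms(2) by (metis add.right_neutral vimage_eq)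
  have eq: "(\<lambda>x. x - l) -` V = (\<lambda>x. l + x) ` V"
  proof (intro Set.set_eqI iffI)
    fix x assume "x \<in> (\<lambda>x. x - l) -` V"
    then show "x \<in> (\<lambda>x. l + x) ` V" by (intro image_eqI[of _ _ "x - l"]) auto
  qed auto
  have "open ((\<lambda>x. x - l) -` V)"
    by (intro open_vimage V) (auto intro!: continuous_intros)
  moreover have "convex ((\<lambda>x. l + x) ` V)"
    using V(2) by (rule convex_translation)
  ultimately show ?thesis
    using V(3,4) eq by (intro that[of "(\<lambda>x. l + x) ` V"]) auto
qed

text \<open>No continuous functionals enter; the argument is bisection. \<open>P a b\<close> says
  that the average slope over [a, b] is an element of \<open>S\<close>. Near each point this holds
  because \<open>S\<close> is open, and it passes to adjacent intervals because the average slope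
  over their union is a convex combination of the two.\<close>

lemma mean_value_convex:
  fixes \<gamma> \<gamma>' :: "real \<Rightarrow> 'f::locally_convex_space"
  assumes S: "open S" "convex S"
    and deriv: "\<And>s. 0 \<le> s \<Longrightarrow> s \<le> 1 \<Longrightarrow> ((\<lambda>t. (\<gamma> (s + t) - \<gamma> s) /\<^sub>R t) \<longlongrightarrow> \<gamma>' s) (at 0)"
    and mem: "\<And>s. 0 \<le> s \<Longrightarrow> s \<le> 1 \<Longrightarrow> \<gamma>' s \<in> S"
  shows "\<gamma> 1 - \<gamma> 0 \<in> S"
proof -
  define P where "P a b \<longleftrightarrow> (\<exists>w\<in>S. \<gamma> b - \<gamma> a = (b - a) *\<^sub>R w)" for a b
  have trans: "P a c" if "P a b" "P b c" "a \<le> b" "b \<le> c" for a b c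
  proof -
    obtain w1 w2 where w: "w1 \<in> S" "w2 \<in> S" "\<gamma> b - \<gamma> a = (b - a) *\<^sub>R w1" "\<gamma> c - \<gamma> b = (c - b) *\<^sub>R w2"
      using \<open>P a b\<close> \<open>P b c\<close> unfolding P_def by auto
    have sum: "\<gamma> c - \<gamma> a = (b - a) *\<^sub>R w1 + (c - b) *\<^sub>R w2"
      using w(3,4) by (metis add.commute diff_add_cancel add_diff_eq)
    show ?thesis
    proof (cases "a = c")
      case True
      then show ?thesis using w(1) unfolding P_def by (intro bexI[of _ w1]) auto
    next
      case False
      then have ac: "c - a > 0" using that by auto
      define w where "w = ((b - a) / (c - a)) *\<^sub>R w1 + ((c - b) / (c - a)) *\<^sub>R w2"
      have "w \<in> S" unfolding w_def
        using ac that
        by (intro convexD[OF S(2)] w) (auto simp: add_divide_distrib[symmetric])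
      moreover have "\<gamma> c - \<gamma> a = (c - a) *\<^sub>R w"
        unfolding sum w_def using ac by (simp add: scaleR_add_right)
      ultimately show ?thesis unfolding P_def by auto
    qed
  qed
  have "P 0 1"
  proof (rule Bolzano)
    fix x :: real
    assume x: "0 \<le> x" "x \<le> 1"
    have "\<forall>\<^sub>F t in at 0. (\<gamma> (x + t) - \<gamma> x) /\<^sub>R t \<in> S"
      by (rule topological_tendstoD[OF deriv[OF x] S(1) mem[OF x]])
    then obtain d where d: "d > 0" "\<And>t. t \<noteq> 0 \<Longrightarrow> \<bar>t\<bar> < d \<Longrightarrow> (\<gamma> (x + t) - \<gamma> x) /\<^sub>R t \<in> S"
      unfolding eventually_at by (auto simp: dist_real_def)
    have step: "\<exists>w\<in>S. \<gamma> (x + t) - \<gamma> x = t *\<^sub>R w" if "\<bar>t\<bar> < d" for t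
    proof (cases "t = 0")
      case True
      then show ?thesis using mem[OF x] by auto
    next
      case False
      then show ?thesis using d(2)[OF False that]
        by (intro bexI[of _ "(\<gamma> (x + t) - \<gamma> x) /\<^sub>R t"]) auto
    qed
    \<comment> \<open>The interval is cut at \<open>x\<close>, where the derivative is known; the
      left half uses a negative increment.\<close>
    have "P a b" if ab: "a \<le> x" "x \<le> b" "b - a < d" for a b
    proof (rule trans)
      show "P x b" using step[of "b - x"] ab unfolding P_def by auto
      have "\<bar>a - x\<bar> < d" using ab by auto
      then obtain w where "w \<in> S" "\<gamma> a - \<gamma> x = (a - x) *\<^sub>R w"
        using step[of "a - x"] by auto
      then have "\<gamma> x - \<gamma> a = (x - a) *\<^sub>R w"
        by (metis minus_diff_eq scaleR_minus_left)
      then show "P a x" using \<open>w \<in> S\<close> unfolding P_def by auto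
    qed (use ab in auto)
    then show "\<exists>d>0. \<forall>a b. a \<le> x \<and> x \<le> b \<and> b - a < d \<longrightarrow> P a b"
      using d(1) by blast
  qed (use trans in auto)
  then show ?thesis unfolding P_def by auto
qed

section \<open>Values, limits and continuity of the iterated derivatives of a smooth map\<close>

lemma iterated_derivative_cong_dirs:
  "(\<And>i. i < k \<Longrightarrow> v i = w i) \<Longrightarrow> D f k x v = D f k x w"
proof (induction k arbitrary: x)
  case (Suc k)
  have "D f k y v = D f k y w" for y
    using Suc by auto
  then show ?case using Suc.prems by simp
qed simp

lemma smooth_on_openin: "smooth_on E F U f \<Longrightarrow> openin (top_of_set E) U"
  unfolding smooth_on_def by auto

lemma smooth_on_subset: "smooth_on E F U f \<Longrightarrow> U \<subseteq> E"
  using smooth_on_openin openin_imp_subset by blast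

lemma smooth_on_image: "smooth_on E F U f \<Longrightarrow> x \<in> U \<Longrightarrow> f x \<in> F"
  unfolding smooth_on_def by auto

lemma tendsto_line:
  fixes x v :: "'e::locally_convex_space"
  shows "((\<lambda>t::real. x + t *\<^sub>R v) \<longlongrightarrow> x) (at 0)"
proof -
  have "((\<lambda>t. x + t *\<^sub>R v) \<longlongrightarrow> x + 0 *\<^sub>R v) (at 0)"
    by (intro tendsto_add tendsto_const tendsto_scaleR_lcs tendsto_ident_at)
  then show ?thesis by simp
qed

lemma ex_scaleR_in_open:
  fixes x v :: "'e::locally_convex_space"
  assumes "openin (top_of_set E) U" "subspace E" "x \<in> U" "v \<in> E"
  shows "\<forall>\<^sub>F t in at (0::real). x + t *\<^sub>R v \<in> U"
proof -
  obtain T where T: "open T" "U = E \<inter> T" using assms(1) by (auto simp: openin_open)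
  have "\<forall>\<^sub>F t in at (0::real). x + t *\<^sub>R v \<in> T"
    using T assms(3) by (intro topological_tendstoD[OF tendsto_line]) auto
  then show ?thesis
    by eventually_elim (use T assms in \<open>auto intro!: subspace_add subspace_scale\<close>)
qed

text \<open>The entries of \<open>v\<close> beyond \<open>k\<close> do not enter, so they may be
  replaced by 0 to obtain a member of the power space in the definition. Uniqueness of limits
  identifies the limit provided there with the \<open>Lim\<close> of the recursion.\<close>

lemma smooth_on_has_derivative:
  fixes f :: "'e::locally_convex_space \<Rightarrow> 'f::locally_convex_space"
  assumes "smooth_on E F U f" "subspace E" "x \<in> U" "\<And>i. i \<le> k \<Longrightarrow> v i \<in> E"
  shows "((\<lambda>t::real. (D f k (x + t *\<^sub>R v k) v - D f k x v) /\<^sub>R t)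
        \<longlongrightarrow> D f (Suc k) x v) (at 0)" (is ?lim)
    and "D f (Suc k) x v \<in> F"
proof -
  define w where "w = (\<lambda>i. if i \<le> k then v i else 0)"
  have w: "w \<in> power_space (Suc k) E"
    using assms(4) by (auto simp: power_space_def w_def)
  have eq: "D f k y w = D f k y v" for y
    by (rule iterated_derivative_cong_dirs) (auto simp: w_def)
  have "w k = v k" by (simp add: w_def)
  obtain l where l: "l \<in> F" "((\<lambda>t::real. (D f k (x + t *\<^sub>R v k) v - D f k x v) /\<^sub>R t)
        \<longlongrightarrow> l) (at 0)"
    using assms(1) w assms(3) unfolding smooth_on_def eq[symmetric] \<open>w k = v k\<close>[symmetric] by blast
  then have "D f (Suc k) x v = l"
    by (auto intro!: tendsto_Lim)
  then show ?lim "D f (Suc k) x v \<in> F"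
    using l by auto
qed

lemma smooth_on_derivative_in:
  assumes "smooth_on E F U f" "subspace E" "x \<in> U" "\<And>i. i < k \<Longrightarrow> v i \<in> E"
  shows "D f k x v \<in> F"
  using assms smooth_on_has_derivative(2)[OF assms(1-3), of "k - 1" v] smooth_on_image[OF assms(1,3)]
  by (cases k) auto

text \<open>Joint continuity along an arbitrary filter. Directions only have to converge entrywise,
  because that is convergence in the product topology, and only the first \<open>k\<close> entries
  matter.\<close>

lemma smooth_on_tendsto:
  fixes f :: "'e::locally_convex_space \<Rightarrow> 'f::locally_convex_space"
  assumes "smooth_on E F U f"
    and "(X \<longlongrightarrow> x) L" "\<forall>\<^sub>F t in L. X t \<in> U" "x \<in> U"
    and "\<And>i. i < k \<Longrightarrow> ((\<lambda>t. W t i) \<longlongrightarrow> w i) L" "\<And>i. i < k \<Longrightarrow> \<forall>\<^sub>F t in L. W t i \<in> E"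
      "\<And>i. i < k \<Longrightarrow> w i \<in> E"
  shows "((\<lambda>t. D f k (X t) (W t)) \<longlongrightarrow> D f k x w) L"
proof -
  define tr where "tr u = (\<lambda>i. if i < k then u i else 0)" for u :: "nat \<Rightarrow> 'e"
  have eq: "D f k y (tr u) = D f k y u" for y u
    by (rule iterated_derivative_cong_dirs) (auto simp: tr_def)
  have "continuous_on (U \<times> power_space k E) (\<lambda>(x, v). D f k x v)"
    using assms(1) unfolding smooth_on_def by auto
  moreover have "((\<lambda>t. (X t, tr (W t))) \<longlongrightarrow> (x, tr w)) L"
    using assms(5) by (intro tendsto_Pair assms(2) tendsto_coordinatewiseI) (auto simp: tr_def)
  moreover have "(x, tr w) \<in> U \<times> power_space k E"
    using assms by (auto simp: tr_def power_space_def)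
  moreover have "\<forall>\<^sub>F t in L. \<forall>i\<in>{..<k}. W t i \<in> E"
    using assms(6) by (intro eventually_ball_finite) auto
  then have "\<forall>\<^sub>F t in L. (X t, tr (W t)) \<in> U \<times> power_space k E"
    using assms(3) by eventually_elim (auto simp: tr_def power_space_def)
  ultimately have "((\<lambda>t. case (X t, tr (W t)) of (x, v) \<Rightarrow> D f k x v) \<longlongrightarrow>
      (case (x, tr w) of (x, v) \<Rightarrow> D f k x v)) L"
    by (rule continuous_on_tendsto_compose)
  then show ?thesis by (simp add: eq)
qed

lemma smooth_on_tendsto_base:
  assumes "smooth_on E F U f" "(X \<longlongrightarrow> x) L" "\<forall>\<^sub>F t in L. X t \<in> U" "x \<in> U"
  shows "((\<lambda>t. f (X t)) \<longlongrightarrow> f x) L"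
  using smooth_on_tendsto[OF assms, of 0] by simp

lemma smooth_on_continuous: "smooth_on E F U f \<Longrightarrow> continuous_on U f"
  unfolding continuous_on_def
  by (rule ballI, rule smooth_on_tendsto_base[OF _ tendsto_ident_at]) (simp_all add: eventually_at_filter)

text \<open>Introduction rule: a family \<open>d\<close> that starts with \<open>f\<close> and
  consists of successive derivatives must be the family of iterated derivatives, because limits are
  unique and \<open>U\<close> is relatively open. The filter in \<open>cont\<close> lives on pairs
  since it is instantiated with punctured neighbourhoods inside
  \<open>U \<times> power_space k E\<close>.\<close>

lemma smooth_on_derivativesI:
  fixes f :: "'e::locally_convex_space \<Rightarrow> 'f::locally_convex_space"
  assumes E: "subspace E" and U: "openin (top_of_set E) U"
    and base: "\<And>x v. x \<in> U \<Longrightarrow> f x = d 0 x v"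
    and in_F: "\<And>k x v. x \<in> U \<Longrightarrow> (\<And>i. v i \<in> E) \<Longrightarrow> d k x v \<in> F"
    and deriv: "\<And>k x v. x \<in> U \<Longrightarrow> (\<And>i. v i \<in> E) \<Longrightarrow>
      ((\<lambda>t::real. (d k (x + t *\<^sub>R v k) v - d k x v) /\<^sub>R t) \<longlongrightarrow> d (Suc k) x v) (at 0)"
    and cont: "\<And>k x v X W (L :: ('e \<times> (nat \<Rightarrow> 'e)) filter). (X \<longlongrightarrow> x) L \<Longrightarrow> \<forall>\<^sub>F t in L. X t \<in> U \<Longrightarrow> x \<in> U \<Longrightarrow>
      (\<And>i. ((\<lambda>t. W t i) \<longlongrightarrow> v i) L) \<Longrightarrow> (\<And>i. \<forall>\<^sub>F t in L. W t i \<in> E) \<Longrightarrow> (\<And>i. v i \<in> E) \<Longrightarrow>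
      ((\<lambda>t. d k (X t) (W t)) \<longlongrightarrow> d k x v) L"
  shows "smooth_on E F U f"
proof -
  have quot: "((\<lambda>t::real. (D f k (x + t *\<^sub>R v k) v - D f k x v) /\<^sub>R t)
      \<longlongrightarrow> d (Suc k) x v) (at 0)"
    if x: "x \<in> U" and v: "\<And>i. v i \<in> E" and IH: "\<And>x. x \<in> U \<Longrightarrow> D f k x v = d k x v" for k x v
  proof (rule Lim_transform_eventually[OF deriv[OF x v]])
    show "\<forall>\<^sub>F t in at (0::real). (d k (x + t *\<^sub>R v k) v - d k x v) /\<^sub>R t =
        (D f k (x + t *\<^sub>R v k) v - D f k x v) /\<^sub>R t"
      using ex_scaleR_in_open[OF U E x v[of k]] by eventually_elim (use x in \<open>simp add: IH\<close>)
  qed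
  have eq: "D f k x v = d k x v" if x: "x \<in> U" and v: "\<And>i. v i \<in> E" for k x v
    using x
  proof (induction k arbitrary: x)
    case (Suc k)
    then show ?case
      unfolding iterated_derivative.simps(2)[of f] by (intro tendsto_Lim quot v) auto
  qed (use base in simp)
  have E0: "0 \<in> E" using E by (rule subspace_0)
  have pw: "v i \<in> E" if "v \<in> power_space k E" for v k i
    using that E0 by (cases "i < k") (auto simp: power_space_def)
  show ?thesis
    unfolding smooth_on_def
  proof (intro conjI allI ballI U)
    show "f ` U \<subseteq> F" using base[of _ "\<lambda>_. 0"] in_F[of _ "\<lambda>_. 0"] E0 by auto
    fix k
    show "\<exists>l\<in>F. ((\<lambda>t::real. (D f k (x + t *\<^sub>R v k) v - D f k x v) /\<^sub>R t)
        \<longlongrightarrow> l) (at 0)" if x: "x \<in> U" and v: "v \<in> power_space (Suc k) E" for x v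
      by (rule bexI, rule quot[OF x pw[OF v] eq[OF _ pw[OF v]]]) (assumption, rule in_F[OF x pw[OF v]])
    show "continuous_on (U \<times> power_space k E) (\<lambda>(x, v). D f k x v)"
      unfolding continuous_on_def
    proof (clarify)
      fix x v assume xv: "x \<in> U" "v \<in> power_space k E"
      let ?L = "at (x, v) within U \<times> power_space k E"
      have lim: "((\<lambda>t. t) \<longlongrightarrow> (x, v)) ?L" by (rule tendsto_ident_at)
      have ev: "\<forall>\<^sub>F t in ?L. t \<in> U \<times> power_space k E" by (simp add: eventually_at_filter)
      have "((\<lambda>t. d k (fst t) (snd t)) \<longlongrightarrow> d k x v) ?L"
      proof (rule cont)
        show "(fst \<longlongrightarrow> x) ?L" using tendsto_fst[OF lim] by simp
        show "\<forall>\<^sub>F t in ?L. fst t \<in> U" using ev by eventually_elim auto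
        show "\<forall>\<^sub>F t in ?L. snd t i \<in> E" for i using ev by eventually_elim (auto intro: pw)
        show "((\<lambda>t. snd t i) \<longlongrightarrow> v i) ?L" for i
          using filterlim_compose[OF tendsto_nhds_coordinate tendsto_snd[OF lim]] by simp
      qed (use xv pw in auto)
      moreover have "\<forall>\<^sub>F t in ?L. d k (fst t) (snd t) = D f k (fst t) (snd t)"
        using ev by eventually_elim (auto intro!: eq[symmetric] pw)
      ultimately show "((\<lambda>(x, v). D f k x v) \<longlongrightarrow> D f k x v) ?L"
        unfolding eq[OF xv(1) pw[OF xv(2)]] case_prod_unfold by (rule Lim_transform_eventually)
    qed
  qed
qed

subsection \<open>Strict differentiability and multilinearity\<close>

text \<open>Strict differentiability: base point, increment and earlier directions may all move
  along the filter. The quotient is the increment over [0, 1] of a curve whose derivatives are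
  values of \<open>D g (Suc m)\<close> along a shrinking segment, and joint continuity eventually
  puts all of these into a given convex neighbourhood of the limit. Multilinearity and the chain
  rule both rest on this uniform version.\<close>

lemma smooth_on_strict:
  fixes g :: "'e::locally_convex_space \<Rightarrow> 'f::locally_convex_space"
  assumes g: "smooth_on F H V g" and F: "subspace F"
    and Y: "(Y \<longlongrightarrow> y) L" "\<forall>\<^sub>F t in L. Y t \<in> V" "y \<in> V"
    and W: "\<And>i. i < m \<Longrightarrow> ((\<lambda>t. W t i) \<longlongrightarrow> w i) L" "\<And>i. i < m \<Longrightarrow> \<forall>\<^sub>F t in L. W t i \<in> F"
      "\<And>i. i < m \<Longrightarrow> w i \<in> F"
    and Z: "(Z \<longlongrightarrow> z) L" "\<forall>\<^sub>F t in L. Z t \<in> F" "z \<in> F"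
    and T: "(T \<longlongrightarrow> (0::real)) L" "\<forall>\<^sub>F t in L. T t \<noteq> 0"
  shows "((\<lambda>t. (D g m (Y t + T t *\<^sub>R Z t) (W t) - D g m (Y t) (W t)) /\<^sub>R T t)
    \<longlongrightarrow> D g (Suc m) y (w(m := z))) L"
proof (rule topological_tendstoI)
  fix S assume "open S" "D g (Suc m) y (w(m := z)) \<in> S"
  then obtain C where C: "open C" "convex C" "D g (Suc m) y (w(m := z)) \<in> C" "C \<subseteq> S"
    by (rule open_convex_nhd)
  \<comment> \<open>The factor \<open>?I\<close> makes all estimates uniform along the segment from \<open>Y t\<close> to
    \<open>Y t + T t *\<^sub>R Z t\<close>.\<close>
  let ?I = "principal {0..1::real}"
  let ?L = "L \<times>\<^sub>F ?I"
  have f1: "filterlim fst L ?L" by (rule filterlim_fst)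
  have ev2: "\<forall>\<^sub>F p in ?L. snd p \<in> {0..1}"
    by (rule eventually_compose_filterlim[OF _ filterlim_snd]) (simp add: eventually_principal)
  have lift: "\<forall>\<^sub>F p in ?L. P (fst p)" if "\<forall>\<^sub>F t in L. P t" for P
    by (rule eventually_compose_filterlim[OF that f1])
  have "((\<lambda>p. \<bar>T (fst p)\<bar>) \<longlongrightarrow> 0) ?L"
    using filterlim_compose[OF tendsto_rabs[OF T(1)] f1] by simp
  then have sT: "((\<lambda>p. snd p * T (fst p)) \<longlongrightarrow> 0) ?L"
  proof (rule Lim_null_comparison[rotated])
    show "\<forall>\<^sub>F p in ?L. norm (snd p * T (fst p)) \<le> \<bar>T (fst p)\<bar>"
      using ev2 by eventually_elim (auto simp: abs_mult intro: mult_left_le_one_le)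
  qed
  define X where "X p = Y (fst p) + (snd p * T (fst p)) *\<^sub>R Z (fst p)" for p
  have "(X \<longlongrightarrow> y + 0 *\<^sub>R z) ?L"
    unfolding X_def
    by (intro tendsto_add tendsto_scaleR_lcs sT filterlim_compose[OF Y(1) f1] filterlim_compose[OF Z(1) f1])
  then have X: "(X \<longlongrightarrow> y) ?L" by simp
  obtain O' where O': "open O'" "V = F \<inter> O'" using smooth_on_openin[OF g] by (auto simp: openin_open)
  have XV: "\<forall>\<^sub>F p in ?L. X p \<in> V"
  proof -
    have "\<forall>\<^sub>F p in ?L. X p \<in> O'"
      using Y(3) O' by (intro topological_tendstoD[OF X]) auto
    then show ?thesis
      using lift[OF Y(2)] lift[OF Z(2)]
      by eventually_elim (use O' F in \<open>auto simp: X_def intro!: subspace_add subspace_scale\<close>)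
  qed
  have "((\<lambda>p. D g (Suc m) (X p) ((W (fst p))(m := Z (fst p)))) \<longlongrightarrow>
      D g (Suc m) y (w(m := z))) ?L"
  proof (rule smooth_on_tendsto[OF g X XV Y(3)])
    fix i assume "i < Suc m"
    then consider "i < m" | "i = m" by linarith
    note * = this
    show "((\<lambda>p. ((W (fst p))(m := Z (fst p))) i) \<longlongrightarrow> (w(m := z)) i) ?L"
      by (cases rule: *) (auto intro: filterlim_compose[OF W(1) f1] filterlim_compose[OF Z(1) f1])
    show "\<forall>\<^sub>F p in ?L. ((W (fst p))(m := Z (fst p))) i \<in> F"
      by (cases rule: *) (auto intro: lift[OF W(2)] lift[OF Z(2)])
    show "(w(m := z)) i \<in> F" by (cases rule: *) (use W(3) Z(3) in auto)
  qed
  then have "\<forall>\<^sub>F p in ?L. D g (Suc m) (X p) ((W (fst p))(m := Z (fst p))) \<in> C"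
    using C by (intro topological_tendstoD) auto
  with XV have "\<forall>\<^sub>F p in ?L. X p \<in> V \<and>
      D g (Suc m) (X p) ((W (fst p))(m := Z (fst p))) \<in> C"
    by (rule eventually_conj)
  then have ev: "\<forall>\<^sub>F t in L. \<forall>s\<in>{0..1}. X (t, s) \<in> V \<and>
      D g (Suc m) (X (t, s)) ((W t)(m := Z t)) \<in> C"
    unfolding eventually_prod_filter eventually_principal
    by (auto elim!: eventually_mono)
  have evW: "\<forall>\<^sub>F t in L. \<forall>i\<in>{..<m}. W t i \<in> F"
    using W(2) by (intro eventually_ball_finite) auto
  show "\<forall>\<^sub>F t in L. (D g m (Y t + T t *\<^sub>R Z t) (W t) - D g m (Y t) (W t)) /\<^sub>R T t \<in> S"
    using ev evW Z(2) T(2)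
  proof eventually_elim
    case (elim t)
    \<comment> \<open>Division by \<open>T t\<close> is built in, so that the increment of \<gamma>
      over [0, 1] is the difference quotient itself.\<close>
    define \<gamma> where "\<gamma> s = D g m (Y t + (s * T t) *\<^sub>R Z t) (W t) /\<^sub>R T t" for s
    define \<gamma>' where "\<gamma>' s = D g (Suc m) (X (t, s)) ((W t)(m := Z t))" for s
    have "\<gamma> 1 - \<gamma> 0 \<in> C"
    proof (rule mean_value_convex[OF C(1,2)])
      fix s :: real assume s: "0 \<le> s" "s \<le> 1"
      then show "\<gamma>' s \<in> C" using elim(1) by (auto simp: \<gamma>'_def)
      have same: "D g m u ((W t)(m := Z t)) = D g m u (W t)" for u
        by (rule iterated_derivative_cong_dirs) auto
      have "((\<lambda>r::real. (D g m (X (t, s) + r *\<^sub>R ((W t)(m := Z t)) m) ((W t)(m := Z t))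
          - D g m (X (t, s)) ((W t)(m := Z t))) /\<^sub>R r) \<longlongrightarrow> \<gamma>' s) (at 0)"
        unfolding \<gamma>'_def using elim s by (intro smooth_on_has_derivative[OF g F]) auto
      then have lim: "((\<lambda>r::real. (D g m (X (t, s) + r *\<^sub>R Z t) (W t)
          - D g m (X (t, s)) (W t)) /\<^sub>R r) \<longlongrightarrow> \<gamma>' s) (at 0)"
        by (simp add: same)
      \<comment> \<open>The derivative of \<gamma> is a directional derivative after the
        substitution of \<open>r * T t\<close> for \<open>r\<close>, which tends to 0 without taking
        the value 0.\<close>
      have "filterlim (\<lambda>r. r * T t) (at 0) (at (0::real))"
        using elim(4) tendsto_mult_right[of "\<lambda>r::real. r" 0 "at 0" "T t"]
        by (auto simp: filterlim_at eventually_at_filter intro: tendsto_ident_at)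
      from filterlim_compose[OF lim this]
      show "((\<lambda>r. (\<gamma> (s + r) - \<gamma> s) /\<^sub>R r) \<longlongrightarrow> \<gamma>' s) (at 0)"
        using elim(4) by (simp add: \<gamma>_def X_def algebra_simps)
    qed
    then show ?case using C(4) by (auto simp: \<gamma>_def scaleR_diff_right)
  qed
qed

text \<open>In the last slot the step along a u + b u' is made in two parts, along a u and then
  along b u'. The second part starts at a moving point, which is where strict differentiability
  enters. Linearity in an earlier slot passes from order \<open>m\<close> to \<open>Suc m\<close> as
  a limit of difference quotients.\<close>

lemma iterated_derivative_linear_slot:
  fixes g :: "'e::locally_convex_space \<Rightarrow> 'f::locally_convex_space"
  assumes g: "smooth_on F H V g" and F: "subspace F"
    and "y \<in> V" "i < m" "\<And>j. j < m \<Longrightarrow> w j \<in> F" "u \<in> F" "u' \<in> F"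
  shows "D g m y (w(i := a *\<^sub>R u + b *\<^sub>R u')) =
    a *\<^sub>R D g m y (w(i := u)) + b *\<^sub>R D g m y (w(i := u'))"
  using assms(3-)
proof (induction m arbitrary: y)
  case (Suc m)
  show ?case
  proof (cases "i = m")
    case True
    let ?D = "\<lambda>u. D g (Suc m) y (w(m := u))"
    have w: "j < m \<Longrightarrow> w j \<in> F" for j using Suc.prems by auto
    \<comment> \<open>The strict difference quotient is taken with increment \<open>c * t\<close>,
      which must not vanish; hence the separate case \<open>c = 0\<close>.\<close>
    have part: "((\<lambda>t. (D g m (Y t + t *\<^sub>R c *\<^sub>R u) w - D g m (Y t) w) /\<^sub>R t)
        \<longlongrightarrow> c *\<^sub>R ?D u) (at 0)"
      if u: "u \<in> F" and Y: "(Y \<longlongrightarrow> y) (at 0)" "\<forall>\<^sub>F t in at 0. Y t \<in> V" for c u Y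
    proof (cases "c = 0")
      case False
      have "((\<lambda>t. (D g m (Y t + (c * t) *\<^sub>R u) w - D g m (Y t) w) /\<^sub>R (c * t))
          \<longlongrightarrow> ?D u) (at 0)"
        using False by (intro smooth_on_strict[OF g F Y Suc.prems(1)])
          (auto simp: eventually_at_filter w u intro!: tendsto_eq_intros)
      from tendsto_scaleR_lcs[OF tendsto_const this, of c] show ?thesis
        using False by (simp add: mult.commute[of _ c] mult.assoc[symmetric])
    qed simp
    let ?c = "a *\<^sub>R u + b *\<^sub>R u'"
    have c: "?c \<in> F" "a *\<^sub>R u \<in> F" using Suc.prems F by (auto intro: subspace_scale subspace_add)
    have near: "\<forall>\<^sub>F t in at (0::real). y + t *\<^sub>R a *\<^sub>R u \<in> V"
      by (rule ex_scaleR_in_open[OF smooth_on_openin[OF g] F Suc.prems(1) c(2)])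
    have "((\<lambda>t. (D g m (y + t *\<^sub>R ?c) w - D g m y w) /\<^sub>R t)
        \<longlongrightarrow> a *\<^sub>R ?D u + b *\<^sub>R ?D u') (at 0)"
      using tendsto_add[OF part[OF Suc.prems(4) tendsto_const, of a] part[OF Suc.prems(5) tendsto_line near, of b]]
        Suc.prems(1) by (simp add: algebra_simps)
    moreover have "((\<lambda>t. (D g m (y + t *\<^sub>R ?c) w - D g m y w) /\<^sub>R t)
        \<longlongrightarrow> ?D ?c) (at 0)"
      using part[OF c(1) tendsto_const, of 1] Suc.prems(1) by simp
    ultimately have "?D ?c = a *\<^sub>R ?D u + b *\<^sub>R ?D u'"
      by (intro tendsto_unique[OF at_neq_bot])
    then show ?thesis using True by (simp only:)
  next
    case False
    then have i: "i < m" using Suc.prems by auto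
    let ?w = "\<lambda>u. w(i := u)"
    have lim: "((\<lambda>t::real. (D g m (y + t *\<^sub>R w m) (?w u) - D g m y (?w u)) /\<^sub>R t)
        \<longlongrightarrow> D g (Suc m) y (?w u)) (at 0)" if "u \<in> F" for u
    proof -
      have "?w u m = w m" using i by simp
      then show ?thesis
        using smooth_on_has_derivative(1)[OF g F Suc.prems(1), of m "?w u"] Suc.prems that by auto
    qed
    let ?c = "a *\<^sub>R u + b *\<^sub>R u'"
    have "((\<lambda>t::real. a *\<^sub>R ((D g m (y + t *\<^sub>R w m) (?w u) - D g m y (?w u)) /\<^sub>R t)
        + b *\<^sub>R ((D g m (y + t *\<^sub>R w m) (?w u') - D g m y (?w u')) /\<^sub>R t))
        \<longlongrightarrow> a *\<^sub>R D g (Suc m) y (?w u) + b *\<^sub>R D g (Suc m) y (?w u')) (at 0)"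
      using Suc.prems by (intro tendsto_add tendsto_scaleR_lcs tendsto_const lim) auto
    moreover have "\<forall>\<^sub>F t in at (0::real). a *\<^sub>R ((D g m (y + t *\<^sub>R w m) (?w u) - D g m y (?w u)) /\<^sub>R t)
        + b *\<^sub>R ((D g m (y + t *\<^sub>R w m) (?w u') - D g m y (?w u')) /\<^sub>R t)
        = (D g m (y + t *\<^sub>R w m) (?w ?c) - D g m y (?w ?c)) /\<^sub>R t"
      using ex_scaleR_in_open[OF smooth_on_openin[OF g] F Suc.prems(1) Suc.prems(3)[of m, OF lessI]]
    proof eventually_elim
      case (elim t)
      have IH: "D g m x (?w ?c) =
        a *\<^sub>R D g m x (?w u) + b *\<^sub>R D g m x (?w u')" if "x \<in> V" for x
        using Suc.prems that i by (intro Suc.IH) auto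
      show ?case using IH[OF elim] IH[OF Suc.prems(1)]
        by (simp add: algebra_simps)
    qed
    ultimately have "((\<lambda>t::real. (D g m (y + t *\<^sub>R w m) (?w ?c) - D g m y (?w ?c)) /\<^sub>R t)
      \<longlongrightarrow> a *\<^sub>R D g (Suc m) y (?w u) + b *\<^sub>R D g (Suc m) y (?w u')) (at 0)"
      by (rule Lim_transform_eventually)
    moreover have "?c \<in> F" using Suc.prems F by (auto intro: subspace_scale subspace_add)
    ultimately show ?thesis
      by (intro tendsto_unique[OF at_neq_bot lim])
  qed
qed simp

declare iterated_derivative.simps(2) [simp del]

text \<open>Product rule for a multilinear map: the slots are changed one at a time. By linearity
  each change, divided by \<open>t\<close>, is the value at the difference quotient of that slot, so
  joint continuity alone gives the limit.\<close>

lemma iterated_derivative_slots_derivative: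
  fixes g :: "'e::locally_convex_space \<Rightarrow> 'f::locally_convex_space"
  assumes g: "smooth_on F H V g" and F: "subspace F" and y: "y \<in> V"
    and W: "\<And>i. i < m \<Longrightarrow> (W i \<longlongrightarrow> W i 0) (at (0::real))"
      "\<And>i. i < m \<Longrightarrow> \<forall>\<^sub>F t in at 0. W i t \<in> F" "\<And>i. i < m \<Longrightarrow> W i 0 \<in> F"
    and W': "\<And>i. i < m \<Longrightarrow> ((\<lambda>t. (W i t - W i 0) /\<^sub>R t) \<longlongrightarrow> w' i) (at 0)" "\<And>i. i < m \<Longrightarrow> w' i \<in> F"
  shows "((\<lambda>t. (D g m y (\<lambda>i. W i t) - D g m y (\<lambda>i. W i 0)) /\<^sub>R t)
    \<longlongrightarrow> (\<Sum>j<m. D g m y ((\<lambda>i. W i 0)(j := w' j)))) (at 0)"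
proof -
  \<comment> \<open>In \<open>mix t j\<close> the first \<open>j\<close> slots have already moved to
    time \<open>t\<close>; consecutive mixtures differ in slot \<open>j\<close> only, so the sum of
    the changes telescopes.\<close>
  define mix where "mix t j = (\<lambda>i. if i < j then W i t else W i 0)" for t and j :: nat
  define dq where "dq j t = (W j t - W j 0) /\<^sub>R t" for j t
  have each: "((\<lambda>t. D g m y ((mix t j)(j := dq j t)))
      \<longlongrightarrow> D g m y ((\<lambda>i. W i 0)(j := w' j))) (at 0)" if j: "j < m" for j
  proof (rule smooth_on_tendsto[OF g tendsto_const _ y])
    fix i assume i: "i < m"
    show "((\<lambda>t. ((mix t j)(j := dq j t)) i) \<longlongrightarrow> ((\<lambda>i. W i 0)(j := w' j)) i) (at 0)"
      using W'(1)[OF j] W(1)[OF i] by (cases "i < j") (auto simp: mix_def dq_def)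
    show "\<forall>\<^sub>F t in at 0. ((mix t j)(j := dq j t)) i \<in> F"
      using W(2)[OF j] W(2)[OF i]
      by eventually_elim
        (use W(3)[OF i] W(3)[OF j] F in \<open>auto simp: mix_def dq_def intro!: subspace_scale subspace_diff\<close>)
    show "((\<lambda>i. W i 0)(j := w' j)) i \<in> F" using W(3)[OF i] W'(2)[OF j] by simp
  qed (simp add: y)
  have "((\<lambda>t. \<Sum>j<m. D g m y ((mix t j)(j := dq j t)))
      \<longlongrightarrow> (\<Sum>j<m. D g m y ((\<lambda>i. W i 0)(j := w' j)))) (at 0)"
    using each by (intro tendsto_sum) auto
  moreover have "\<forall>\<^sub>F t in at 0. \<forall>i\<in>{..<m}. W i t \<in> F"
    using W(2) by (intro eventually_ball_finite) auto
  then have "\<forall>\<^sub>F t in at 0. (\<Sum>j<m. D g m y ((mix t j)(j := dq j t))) =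
      (D g m y (\<lambda>i. W i t) - D g m y (\<lambda>i. W i 0)) /\<^sub>R t"
  proof eventually_elim
    case (elim t)
    have "D g m y ((mix t j)(j := dq j t)) =
        (D g m y (mix t (Suc j)) - D g m y (mix t j)) /\<^sub>R t"
      if j: "j < m" for j
    proof -
      have eq: "dq j t = inverse t *\<^sub>R W j t + (- inverse t) *\<^sub>R W j 0"
        by (simp add: dq_def scaleR_diff_right)
      have "mix t (Suc j) = (mix t j)(j := W j t)" "mix t j = (mix t j)(j := W j 0)"
        by (auto simp: mix_def)
      moreover have "D g m y ((mix t j)(j := dq j t)) =
        inverse t *\<^sub>R D g m y ((mix t j)(j := W j t)) +
        (- inverse t) *\<^sub>R D g m y ((mix t j)(j := W j 0))"
        unfolding eq using elim W(3) j
        by (intro iterated_derivative_linear_slot[OF g F y j]) (auto simp: mix_def)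
      ultimately show ?thesis by (simp add: scaleR_diff_right)
    qed
    then have "(\<Sum>j<m. D g m y ((mix t j)(j := dq j t))) =
        (\<Sum>j<m. D g m y (mix t (Suc j)) - D g m y (mix t j)) /\<^sub>R t"
      by (simp add: scaleR_sum_right)
    also have "\<dots> = (D g m y (mix t m) - D g m y (mix t 0)) /\<^sub>R t"
      by (simp only: sum_lessThan_telescope[of "\<lambda>j. D g m y (mix t j)" m])
    also have "D g m y (mix t m) = D g m y (\<lambda>i. W i t)"
      by (rule iterated_derivative_cong_dirs) (simp add: mix_def)
    also have "mix t 0 = (\<lambda>i. W i 0)"
      by (simp add: mix_def)
    finally show ?case .
  qed
  ultimately show ?thesis by (rule Lim_transform_eventually)
qed

subsection \<open>The chain rule\<close>

text \<open>Faa di Bruno's formula writes the iterated derivative of \<open>g \<circ> f\<close> as a sum over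
  the partitions of the set of directions; a partition is represented by the list \<open>L\<close> of its
  blocks, and differentiating once more either adds a singleton block or enlarges one block.\<close>

definition faa_term ::
  "('f::locally_convex_space \<Rightarrow> 'h::locally_convex_space) \<Rightarrow> ('e::locally_convex_space \<Rightarrow> 'f)
    \<Rightarrow> nat list list \<Rightarrow> 'e \<Rightarrow> (nat \<Rightarrow> 'e) \<Rightarrow> 'h"
  where "faa_term g f L x v = D g (length L) (f x)
    (\<lambda>j. D f (length (L ! j)) x (\<lambda>i. v (L ! j ! i)))"

definition faa_step :: "nat \<Rightarrow> nat list list \<Rightarrow> nat list list list"
  where "faa_step k L = (L @ [[k]]) # map (\<lambda>j. L[j := L ! j @ [k]]) [0..<length L]"

lemma tendsto_sum_list:
  fixes f :: "'i \<Rightarrow> 'c \<Rightarrow> 'b::topological_monoid_add"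
  assumes "\<And>i. i \<in> set xs \<Longrightarrow> (f i \<longlongrightarrow> l i) F"
  shows "((\<lambda>x. \<Sum>i\<leftarrow>xs. f i x) \<longlongrightarrow> (\<Sum>i\<leftarrow>xs. l i)) F"
  using assms by (induction xs) (auto intro!: tendsto_add)

context
  fixes E :: "'e::locally_convex_space set" and F :: "'f::locally_convex_space set"
    and H :: "'h::locally_convex_space set" and f g U V
  assumes E: "subspace E" and F: "subspace F" and H: "subspace H"
    and f: "smooth_on E F U f" and g: "smooth_on F H V g" and fU: "f ` U \<subseteq> V"
begin

text \<open>The increment is split in two. Moving the base point of \<open>g\<close> with the slots
  held at time \<open>t\<close> is strict differentiability and yields the new singleton block
  \<open>[k]\<close>. Moving the slots at the base point \<open>f x\<close> is the product rule and
  yields one summand for each block enlarged by \<open>k\<close>.\<close>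

lemma faa_term_derivative:
  assumes x: "x \<in> U" and v: "\<And>i. v i \<in> E"
  shows "((\<lambda>t::real. (faa_term g f L (x + t *\<^sub>R v k) v - faa_term g f L x v) /\<^sub>R t)
    \<longlongrightarrow> (\<Sum>L'\<leftarrow>faa_step k L. faa_term g f L' x v)) (at 0)"
proof -
  define m where "m = length L"
  define W where "W j t = D f (length (L ! j)) (x + t *\<^sub>R v k) (\<lambda>i. v (L ! j ! i))" for j and t :: real
  define w' where "w' j = D f (Suc (length (L ! j))) x ((\<lambda>i. v (L ! j ! i))(length (L ! j) := v k))" for j
  have ev: "\<forall>\<^sub>F t in at (0::real). x + t *\<^sub>R v k \<in> U"
    by (rule ex_scaleR_in_open[OF smooth_on_openin[OF f] E x v])
  have W0: "(W j \<longlongrightarrow> W j 0) (at 0)" for j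
    unfolding W_def by (rule smooth_on_tendsto[OF f]) (use tendsto_line ev x v in auto)
  have WF: "\<forall>\<^sub>F t in at 0. W j t \<in> F" for j
    using ev by eventually_elim (auto simp: W_def intro!: smooth_on_derivative_in[OF f E] v)
  have W0F: "W j 0 \<in> F" for j
    using x by (auto simp: W_def intro!: smooth_on_derivative_in[OF f E] v)
  have w'F: "w' j \<in> F" for j
    unfolding w'_def using x v by (intro smooth_on_derivative_in[OF f E]) auto
  have W': "((\<lambda>t. (W j t - W j 0) /\<^sub>R t) \<longlongrightarrow> w' j) (at 0)" for j
  proof -
    let ?n = "length (L ! j)" and ?u = "\<lambda>i. v (L ! j ! i)"
    have "((\<lambda>t. (D f ?n (x + t *\<^sub>R (?u(?n := v k)) ?n) (?u(?n := v k)) -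
        D f ?n x (?u(?n := v k))) /\<^sub>R t) \<longlongrightarrow> w' j) (at 0)"
      unfolding w'_def using v by (intro smooth_on_has_derivative(1)[OF f E x]) auto
    moreover have "D f ?n y (?u(?n := v k)) = D f ?n y ?u" for y
      by (rule iterated_derivative_cong_dirs) auto
    ultimately show ?thesis by (simp add: W_def)
  qed
  \<comment> \<open>For \<open>t \<noteq> 0\<close> the value of \<open>f\<close> at the moved point
    is exactly \<open>f x + t *\<^sub>R Z t\<close>, the form of increment that
    \<open>smooth_on_strict\<close> takes.\<close>
  define Z where "Z t = (f (x + t *\<^sub>R v k) - f x) /\<^sub>R t" for t
  let ?z = "D f 1 x (\<lambda>_. v k)"
  have Z: "(Z \<longlongrightarrow> ?z) (at 0)"
    using smooth_on_has_derivative(1)[OF f E x, of 0 "\<lambda>_. v k"] v by (simp add: Z_def[abs_def])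
  have zF: "?z \<in> F" by (intro smooth_on_derivative_in[OF f E x] v)
  have ZF: "\<forall>\<^sub>F t in at 0. Z t \<in> F"
    using ev by eventually_elim
      (auto simp: Z_def intro!: subspace_scale[OF F] subspace_diff[OF F] smooth_on_image[OF f] x)
  have fx: "f x \<in> V" using fU x by auto
  have "((\<lambda>t. (D g m (f x + t *\<^sub>R Z t) (\<lambda>j. W j t) - D g m (f x) (\<lambda>j. W j t)) /\<^sub>R t)
      \<longlongrightarrow> D g (Suc m) (f x) ((\<lambda>j. W j 0)(m := ?z))) (at 0)"
    by (rule smooth_on_strict[OF g F tendsto_const _ fx])
      (rule W0 WF W0F Z ZF zF tendsto_ident_at always_eventually allI fx
        eventually_at_filter[THEN iffD2] impI | assumption)+
  moreover have "((\<lambda>t. (D g m (f x) (\<lambda>j. W j t) - D g m (f x) (\<lambda>j. W j 0)) /\<^sub>R t)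
    \<longlongrightarrow> (\<Sum>j<m. D g m (f x) ((\<lambda>j. W j 0)(j := w' j)))) (at 0)"
    by (intro iterated_derivative_slots_derivative[OF g F fx] W0 WF W0F W' w'F)
  ultimately have "((\<lambda>t. (D g m (f x + t *\<^sub>R Z t) (\<lambda>j. W j t) - D g m (f x) (\<lambda>j. W j t)) /\<^sub>R t
      + (D g m (f x) (\<lambda>j. W j t) - D g m (f x) (\<lambda>j. W j 0)) /\<^sub>R t)
      \<longlongrightarrow> D g (Suc m) (f x) ((\<lambda>j. W j 0)(m := ?z))
        + (\<Sum>j<m. D g m (f x) ((\<lambda>j. W j 0)(j := w' j)))) (at 0)"
    by (rule tendsto_add)
  moreover have "\<forall>\<^sub>F t in at 0.
      (D g m (f x + t *\<^sub>R Z t) (\<lambda>j. W j t) - D g m (f x) (\<lambda>j. W j t)) /\<^sub>R t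
      + (D g m (f x) (\<lambda>j. W j t) - D g m (f x) (\<lambda>j. W j 0)) /\<^sub>R t
      = (faa_term g f L (x + t *\<^sub>R v k) v - faa_term g f L x v) /\<^sub>R t"
  proof -
    have "\<forall>\<^sub>F t in at (0::real). t \<noteq> 0" by (simp add: eventually_at_filter)
    then show ?thesis
    proof eventually_elim
      case (elim t)
      then have "f x + t *\<^sub>R Z t = f (x + t *\<^sub>R v k)" by (simp add: Z_def)
      then show ?case
        by (simp add: faa_term_def W_def m_def scaleR_add_right[symmetric])
    qed
  qed
  moreover have "D g (Suc m) (f x) ((\<lambda>j. W j 0)(m := ?z)) = faa_term g f (L @ [[k]]) x v"
    unfolding faa_term_def length_append m_def
    by (simp, rule iterated_derivative_cong_dirs)
      (auto simp: W_def nth_append intro!: iterated_derivative_cong_dirs)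
  moreover have "D g m (f x) ((\<lambda>i. W i 0)(j := w' j)) = faa_term g f (L[j := L ! j @ [k]]) x v"
    if "j < m" for j
    unfolding faa_term_def length_list_update m_def[symmetric]
    by (rule iterated_derivative_cong_dirs)
      (use that in \<open>auto simp: W_def w'_def m_def nth_append nth_list_update intro!: iterated_derivative_cong_dirs\<close>)
  moreover have "(\<Sum>L'\<leftarrow>faa_step k L. faa_term g f L' x v) =
      faa_term g f (L @ [[k]]) x v + (\<Sum>j<m. faa_term g f (L[j := L ! j @ [k]]) x v)"
    by (simp add: faa_step_def m_def comp_def interv_sum_list_conv_sum_set_nat atLeast0LessThan)
  ultimately show ?thesis
    by (simp add: Lim_transform_eventually)
qed

lemma faa_term_tendsto:
  assumes "(X \<longlongrightarrow> x) L" "\<forall>\<^sub>F t in L. X t \<in> U" "x \<in> U"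
    and "\<And>i. ((\<lambda>t. W t i) \<longlongrightarrow> v i) L" and WE: "\<And>i. \<forall>\<^sub>F t in L. W t i \<in> E" and "\<And>i. v i \<in> E"
  shows "((\<lambda>t. faa_term g f P (X t) (W t)) \<longlongrightarrow> faa_term g f P x v) L"
  unfolding faa_term_def
proof (rule smooth_on_tendsto[OF g])
  show "((\<lambda>t. f (X t)) \<longlongrightarrow> f x) L" by (rule smooth_on_tendsto_base[OF f assms(1-3)])
  show "\<forall>\<^sub>F t in L. f (X t) \<in> V" using assms(2) by eventually_elim (use fU in auto)
  show "f x \<in> V" using assms(3) fU by auto
  fix j assume "j < length P"
  show "((\<lambda>t. D f (length (P ! j)) (X t) (\<lambda>i. W t (P ! j ! i))) \<longlongrightarrow>
      D f (length (P ! j)) x (\<lambda>i. v (P ! j ! i))) L"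
    by (rule smooth_on_tendsto[OF f assms(1-3)]) (rule assms)+
  have "\<forall>\<^sub>F t in L. \<forall>i\<in>set (P ! j). W t i \<in> E"
    using WE by (intro eventually_ball_finite) auto
  then show "\<forall>\<^sub>F t in L. D f (length (P ! j)) (X t) (\<lambda>i. W t (P ! j ! i)) \<in> F"
    using assms(2) by eventually_elim (auto intro!: smooth_on_derivative_in[OF f E])
  show "D f (length (P ! j)) x (\<lambda>i. v (P ! j ! i)) \<in> F"
    using assms by (intro smooth_on_derivative_in[OF f E]) auto
qed

lemma faa_term_in:
  assumes "x \<in> U" "\<And>i. v i \<in> E"
  shows "faa_term g f P x v \<in> H"
  unfolding faa_term_def using assms fU
  by (intro smooth_on_derivative_in[OF g F] smooth_on_derivative_in[OF f E]) auto

text \<open>The partitions of {..<k}. Deleting the largest element from a partition of {..<Suc k}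
  shows that each arises from exactly one smaller partition.\<close>

primrec faa_list :: "nat \<Rightarrow> nat list list list"
  where
    "faa_list 0 = [[]]"
  | "faa_list (Suc k) = concat (map (faa_step k) (faa_list k))"

lemma smooth_on_compose: "smooth_on E H U (\<lambda>x. g (f x))"
proof (rule smooth_on_derivativesI[OF E smooth_on_openin[OF f],
      where d = "\<lambda>k x v. \<Sum>L\<leftarrow>faa_list k. faa_term g f L x v"])
  fix k x and v :: "nat \<Rightarrow> 'e"
  assume x: "x \<in> U" and v: "\<And>i. v i \<in> E"
  have "(\<Sum>L\<leftarrow>xs. faa_term g f L x v) \<in> H" for xs
    by (induction xs) (auto intro!: subspace_0[OF H] subspace_add[OF H] faa_term_in x v)
  then show "(\<Sum>L\<leftarrow>faa_list k. faa_term g f L x v) \<in> H" .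
  have "((\<lambda>t::real. \<Sum>L\<leftarrow>faa_list k. (faa_term g f L (x + t *\<^sub>R v k) v - faa_term g f L x v) /\<^sub>R t)
      \<longlongrightarrow> (\<Sum>L\<leftarrow>faa_list k. \<Sum>L'\<leftarrow>faa_step k L. faa_term g f L' x v)) (at 0)"
    by (intro tendsto_sum_list faa_term_derivative x v)
  moreover have "(\<Sum>L\<leftarrow>xs. (a L - b L) /\<^sub>R t) = ((\<Sum>L\<leftarrow>xs. a L) - (\<Sum>L\<leftarrow>xs. b L)) /\<^sub>R t"
    for xs :: "nat list list list" and a b :: "nat list list \<Rightarrow> 'h" and t
    by (induction xs) (simp_all add: algebra_simps)
  moreover have "(\<Sum>L\<leftarrow>concat (map s xs). a L) = (\<Sum>L\<leftarrow>xs. \<Sum>L'\<leftarrow>s L. a L')"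
    for xs and a :: "nat list list \<Rightarrow> 'h" and s :: "nat list list \<Rightarrow> nat list list list"
    by (induction xs) simp_all
  ultimately show "((\<lambda>t::real. ((\<Sum>L\<leftarrow>faa_list k. faa_term g f L (x + t *\<^sub>R v k) v)
      - (\<Sum>L\<leftarrow>faa_list k. faa_term g f L x v)) /\<^sub>R t)
      \<longlongrightarrow> (\<Sum>L\<leftarrow>faa_list (Suc k). faa_term g f L x v)) (at 0)"
    by simp
qed (auto simp: faa_term_def[of _ _ "[]"] intro!: tendsto_sum_list faa_term_tendsto)

end

subsection \<open>Locality and basic smooth maps\<close>

text \<open>\<open>D g\<close> is defined with values of \<open>g\<close> off \<open>U\<close> as
  well, but at points of a relatively open set and for directions in the model space only nearby
  values count. So \<open>D f\<close> serves as the derivative family of \<open>g\<close>.\<close>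

lemma smooth_on_cong:
  assumes f: "smooth_on E F U f" and E: "subspace E" and eq: "\<And>x. x \<in> U \<Longrightarrow> f x = g x"
  shows "smooth_on E F U g"
  by (rule smooth_on_derivativesI[OF E smooth_on_openin[OF f], where d = "D f"])
    (rule smooth_on_has_derivative[OF f E] smooth_on_derivative_in[OF f E] smooth_on_tendsto[OF f]
      | assumption | simp add: eq)+

lemma smooth_on_open_subset:
  assumes "smooth_on E F U f" "openin (top_of_set E) U'" "U' \<subseteq> U"
  shows "smooth_on E F U' f"
proof -
  have "U' \<times> power_space k E \<subseteq> U \<times> power_space k E" for k using assms(3) by auto
  then show ?thesis
    using assms unfolding smooth_on_def by (blast intro: continuous_on_subset)
qed

text \<open>Smoothness is local. This serves compositions of maps between manifolds, where the
  domain is covered by pieces on which a single intermediate chart can be used.\<close>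

lemma smooth_on_UN:
  assumes E: "subspace E" and f: "\<And>i. i \<in> I \<Longrightarrow> smooth_on E F (U i) f"
  shows "smooth_on E F (\<Union>i\<in>I. U i) f"
proof (rule smooth_on_derivativesI[OF E, where d = "D f"])
  show "openin (top_of_set E) (\<Union>i\<in>I. U i)"
    using f by (intro openin_Union) (auto intro: smooth_on_openin)
next
  fix k x and v :: "nat \<Rightarrow> 'a"
  assume "x \<in> (\<Union>i\<in>I. U i)" and v: "\<And>i. v i \<in> E"
  then obtain i where i: "i \<in> I" "x \<in> U i" by auto
  show "D f k x v \<in> F"
    by (rule smooth_on_derivative_in[OF f[OF i(1)] E i(2) v])
  show "((\<lambda>t::real. (D f k (x + t *\<^sub>R v k) v - D f k x v) /\<^sub>R t)
      \<longlongrightarrow> D f (Suc k) x v) (at 0)"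
    by (rule smooth_on_has_derivative(1)[OF f[OF i(1)] E i(2) v])
next
  fix k x and v :: "nat \<Rightarrow> 'a" and X W and L :: "('a \<times> (nat \<Rightarrow> 'a)) filter"
  assume X: "(X \<longlongrightarrow> x) L" "\<forall>\<^sub>F t in L. X t \<in> (\<Union>i\<in>I. U i)" "x \<in> (\<Union>i\<in>I. U i)"
    and W: "\<And>i. ((\<lambda>t. W t i) \<longlongrightarrow> v i) L" "\<And>i. \<forall>\<^sub>F t in L. W t i \<in> E" "\<And>i. v i \<in> E"
  obtain i where i: "i \<in> I" "x \<in> U i" using X(3) by auto
  obtain T where T: "open T" "U i = E \<inter> T"
    using smooth_on_openin[OF f[OF i(1)]] by (auto simp: openin_open)
  have "\<forall>\<^sub>F t in L. X t \<in> T" using T i by (intro topological_tendstoD[OF X(1)]) auto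
  with X(2) have "\<forall>\<^sub>F t in L. X t \<in> U i"
    by eventually_elim (use T f smooth_on_subset in fast)
  then show "((\<lambda>t. D f k (X t) (W t)) \<longlongrightarrow> D f k x v) L"
    by (intro smooth_on_tendsto[OF f[OF i(1)] X(1) _ i(2)] W)
qed simp

lemma smooth_on_const:
  assumes E: "subspace E" and F: "subspace F" and U: "openin (top_of_set E) U" and c: "c \<in> F"
  shows "smooth_on E F U (\<lambda>_. c)"
  by (rule smooth_on_derivativesI[OF E U, where d = "\<lambda>k _ _. if k = 0 then c else 0"])
    (use c subspace_0[OF F] in auto)

lemma smooth_on_linear:
  assumes E: "subspace E" and F: "subspace F" and U: "openin (top_of_set E) U"
    and l: "linear l" "continuous_on UNIV l" "l ` E \<subseteq> F"
  shows "smooth_on E F U l"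
proof (rule smooth_on_derivativesI[OF E U,
      where d = "\<lambda>k x v. if k = 0 then l x else if k = 1 then l (v 0) else 0"])
  have quot: "((\<lambda>t::real. (l (x + t *\<^sub>R w) - l x) /\<^sub>R t) \<longlongrightarrow> l w) (at 0)" for x w
  proof (rule Lim_transform_eventually[OF tendsto_const])
    show "\<forall>\<^sub>F t in at (0::real). l w = (l (x + t *\<^sub>R w) - l x) /\<^sub>R t"
      unfolding eventually_at_filter
      by (simp add: linear_add[OF l(1)] linear_scale[OF l(1)])
  qed
  show "((\<lambda>t::real. ((if k = 0 then l (x + t *\<^sub>R v k) else if k = 1 then l (v 0) else 0) -
      (if k = 0 then l x else if k = 1 then l (v 0) else 0)) /\<^sub>R t) \<longlongrightarrow>
      (if Suc k = 0 then l x else if Suc k = 1 then l (v 0) else 0)) (at 0)" for k x v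
    by (cases k) (auto intro: quot)
  have lim: "(X \<longlongrightarrow> x) L \<Longrightarrow> ((\<lambda>t. l (X t)) \<longlongrightarrow> l x) L" for X x and L :: "('a \<times> (nat \<Rightarrow> 'a)) filter"
    by (rule continuous_on_tendsto_compose[OF l(2)]) auto
  show "((\<lambda>t. if k = 0 then l (X t) else if k = 1 then l (W t 0) else 0) \<longlongrightarrow>
      (if k = 0 then l x else if k = 1 then l (v 0) else 0)) L"
    if "(X \<longlongrightarrow> x) L" "\<And>i. ((\<lambda>t. W t i) \<longlongrightarrow> v i) L"
    for k x v X W and L :: "('a \<times> (nat \<Rightarrow> 'a)) filter"
    by (cases "k = 0"; cases "k = 1") (simp_all add: lim that)
  show "(if k = 0 then l x else if k = 1 then l (v 0) else 0) \<in> F" if "x \<in> U" "\<And>i. v i \<in> E" for k x v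
    using that l(3) openin_imp_subset[OF U] subspace_0[OF F] by auto
qed simp

lemma smooth_on_Pair:
  assumes E: "subspace E" and f: "smooth_on E F U f" and g: "smooth_on E H U g"
  shows "smooth_on E (F \<times> H) U (\<lambda>x. (f x, g x))"
proof (rule smooth_on_derivativesI[OF E smooth_on_openin[OF f],
      where d = "\<lambda>k x v. (D f k x v, D g k x v)"])
  fix k x and v :: "nat \<Rightarrow> 'a" assume x: "x \<in> U" and v: "\<And>i. v i \<in> E"
  show "(D f k x v, D g k x v) \<in> F \<times> H"
    using smooth_on_derivative_in[OF f E x v] smooth_on_derivative_in[OF g E x v] by simp
  show "((\<lambda>t::real. ((D f k (x + t *\<^sub>R v k) v, D g k (x + t *\<^sub>R v k) v) -
      (D f k x v, D g k x v)) /\<^sub>R t) \<longlongrightarrow>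
      (D f (Suc k) x v, D g (Suc k) x v)) (at 0)"
    using tendsto_Pair[OF smooth_on_has_derivative(1)[OF f E x v] smooth_on_has_derivative(1)[OF g E x v]]
    by simp
qed (auto intro!: tendsto_Pair smooth_on_tendsto[OF f] smooth_on_tendsto[OF g])

text \<open>Limits in the product topology are entrywise, so no uniformity in the index is
  required.\<close>

lemma smooth_on_coordinatewise:
  fixes f :: "'e::locally_convex_space \<Rightarrow> 'i \<Rightarrow> 'f::locally_convex_space"
  assumes E: "subspace E" and U: "openin (top_of_set E) U"
    and f: "\<And>i. smooth_on E (F i) U (\<lambda>x. f x i)"
  shows "smooth_on E {w. \<forall>i. w i \<in> F i} U f"
proof (rule smooth_on_derivativesI[OF E U, where d = "\<lambda>k x v i. D (\<lambda>x. f x i) k x v"])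
  fix k x and v :: "nat \<Rightarrow> 'e" assume x: "x \<in> U" and v: "\<And>i. v i \<in> E"
  show "(\<lambda>i. D (\<lambda>x. f x i) k x v) \<in> {w. \<forall>i. w i \<in> F i}"
    using smooth_on_derivative_in[OF f E x v] by simp
  show "((\<lambda>t::real. ((\<lambda>i. D (\<lambda>x. f x i) k (x + t *\<^sub>R v k) v) -
      (\<lambda>i. D (\<lambda>x. f x i) k x v)) /\<^sub>R t) \<longlongrightarrow>
      (\<lambda>i. D (\<lambda>x. f x i) (Suc k) x v)) (at 0)"
    using smooth_on_has_derivative(1)[OF f E x v]
    by (intro tendsto_coordinatewiseI) (simp add: scaleR_fun_def)
qed (auto intro!: tendsto_coordinatewiseI smooth_on_tendsto[OF f])

lemma power_space_alt: "power_space p E = {w. \<forall>i. w i \<in> (if i < p then E else {0})}"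
proof (rule Set.set_eqI)
  fix w :: "nat \<Rightarrow> 'a"
  show "w \<in> power_space p E \<longleftrightarrow> w \<in> {w. \<forall>i. w i \<in> (if i < p then E else {0})}"
    unfolding power_space_def mem_Collect_eq by (metis insertE empty_iff insertI1 not_less)
qed

lemma subspace_power_space:
  fixes E :: "'e::real_vector set"
  shows "subspace E \<Longrightarrow> subspace (power_space p E)"
  by (auto simp: power_space_def subspace_def scaleR_fun_def)

lemma smooth_on_tuple:
  fixes f :: "'e::locally_convex_space \<Rightarrow> nat \<Rightarrow> 'f::locally_convex_space"
  assumes E: "subspace E" and U: "openin (top_of_set E) U"
    and f: "\<And>i. i < p \<Longrightarrow> smooth_on E F U (\<lambda>x. f x i)" and "\<And>i x. p \<le> i \<Longrightarrow> x \<in> U \<Longrightarrow> f x i = 0"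
  shows "smooth_on E (power_space p F) U f"
  unfolding power_space_alt
proof (rule smooth_on_coordinatewise[OF E U])
  fix i
  show "smooth_on E (if i < p then F else {0}) U (\<lambda>x. f x i)"
  proof (cases "i < p")
    case False
    have "smooth_on E {0} U (\<lambda>x. 0::'f)"
      by (rule smooth_on_const[OF E _ U]) auto
    then have "smooth_on E {0} U (\<lambda>x. f x i)"
      by (rule smooth_on_cong[OF _ E]) (use False assms(4) in auto)
    with False show ?thesis by simp
  qed (simp add: f)
qed

section \<open>Smooth maps between manifolds\<close>

text \<open>Composing smooth maps does not need compatible charts, only a cover by injective charts that
  are open maps; this weaker property is easily inherited by products.\<close>

definition charted :: "('m, 'e::locally_convex_space) manifold \<Rightarrow> bool"
  where "charted M \<longleftrightarrow> subspace (model M) \<and> (\<Union>(U, \<phi>)\<in>atlas M. U) = topspace (topo M) \<and>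
    (\<forall>(U, \<phi>)\<in>atlas M. openin (topo M) U \<and> inj_on \<phi> U \<and>
      (\<forall>W. openin (topo M) W \<longrightarrow> openin (top_of_set (model M)) (\<phi> ` (U \<inter> W))))"

lemma chartedI:
  assumes "subspace (model M)" "(\<Union>(U, \<phi>)\<in>atlas M. U) = topspace (topo M)"
    and "\<And>U \<phi>. (U, \<phi>) \<in> atlas M \<Longrightarrow> openin (topo M) U"
    and "\<And>U \<phi>. (U, \<phi>) \<in> atlas M \<Longrightarrow> inj_on \<phi> U"
    and "\<And>U \<phi> W. (U, \<phi>) \<in> atlas M \<Longrightarrow> openin (topo M) W \<Longrightarrow>
      openin (top_of_set (model M)) (\<phi> ` (U \<inter> W))"
  shows "charted M"
  using assms unfolding charted_def by auto

lemma charted_subspace: "charted M \<Longrightarrow> subspace (model M)"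
  by (simp add: charted_def)

lemma charted_chart:
  assumes "charted M" "(U, \<phi>) \<in> atlas M"
  shows "openin (topo M) U" "inj_on \<phi> U"
    "openin (topo M) W \<Longrightarrow> openin (top_of_set (model M)) (\<phi> ` (U \<inter> W))"
  using assms by (auto simp: charted_def)

lemma charted_cover:
  assumes "charted M" "x \<in> topspace (topo M)"
  obtains U \<phi> where "(U, \<phi>) \<in> atlas M" "x \<in> U"
proof -
  have "x \<in> (\<Union>(U, \<phi>)\<in>atlas M. U)" using assms by (simp add: charted_def)
  then show ?thesis using that by auto
qed

lemma smooth_manifold_charted:
  assumes "smooth_manifold M"
  shows "charted M"
proof -
  have "openin (top_of_set (model M)) (\<phi> ` (U \<inter> W))" "inj_on \<phi> U" "openin (topo M) U"
    if "(U, \<phi>) \<in> atlas M" "openin (topo M) W" for U \<phi> W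
  proof -
    have U: "openin (topo M) U" "openin (top_of_set (model M)) (\<phi> ` U)"
      "homeomorphic_map (subtopology (topo M) U) (top_of_set (\<phi> ` U)) \<phi>"
      using assms that unfolding smooth_manifold_def by auto
    have top: "topspace (subtopology (topo M) U) = U"
      using openin_subset[OF U(1)] by (auto simp: topspace_subtopology)
    show "inj_on \<phi> U" using homeomorphic_imp_injective_map[OF U(3)] top by simp
    have "openin (subtopology (topo M) U) (U \<inter> W)"
      using that(2) by (simp add: openin_subtopology_Int2)
    then have "openin (top_of_set (\<phi> ` U)) (\<phi> ` (U \<inter> W))"
      using homeomorphic_imp_open_map[OF U(3)] by (simp add: open_map_def)
    then show "openin (top_of_set (model M)) (\<phi> ` (U \<inter> W))"
      using U(2) openin_trans by blast
    show "openin (topo M) U" by (rule U)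
  qed
  then show ?thesis
    using assms unfolding charted_def smooth_manifold_def by fast
qed

text \<open>Local representatives contain \<open>inv_into U \<phi>\<close>. This lets their
  smoothness be checked on any formula \<open>h\<close> in the chart coordinate that agrees with
  them on the image of \<open>S\<close>.\<close>

lemma smooth_on_chart_cong:
  assumes "subspace E" "inj_on \<phi> U" "smooth_on E F (\<phi> ` S) h" "S \<subseteq> U" "\<And>x. x \<in> S \<Longrightarrow> h (\<phi> x) = k x"
  shows "smooth_on E F (\<phi> ` S) (k \<circ> inv_into U \<phi>)"
proof (rule smooth_on_cong[OF assms(3,1)])
  fix y assume "y \<in> \<phi> ` S"
  then obtain x where x: "x \<in> S" "y = \<phi> x" by auto
  then have "inv_into U \<phi> y = x" using assms(2,4) by auto
  then show "h y = (k \<circ> inv_into U \<phi>) y" using x assms(5) by simp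
qed

lemma smooth_map_on_openin_chart:
  assumes "smooth_map_on M M' W f" "(U, \<phi>) \<in> atlas M" "(V, \<psi>) \<in> atlas M'"
  shows "openin (top_of_set (model M)) (\<phi> ` {x \<in> U \<inter> W. f x \<in> V})"
    and "smooth_on (model M) (model M') (\<phi> ` {x \<in> U \<inter> W. f x \<in> V}) (\<psi> \<circ> f \<circ> inv_into U \<phi>)"
proof -
  show *: "smooth_on (model M) (model M') (\<phi> ` {x \<in> U \<inter> W. f x \<in> V}) (\<psi> \<circ> f \<circ> inv_into U \<phi>)"
    using assms unfolding smooth_map_on_def by fast
  show "openin (top_of_set (model M)) (\<phi> ` {x \<in> U \<inter> W. f x \<in> V})"
    by (rule smooth_on_openin[OF *])
qed

lemma smooth_map_on_subset:
  assumes M: "charted M" and f: "smooth_map_on M M' W f" and W': "openin (topo M) W'" "W' \<subseteq> W"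
  shows "smooth_map_on M M' W' f"
  unfolding smooth_map_on_def
proof (intro conjI; clarify?)
  show "continuous_map (subtopology (topo M) W') (topo M') f"
    using f W'(2) unfolding smooth_map_on_def by (blast intro: continuous_map_from_subtopology_mono)
  fix U \<phi> V \<psi> assume charts: "(U, \<phi>) \<in> atlas M" "(V, \<psi>) \<in> atlas M'"
  have "\<phi> ` {x \<in> U \<inter> W'. f x \<in> V} = \<phi> ` {x \<in> U \<inter> W. f x \<in> V} \<inter> \<phi> ` (U \<inter> W')"
    using charted_chart(2)[OF M charts(1)] W'(2) by (auto simp: inj_on_def)
  then have "openin (top_of_set (model M)) (\<phi> ` {x \<in> U \<inter> W'. f x \<in> V})"
    using smooth_map_on_openin_chart(1)[OF f charts] charted_chart(3)[OF M charts(1) W'(1)]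
    by (simp add: openin_Int)
  then show "smooth_on (model M) (model M') (\<phi> ` {x \<in> U \<inter> W'. f x \<in> V}) (\<psi> \<circ> f \<circ> inv_into U \<phi>)"
    by (rule smooth_on_open_subset[OF smooth_map_on_openin_chart(2)[OF f charts]]) (use W'(2) in auto)
qed

lemma smooth_map_on_cong:
  assumes M: "charted M" and f: "smooth_map_on M M' W f" and eq: "\<And>x. x \<in> W \<Longrightarrow> f x = g x"
  shows "smooth_map_on M M' W g"
  unfolding smooth_map_on_def
proof (intro conjI; clarify?)
  show "continuous_map (subtopology (topo M) W) (topo M') g"
    using f eq unfolding smooth_map_on_def
    by (auto intro: continuous_map_eq simp: topspace_subtopology)
  fix U \<phi> V \<psi> assume charts: "(U, \<phi>) \<in> atlas M" "(V, \<psi>) \<in> atlas M'"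
  have "{x \<in> U \<inter> W. g x \<in> V} = {x \<in> U \<inter> W. f x \<in> V}" using eq by auto
  then show "smooth_on (model M) (model M') (\<phi> ` {x \<in> U \<inter> W. g x \<in> V}) (\<psi> \<circ> g \<circ> inv_into U \<phi>)"
    using smooth_on_chart_cong[OF charted_subspace[OF M] charted_chart(2)[OF M charts(1)]
        smooth_map_on_openin_chart(2)[OF f charts], of "\<psi> \<circ> g"] eq
      charted_chart(2)[OF M charts(1)]
    by (auto simp: inv_into_f_f)
qed

text \<open>The local representative of the composite is a composition in model spaces only where
  \<open>f\<close> lands in the domain of one chart of \<open>M'\<close>. These pieces are open and
  cover the domain, so smoothness is glued from them.\<close>

lemma smooth_map_on_compose:
  fixes M' :: "('n, 'f::locally_convex_space) manifold"
  assumes M: "charted M" and M': "charted M'" and M3: "subspace (model M3)"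
    and f: "smooth_map_on M M' W f" and g: "smooth_map_on M' M3 W' g" and fW: "f ` W \<subseteq> W'"
    and W: "openin (topo M) W"
  shows "smooth_map_on M M3 W (\<lambda>x. g (f x))"
  unfolding smooth_map_on_def
proof (intro conjI; clarify?)
  have "continuous_map (subtopology (topo M) W) (subtopology (topo M') W') f"
    using f fW unfolding smooth_map_on_def
    by (auto intro!: continuous_map_into_subtopology simp: topspace_subtopology)
  moreover have cg: "continuous_map (subtopology (topo M') W') (topo M3) g"
    using g unfolding smooth_map_on_def by auto
  ultimately show "continuous_map (subtopology (topo M) W) (topo M3) (\<lambda>x. g (f x))"
    using continuous_map_compose by (fastforce simp: o_def)
  fix U \<phi> C \<xi> assume charts: "(U, \<phi>) \<in> atlas M" "(C, \<xi>) \<in> atlas M3"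
  have inj: "inj_on \<phi> U" by (rule charted_chart(2)[OF M charts(1)])
  define S where "S c = {x \<in> U \<inter> W. f x \<in> fst c \<and> g (f x) \<in> C}" for c :: "'n set \<times> ('n \<Rightarrow> 'f)"
  have "smooth_on (model M) (model M3) (\<phi> ` S c) (\<xi> \<circ> (\<lambda>x. g (f x)) \<circ> inv_into U \<phi>)" if c: "c \<in> atlas M'" for c
  proof -
    obtain V \<psi> where c_eq: "c = (V, \<psi>)" by (cases c)
    with c have c': "(V, \<psi>) \<in> atlas M'" by simp
    have inj': "inj_on \<psi> V" by (rule charted_chart(2)[OF M' c'])
    let ?A = "\<phi> ` {x \<in> U \<inter> W. f x \<in> V}" and ?B = "\<psi> ` {y \<in> V \<inter> W'. g y \<in> C}"
    let ?h = "\<psi> \<circ> f \<circ> inv_into U \<phi>" and ?k = "\<xi> \<circ> g \<circ> inv_into V \<psi>"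
    note h = smooth_map_on_openin_chart(2)[OF f charts(1) c']
    note k = smooth_map_on_openin_chart(2)[OF g c' charts(2)]
    \<comment> \<open>Injectivity of both charts writes the piece as a preimage under the continuous
      local representative of \<open>f\<close>; this is what makes it open.\<close>
    have S_eq: "\<phi> ` S c = ?A \<inter> ?h -` ?B"
    proof (intro subset_antisym subsetI)
      fix y assume "y \<in> \<phi> ` S c"
      then show "y \<in> ?A \<inter> ?h -` ?B" using fW inj by (auto simp: S_def c_eq)
    next
      fix y assume "y \<in> ?A \<inter> ?h -` ?B"
      then obtain x where x: "x \<in> U" "x \<in> W" "f x \<in> V" "y = \<phi> x" "?h y \<in> ?B" by auto
      then have "\<psi> (f x) \<in> ?B" using inj by simp
      then have "g (f x) \<in> C" using inj' x(3) by (auto simp: inj_on_def)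
      then show "y \<in> \<phi> ` S c" using x by (auto simp: S_def c_eq)
    qed
    have "openin (top_of_set ?A) (?A \<inter> ?h -` ?B)"
      using smooth_on_image[OF h]
      by (intro continuous_openin_preimage[OF smooth_on_continuous[OF h] _ smooth_on_openin[OF k]]) auto
    then have op: "openin (top_of_set (model M)) (\<phi> ` S c)"
      unfolding S_eq using smooth_on_openin[OF h] openin_trans by blast
    have "smooth_on (model M) (model M3) (\<phi> ` S c) (\<lambda>y. ?k (?h y))"
    proof (rule smooth_on_compose[OF charted_subspace[OF M] charted_subspace[OF M'] M3 _ k])
      show "smooth_on (model M) (model M') (\<phi> ` S c) ?h"
        by (rule smooth_on_open_subset[OF h op]) (simp add: S_eq)
      show "?h ` \<phi> ` S c \<subseteq> ?B" unfolding S_eq by auto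
    qed
    then show ?thesis
      by (rule smooth_on_chart_cong[OF charted_subspace[OF M] inj])
        (use inj inj' in \<open>auto simp: S_def c_eq\<close>)
  qed
  then have "smooth_on (model M) (model M3) (\<Union>c\<in>atlas M'. \<phi> ` S c) (\<xi> \<circ> (\<lambda>x. g (f x)) \<circ> inv_into U \<phi>)"
    by (intro smooth_on_UN charted_subspace M)
  moreover have "(\<Union>c\<in>atlas M'. \<phi> ` S c) = \<phi> ` {x \<in> U \<inter> W. g (f x) \<in> C}"
  proof -
    have "f x \<in> topspace (topo M')" if "x \<in> W" for x
      using f that openin_subset[OF W] unfolding smooth_map_on_def continuous_map_def
      by (auto simp: topspace_subtopology)
    then have "\<exists>c\<in>atlas M'. f x \<in> fst c" if "x \<in> W" for x
      using charted_cover[OF M'] that by (metis fst_conv)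
    then show ?thesis by (fastforce simp: S_def)
  qed
  ultimately show "smooth_on (model M) (model M3) (\<phi> ` {x \<in> U \<inter> W. g (f x) \<in> C})
      (\<xi> \<circ> (\<lambda>x. g (f x)) \<circ> inv_into U \<phi>)" by simp
qed

subsection \<open>Products\<close>

lemma prod_manifold_simps [simp]:
  "topo (prod_manifold M M') = prod_topology (topo M) (topo M')"
  "model (prod_manifold M M') = model M \<times> model M'"
  "atlas (prod_manifold M M') =
    {(U \<times> V, map_prod \<phi> \<psi>) | U \<phi> V \<psi>. (U, \<phi>) \<in> atlas M \<and> (V, \<psi>) \<in> atlas M'}"
  by (simp_all add: prod_manifold_def)

lemma power_manifold_simps [simp]:
  "topo (power_manifold p M) = product_topology (\<lambda>_. topo M) {..<p}"
  "model (power_manifold p M) = power_space p (model M)"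
  "atlas (power_manifold p M) = {(\<Pi>\<^sub>E i\<in>{..<p}. U i, \<lambda>x i. if i < p then \<phi> i (x i) else 0) | U \<phi>.
       \<forall>i<p. (U i, \<phi> i) \<in> atlas M}"
  by (simp_all add: power_manifold_def)

lemma charted_prod_manifold:
  assumes M: "charted M" and M': "charted M'"
  shows "charted (prod_manifold M M')"
proof (rule chartedI)
  show "subspace (model (prod_manifold M M'))"
    using charted_subspace[OF M] charted_subspace[OF M'] by (simp add: subspace_Times)
  show "(\<Union>(U, \<phi>)\<in>atlas (prod_manifold M M'). U) = topspace (topo (prod_manifold M M'))" (is "?L = ?R")
  proof (intro subset_antisym subsetI)
    fix z assume "z \<in> ?L"
    then show "z \<in> ?R"
      using charted_chart(1)[OF M, THEN openin_subset] charted_chart(1)[OF M', THEN openin_subset]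
      by fastforce
  next
    fix z assume "z \<in> ?R"
    then have z: "fst z \<in> topspace (topo M)" "snd z \<in> topspace (topo M')" by auto
    obtain U \<phi> where U: "(U, \<phi>) \<in> atlas M" "fst z \<in> U" by (rule charted_cover[OF M z(1)])
    obtain V \<psi> where V: "(V, \<psi>) \<in> atlas M'" "snd z \<in> V" by (rule charted_cover[OF M' z(2)])
    have "(U \<times> V, map_prod \<phi> \<psi>) \<in> atlas (prod_manifold M M')" using U V by auto
    moreover have "z \<in> U \<times> V" using U V by (cases z) auto
    ultimately show "z \<in> ?L" by blast
  qed
  fix UV \<theta> assume "(UV, \<theta>) \<in> atlas (prod_manifold M M')"
  then obtain U \<phi> V \<psi> where UV: "UV = U \<times> V" "\<theta> = map_prod \<phi> \<psi>" "(U, \<phi>) \<in> atlas M" "(V, \<psi>) \<in> atlas M'"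
    by auto
  note c = charted_chart[OF M UV(3)] and c' = charted_chart[OF M' UV(4)]
  show "openin (topo (prod_manifold M M')) UV"
    using c(1) c'(1) by (simp add: UV openin_prod_Times_iff)
  show "inj_on \<theta> UV"
    unfolding UV by (rule map_prod_inj_on[OF c(2) c'(2)])
  fix W assume W: "openin (topo (prod_manifold M M')) W"
  show "openin (top_of_set (model (prod_manifold M M'))) (\<theta> ` (UV \<inter> W))"
  proof (subst openin_subopen, intro ballI)
    fix y assume "y \<in> \<theta> ` (UV \<inter> W)"
    then obtain a b where ab: "a \<in> U" "b \<in> V" "(a, b) \<in> W" "y = (\<phi> a, \<psi> b)" by (auto simp: UV)
    obtain A B where AB: "openin (topo M) A" "openin (topo M') B" "a \<in> A" "b \<in> B" "A \<times> B \<subseteq> W"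
      using W[unfolded prod_manifold_simps openin_prod_topology_alt, rule_format, OF ab(3)] by auto
    have "openin (top_of_set (model (prod_manifold M M'))) (\<phi> ` (U \<inter> A) \<times> \<psi> ` (V \<inter> B))"
      using c(3)[OF AB(1)] c'(3)[OF AB(2)] by (simp add: openin_Times)
    moreover have "\<phi> ` (U \<inter> A) \<times> \<psi> ` (V \<inter> B) \<subseteq> \<theta> ` (UV \<inter> W)"
      using AB(5) by (force simp: UV)
    ultimately show "\<exists>T. openin (top_of_set (model (prod_manifold M M'))) T \<and> y \<in> T \<and> T \<subseteq> \<theta> ` (UV \<inter> W)"
      using ab AB by blast
  qed
qed

lemma charted_power_manifold:
  fixes M :: "('m, 'e::locally_convex_space) manifold"
  assumes M: "charted M"
  shows "charted (power_manifold p M)"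
proof (rule chartedI)
  show "subspace (model (power_manifold p M))"
    using charted_subspace[OF M] by (simp add: subspace_power_space)
  show "(\<Union>(U, \<phi>)\<in>atlas (power_manifold p M). U) = topspace (topo (power_manifold p M))" (is "?L = ?R")
  proof (intro subset_antisym subsetI)
    fix z assume "z \<in> ?L"
    then obtain U \<phi> where U: "\<forall>i<p. (U i, \<phi> i) \<in> atlas M" "z \<in> (\<Pi>\<^sub>E i\<in>{..<p}. U i)" by auto
    have "U i \<subseteq> topspace (topo M)" if "i < p" for i
      using U(1) that charted_chart(1)[OF M] openin_subset by blast
    then show "z \<in> ?R" using U(2) by (auto simp: PiE_iff)
  next
    fix z assume "z \<in> ?R"
    then have z: "\<forall>i<p. z i \<in> topspace (topo M)" "z \<in> extensional {..<p}" by (auto simp: PiE_iff)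
    have "\<forall>i. \<exists>U \<phi>. i < p \<longrightarrow> (U, \<phi>) \<in> atlas M \<and> z i \<in> U"
      using z(1) charted_cover[OF M] by metis
    then obtain U \<phi> where U: "\<And>i. i < p \<Longrightarrow> (U i, \<phi> i) \<in> atlas M" "\<And>i. i < p \<Longrightarrow> z i \<in> U i" by metis
    have "(\<Pi>\<^sub>E i\<in>{..<p}. U i, \<lambda>x i. if i < p then \<phi> i (x i) else 0) \<in> atlas (power_manifold p M)"
      unfolding power_manifold_simps using U(1) by blast
    moreover have "z \<in> (\<Pi>\<^sub>E i\<in>{..<p}. U i)" using U(2) z(2) by (auto simp: PiE_iff)
    ultimately show "z \<in> ?L" by blast
  qed
  fix UU \<theta> assume "(UU, \<theta>) \<in> atlas (power_manifold p M)"
  then obtain U \<phi> where U: "UU = (\<Pi>\<^sub>E i\<in>{..<p}. U i)" "\<theta> = (\<lambda>x i. if i < p then \<phi> i (x i) else 0)"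
      "\<And>i. i < p \<Longrightarrow> (U i, \<phi> i) \<in> atlas M"
    by auto
  note c = charted_chart[OF M U(3)]
  show "openin (topo (power_manifold p M)) UU"
    using c(1) by (auto simp: U(1) openin_PiE_gen)
  show "inj_on \<theta> UU"
  proof (rule inj_onI)
    fix x y assume xy: "x \<in> UU" "y \<in> UU" "\<theta> x = \<theta> y"
    have "x i = y i" if "i < p" for i
      using fun_cong[OF xy(3), of i] that xy(1,2) c(2)[OF that] by (auto simp: U(1,2) PiE_iff inj_on_def)
    then show "x = y" using xy(1,2) unfolding U(1) by (intro PiE_ext) auto
  qed
  fix W assume W: "openin (topo (power_manifold p M)) W"
  show "openin (top_of_set (model (power_manifold p M))) (\<theta> ` (UU \<inter> W))"
  proof (subst openin_subopen, intro ballI)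
    fix y assume "y \<in> \<theta> ` (UU \<inter> W)"
    then obtain x where x: "x \<in> UU" "x \<in> W" "y = \<theta> x" by auto
    obtain A where A: "\<And>i. i < p \<Longrightarrow> openin (topo M) (A i)" "x \<in> Pi\<^sub>E {..<p} A" "Pi\<^sub>E {..<p} A \<subseteq> W"
    proof -
      from W x(2) obtain A where "\<forall>i\<in>{..<p}. openin (topo M) (A i)" "x \<in> Pi\<^sub>E {..<p} A" "Pi\<^sub>E {..<p} A \<subseteq> W"
        unfolding power_manifold_simps openin_product_topology_alt by meson
      then show ?thesis by (intro that[of A]) (simp_all only: lessThan_iff Ball_def)
    qed
    have "\<forall>i. \<exists>T. i < p \<longrightarrow> open T \<and> \<phi> i ` (U i \<inter> A i) = model M \<inter> T"
      using c(3)[OF _ A(1)] by (auto simp: openin_open)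
    then obtain T where T: "\<And>i. i < p \<Longrightarrow> open (T i)"
        "\<And>i. i < p \<Longrightarrow> \<phi> i ` (U i \<inter> A i) = model M \<inter> T i" by metis
    \<comment> \<open>Only the coordinates below \<open>p\<close> are constrained, and these are
      finitely many, so the box is relatively open in the model.\<close>
    let ?S = "power_space p (model M) \<inter> (\<Inter>i\<in>{..<p}. (\<lambda>v. v i) -` T i)"
    have "open (\<Inter>i\<in>{..<p}. (\<lambda>v::nat \<Rightarrow> 'e. v i) -` T i)"
      using T(1) by (intro open_INT) (auto intro: open_vimage_coordinate)
    then have "openin (top_of_set (model (power_manifold p M))) ?S"
      by (auto simp: openin_open)
    moreover have "y \<in> ?S"
    proof -
      have "\<phi> i (x i) \<in> model M \<inter> T i" if "i < p" for i
        unfolding T(2)[OF that, symmetric] using x(1) A(2) that by (auto simp: U(1) PiE_iff)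
      then show ?thesis using x(3) by (auto simp: U(2) power_space_def)
    qed
    moreover have "?S \<subseteq> \<theta> ` (UU \<inter> W)"
    proof
      fix v assume v: "v \<in> ?S"
      then have "v i \<in> \<phi> i ` (U i \<inter> A i)" if "i < p" for i
        using that by (auto simp: T(2) power_space_def)
      then have "\<forall>i. \<exists>a. i < p \<longrightarrow> a \<in> U i \<inter> A i \<and> v i = \<phi> i a" by blast
      then obtain a where a: "\<And>i. i < p \<Longrightarrow> a i \<in> U i \<inter> A i" "\<And>i. i < p \<Longrightarrow> v i = \<phi> i (a i)" by metis
      have "restrict a {..<p} \<in> Pi\<^sub>E {..<p} A" using a(1) by auto
      then have "restrict a {..<p} \<in> W" using A(3) by blast
      then have "restrict a {..<p} \<in> UU \<inter> W" using a(1) by (auto simp: U(1))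
      moreover have "v = \<theta> (restrict a {..<p})"
        using a(2) v by (auto simp: U(2) power_space_def fun_eq_iff)
      ultimately show "v \<in> \<theta> ` (UU \<inter> W)" by blast
    qed
    ultimately show "\<exists>T. openin (top_of_set (model (power_manifold p M))) T \<and> y \<in> T \<and> T \<subseteq> \<theta> ` (UU \<inter> W)"
      by blast
  qed
qed

subsection \<open>Smoothness near a point\<close>

lemma smooth_nearI:
  "openin (topo M) W \<Longrightarrow> x \<in> W \<Longrightarrow> smooth_map_on M M' W f \<Longrightarrow> smooth_near M M' x f"
  unfolding smooth_near_def by blast

lemma smooth_near_in_topspace: "smooth_near M M' x f \<Longrightarrow> x \<in> topspace (topo M)"
  unfolding smooth_near_def using openin_subset by blast

lemma smooth_near_range:
  assumes "smooth_near M M' x f"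
  shows "f x \<in> topspace (topo M')"
proof -
  obtain W where W: "openin (topo M) W" "x \<in> W" "smooth_map_on M M' W f"
    using assms unfolding smooth_near_def by auto
  then have "x \<in> topspace (subtopology (topo M) W)" using openin_subset by (auto simp: topspace_subtopology)
  then show ?thesis using W(3) unfolding smooth_map_on_def continuous_map_def by auto
qed

lemma smooth_map_near:
  "smooth_map M M' f \<Longrightarrow> x \<in> topspace (topo M) \<Longrightarrow> smooth_near M M' x f"
  unfolding smooth_map_def smooth_near_def by blast

lemma smooth_near_cong:
  assumes M: "charted M" and f: "smooth_near M M' x f"
    and V: "openin (topo M) V" "x \<in> V" "\<And>y. y \<in> V \<Longrightarrow> f y = g y"
  shows "smooth_near M M' x g"
proof -
  obtain W where W: "openin (topo M) W" "x \<in> W" "smooth_map_on M M' W f"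
    using f unfolding smooth_near_def by auto
  have "smooth_map_on M M' (W \<inter> V) g"
    by (rule smooth_map_on_cong[OF M smooth_map_on_subset[OF M W(3)]]) (use W V in auto)
  then show ?thesis using W V by (intro smooth_nearI[of _ "W \<inter> V"]) auto
qed

lemma smooth_near_cong_topspace:
  assumes "charted M" "smooth_near M M' x f" "\<And>y. y \<in> topspace (topo M) \<Longrightarrow> f y = g y"
  shows "smooth_near M M' x g"
  by (rule smooth_near_cong[OF assms(1,2) openin_topspace smooth_near_in_topspace[OF assms(2)] assms(3)])

lemma smooth_near_compose:
  assumes M: "charted M" and M': "charted M'" and M3: "subspace (model M3)"
    and f: "smooth_near M M' x f" and g: "smooth_near M' M3 (f x) g"
  shows "smooth_near M M3 x (\<lambda>x. g (f x))"
proof -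
  obtain W where W: "openin (topo M) W" "x \<in> W" "smooth_map_on M M' W f"
    using f unfolding smooth_near_def by auto
  obtain W' where W': "openin (topo M') W'" "f x \<in> W'" "smooth_map_on M' M3 W' g"
    using g unfolding smooth_near_def by auto
  have "continuous_map (subtopology (topo M) W) (topo M') f"
    using W(3) unfolding smooth_map_on_def by auto
  from openin_continuous_map_preimage[OF this W'(1)]
  moreover have "{y \<in> topspace (subtopology (topo M) W). f y \<in> W'} = {y \<in> W. f y \<in> W'}"
    using openin_subset[OF W(1)] by (auto simp: topspace_subtopology)
  ultimately have op: "openin (subtopology (topo M) W) {y \<in> W. f y \<in> W'}"
    by simp
  then have op: "openin (topo M) {y \<in> W. f y \<in> W'}"
    using W(1) openin_trans_full by blast
  show ?thesis
  proof (rule smooth_nearI[OF op])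
    show "x \<in> {y \<in> W. f y \<in> W'}" using W W' by auto
    show "smooth_map_on M M3 {y \<in> W. f y \<in> W'} (\<lambda>x. g (f x))"
      by (rule smooth_map_on_compose[OF M M' M3 smooth_map_on_subset[OF M W(3) op] W'(3) _ op]) auto
  qed
qed

lemma smooth_near_const:
  assumes M: "charted M" and M': "charted M'" and x: "x \<in> topspace (topo M)" and c: "c \<in> topspace (topo M')"
  shows "smooth_near M M' x (\<lambda>_. c)"
proof (rule smooth_nearI[OF openin_topspace x])
  show "smooth_map_on M M' (topspace (topo M)) (\<lambda>_. c)"
    unfolding smooth_map_on_def
  proof (intro conjI; clarify?)
    show "continuous_map (subtopology (topo M) (topspace (topo M))) (topo M') (\<lambda>_. c)"
      using c by simp
    fix U \<phi> V \<psi> assume charts: "(U, \<phi>) \<in> atlas M" "(V, \<psi>) \<in> atlas M'"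
    let ?S = "\<phi> ` {x \<in> U \<inter> topspace (topo M). c \<in> V}"
    have "openin (top_of_set (model M)) (\<phi> ` (U \<inter> topspace (topo M)))"
      by (rule charted_chart(3)[OF M charts(1) openin_topspace])
    moreover have "?S = (if c \<in> V then \<phi> ` (U \<inter> topspace (topo M)) else {})" by auto
    ultimately have op: "openin (top_of_set (model M)) ?S" by simp
    have "\<psi> c \<in> model M'" if "c \<in> V"
    proof -
      have "\<psi> ` (V \<inter> topspace (topo M')) \<subseteq> model M'"
        using charted_chart(3)[OF M' charts(2) openin_topspace] openin_imp_subset by blast
      then show ?thesis using that c by auto
    qed
    then have "smooth_on (model M) (model M') ?S (\<lambda>_. if c \<in> V then \<psi> c else 0)"
      using charted_subspace[OF M'] subspace_0[OF charted_subspace[OF M']]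
      by (intro smooth_on_const charted_subspace M op) (auto intro: M')
    then show "smooth_on (model M) (model M') ?S (\<psi> \<circ> (\<lambda>_. c) \<circ> inv_into U \<phi>)"
      by (rule smooth_on_cong[OF _ charted_subspace[OF M]]) auto
  qed
qed

lemma smooth_near_Pair:
  assumes M: "charted M" and f: "smooth_near M M1 x f" and g: "smooth_near M M2 x g"
  shows "smooth_near M (prod_manifold M1 M2) x (\<lambda>x. (f x, g x))"
proof -
  obtain Wf where Wf: "openin (topo M) Wf" "x \<in> Wf" "smooth_map_on M M1 Wf f"
    using f unfolding smooth_near_def by auto
  obtain Wg where Wg: "openin (topo M) Wg" "x \<in> Wg" "smooth_map_on M M2 Wg g"
    using g unfolding smooth_near_def by auto
  define W where "W = Wf \<inter> Wg"
  have W: "openin (topo M) W" using Wf Wg by (auto simp: W_def)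
  have f': "smooth_map_on M M1 W f" and g': "smooth_map_on M M2 W g"
    using smooth_map_on_subset[OF M Wf(3) W] smooth_map_on_subset[OF M Wg(3) W] by (auto simp: W_def)
  have "smooth_map_on M (prod_manifold M1 M2) W (\<lambda>x. (f x, g x))"
    unfolding smooth_map_on_def
  proof (intro conjI; clarify?)
    show "continuous_map (subtopology (topo M) W) (topo (prod_manifold M1 M2)) (\<lambda>x. (f x, g x))"
      using f' g' by (simp add: smooth_map_on_def continuous_map_pairedI)
    fix U \<phi> VV \<theta> assume charts: "(U, \<phi>) \<in> atlas M" "(VV, \<theta>) \<in> atlas (prod_manifold M1 M2)"
    then obtain V1 \<psi>1 V2 \<psi>2 where V: "VV = V1 \<times> V2" "\<theta> = map_prod \<psi>1 \<psi>2"
        "(V1, \<psi>1) \<in> atlas M1" "(V2, \<psi>2) \<in> atlas M2" by auto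
    note cf = smooth_map_on_openin_chart[OF f' charts(1) V(3)]
    note cg = smooth_map_on_openin_chart[OF g' charts(1) V(4)]
    let ?S = "\<phi> ` {x \<in> U \<inter> W. (f x, g x) \<in> VV}"
    note inj = charted_chart(2)[OF M charts(1)]
    have S: "?S = \<phi> ` {x \<in> U \<inter> W. f x \<in> V1} \<inter> \<phi> ` {x \<in> U \<inter> W. g x \<in> V2}"
      using inj by (auto simp: V inj_on_def)
    have op: "openin (top_of_set (model M)) ?S" unfolding S using cf(1) cg(1) by (rule openin_Int)
    have "smooth_on (model M) (model M1 \<times> model M2) ?S
        (\<lambda>y. ((\<psi>1 \<circ> f \<circ> inv_into U \<phi>) y, (\<psi>2 \<circ> g \<circ> inv_into U \<phi>) y))"
      by (intro smooth_on_Pair charted_subspace M smooth_on_open_subset[OF cf(2) op]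
          smooth_on_open_subset[OF cg(2) op]) (auto simp: V)
    then show "smooth_on (model M) (model (prod_manifold M1 M2)) ?S (\<theta> \<circ> (\<lambda>x. (f x, g x)) \<circ> inv_into U \<phi>)"
      by (simp add: V comp_def)
  qed
  then show ?thesis using W Wf Wg by (intro smooth_nearI[of _ W]) (auto simp: W_def)
qed

text \<open>Common source of the identity, the projections and the coordinate maps.
  \<open>lift\<close> supplies one target chart for each source chart; every other target chart is
  reached by a transition map, which is why \<open>M'\<close> has to be a smooth manifold and not
  merely charted.\<close>

lemma smooth_map_linear_in_charts:
  assumes M: "charted M" and M': "smooth_manifold M'"
    and cont: "continuous_map (topo M) (topo M') f"
    and l: "linear l" "continuous_on UNIV l" "l ` model M \<subseteq> model M'"
    and lift: "\<And>U \<phi>. (U, \<phi>) \<in> atlas M \<Longrightarrow> \<exists>(V, \<psi>)\<in>atlas M'. \<forall>x\<in>U. f x \<in> V \<and> l (\<phi> x) = \<psi> (f x)"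
  shows "smooth_map M M' f"
  unfolding smooth_map_def smooth_map_on_def
proof (intro conjI; clarify?)
  note cM' = smooth_manifold_charted[OF M']
  show "continuous_map (subtopology (topo M) (topspace (topo M))) (topo M') f" using cont by simp
  fix U \<phi> V' \<psi>' assume charts: "(U, \<phi>) \<in> atlas M" "(V', \<psi>') \<in> atlas M'"
  obtain V \<psi> where V: "(V, \<psi>) \<in> atlas M'" "\<And>x. x \<in> U \<Longrightarrow> f x \<in> V" "\<And>x. x \<in> U \<Longrightarrow> l (\<phi> x) = \<psi> (f x)"
    using lift[OF charts(1)] by auto
  note inj = charted_chart(2)[OF M charts(1)] and inj' = charted_chart(2)[OF cM' V(1)]
  let ?S = "{x \<in> U \<inter> topspace (topo M). f x \<in> V'}"
  have "?S = U \<inter> {x \<in> topspace (topo M). f x \<in> V'}" by auto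
  then have op: "openin (top_of_set (model M)) (\<phi> ` ?S)"
    using charted_chart(3)[OF M charts(1) openin_continuous_map_preimage[OF cont charted_chart(1)[OF cM' charts(2)]]]
    by simp
  have trans: "smooth_on (model M') (model M') (\<psi> ` (V \<inter> V')) (\<psi>' \<circ> inv_into V \<psi>)"
    using M' V(1) charts(2) unfolding smooth_manifold_def by fast
  have "smooth_on (model M) (model M') (\<phi> ` ?S) (\<lambda>y. (\<psi>' \<circ> inv_into V \<psi>) (l y))"
    by (rule smooth_on_compose[OF charted_subspace[OF M] charted_subspace[OF cM'] charted_subspace[OF cM'] _ trans])
      (use smooth_on_linear[OF charted_subspace[OF M] charted_subspace[OF cM'] op l] V in auto)
  then have "smooth_on (model M) (model M') (\<phi> ` ?S) ((\<psi>' \<circ> f) \<circ> inv_into U \<phi>)"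
    by (rule smooth_on_chart_cong[OF charted_subspace[OF M] inj]) (use V inj' in auto)
  then show "smooth_on (model M) (model M') (\<phi> ` ?S) (\<psi>' \<circ> f \<circ> inv_into U \<phi>)" .
qed

lemma smooth_near_ident:
  assumes M: "smooth_manifold M" and x: "x \<in> topspace (topo M)"
  shows "smooth_near M M x (\<lambda>x. x)"
  by (rule smooth_map_near[OF smooth_map_linear_in_charts[OF smooth_manifold_charted[OF M] M,
          where l = "\<lambda>x. x"] x])
    (fastforce simp: linear_iff)+

lemma smooth_map_fst:
  assumes M: "smooth_manifold M" and M': "charted M'"
  shows "smooth_map (prod_manifold M M') M fst"
  by (rule smooth_map_linear_in_charts[OF charted_prod_manifold[OF smooth_manifold_charted[OF M] M'] M,
        where l = fst])
    (fastforce simp: continuous_map_fst linear_fst intro!: continuous_intros)+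

lemma smooth_map_snd:
  assumes M: "charted M" and M': "smooth_manifold M'"
  shows "smooth_map (prod_manifold M M') M' snd"
  by (rule smooth_map_linear_in_charts[OF charted_prod_manifold[OF M smooth_manifold_charted[OF M']] M',
        where l = snd])
    (fastforce simp: continuous_map_snd linear_snd intro!: continuous_intros)+

lemma smooth_map_coordinate:
  assumes M: "smooth_manifold M" and i: "i < p"
  shows "smooth_map (power_manifold p M) M (\<lambda>x. x i)"
proof (rule smooth_map_linear_in_charts[OF charted_power_manifold[OF smooth_manifold_charted[OF M]] M,
      where l = "\<lambda>v. v i"])
  show "continuous_map (topo (power_manifold p M)) (topo M) (\<lambda>x. x i)"
    using i continuous_map_product_projection[of i "{..<p}" "\<lambda>_. topo M"] by simp
  show "linear (\<lambda>v. v i)" by (rule linearI) (auto simp: scaleR_fun_def)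
  show "continuous_on UNIV (\<lambda>v. v i)" by (rule continuous_on_product_coordinates)
  show "(\<lambda>v. v i) ` model (power_manifold p M) \<subseteq> model M" using i by (auto simp: power_space_def)
  fix UU \<theta> assume "(UU, \<theta>) \<in> atlas (power_manifold p M)"
  then obtain U \<phi> where U: "UU = (\<Pi>\<^sub>E i\<in>{..<p}. U i)" "\<theta> = (\<lambda>x i. if i < p then \<phi> i (x i) else 0)"
      "\<And>i. i < p \<Longrightarrow> (U i, \<phi> i) \<in> atlas M"
    by auto
  show "\<exists>(V, \<psi>)\<in>atlas M. \<forall>x\<in>UU. x i \<in> V \<and> \<theta> x i = \<psi> (x i)"
    using U(3)[OF i] i by (intro bexI[of _ "(U i, \<phi> i)"]) (auto simp: U(1,2) PiE_iff)
qed

lemma smooth_near_tuple: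
  assumes M: "charted M" and x: "x \<in> topspace (topo M)"
    and f: "\<And>i. i < p \<Longrightarrow> smooth_near M M' x (\<lambda>y. f y i)"
  shows "smooth_near M (power_manifold p M') x (\<lambda>y. \<lambda>i\<in>{..<p}. f y i)"
proof -
  have "\<forall>i. \<exists>W. i < p \<longrightarrow> openin (topo M) W \<and> x \<in> W \<and> smooth_map_on M M' W (\<lambda>y. f y i)"
    using f unfolding smooth_near_def by auto
  then obtain Wi where Wi: "\<And>i. i < p \<Longrightarrow> openin (topo M) (Wi i)" "\<And>i. i < p \<Longrightarrow> x \<in> Wi i"
      "\<And>i. i < p \<Longrightarrow> smooth_map_on M M' (Wi i) (\<lambda>y. f y i)" by metis
  \<comment> \<open>Inserting the whole space keeps this an open subset when \<open>p = 0\<close>,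
    where the other sets form an empty family.\<close>
  define W where "W = \<Inter>(insert (topspace (topo M)) (Wi ` {..<p}))"
  have W: "openin (topo M) W" unfolding W_def using Wi(1) by (intro openin_Inter) auto
  have f': "smooth_map_on M M' W (\<lambda>y. f y i)" if "i < p" for i
    by (rule smooth_map_on_subset[OF M Wi(3)[OF that] W]) (use that in \<open>auto simp: W_def\<close>)
  let ?f = "\<lambda>y. \<lambda>i\<in>{..<p}. f y i"
  have "smooth_map_on M (power_manifold p M') W ?f"
    unfolding smooth_map_on_def
  proof (intro conjI; clarify?)
    have "continuous_map (subtopology (topo M) W) (topo M') (\<lambda>y. ?f y i)" if "i < p" for i
      using f'[OF that] that by (simp add: smooth_map_on_def)
    then show "continuous_map (subtopology (topo M) W) (topo (power_manifold p M')) ?f"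
      by (auto simp: continuous_map_componentwise)
    fix U \<phi> VV \<theta> assume charts: "(U, \<phi>) \<in> atlas M" "(VV, \<theta>) \<in> atlas (power_manifold p M')"
    then obtain V \<psi> where V: "VV = (\<Pi>\<^sub>E i\<in>{..<p}. V i)" "\<theta> = (\<lambda>x i. if i < p then \<psi> i (x i) else 0)"
        "\<And>i. i < p \<Longrightarrow> (V i, \<psi> i) \<in> atlas M'"
      by auto
    note c = smooth_map_on_openin_chart[OF f' charts(1) V(3)]
    note inj = charted_chart(2)[OF M charts(1)]
    let ?S = "\<phi> ` {x \<in> U \<inter> W. ?f x \<in> VV}"
    have S: "?S = \<Inter>(insert (\<phi> ` (U \<inter> W)) ((\<lambda>i. \<phi> ` {x \<in> U \<inter> W. f x i \<in> V i}) ` {..<p}))" (is "_ = ?R")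
    proof (intro subset_antisym subsetI)
      fix y assume "y \<in> ?R"
      then obtain z where z: "z \<in> U" "z \<in> W" "y = \<phi> z" by auto
      have "f z i \<in> V i" if "i < p" for i
      proof -
        have "\<phi> z \<in> \<phi> ` {x \<in> U \<inter> W. f x i \<in> V i}" using \<open>y \<in> ?R\<close> that z(3) by auto
        then show ?thesis using inj z(1) by (auto simp: inj_on_def)
      qed
      then show "y \<in> ?S" using z by (auto simp: V(1))
    qed (auto simp: V(1) PiE_iff)
    have op: "openin (top_of_set (model M)) ?S"
      unfolding S using c(1) charted_chart(3)[OF M charts(1) W] by (intro openin_Inter) auto
    have sub: "?S \<subseteq> \<phi> ` {x \<in> U \<inter> W. f x i \<in> V i}" if "i < p" for i using that by (auto simp: V(1) PiE_iff)
    show "smooth_on (model M) (model (power_manifold p M')) ?S (\<theta> \<circ> ?f \<circ> inv_into U \<phi>)"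
      unfolding power_manifold_simps
    proof (rule smooth_on_tuple[OF charted_subspace[OF M] op])
      fix i assume i: "i < p"
      show "smooth_on (model M) (model M') ?S (\<lambda>y. (\<theta> \<circ> ?f \<circ> inv_into U \<phi>) y i)"
        using smooth_on_open_subset[OF c(2)[OF i i] op sub[OF i]] i by (simp add: V(2) comp_def)
    qed (auto simp: V(2))
  qed
  then show ?thesis using W Wi x by (intro smooth_nearI[of _ W]) (auto simp: W_def)
qed

section \<open>Quotients of additive groups of cochains\<close>

definition add_subgroup :: "'c::ab_group_add set \<Rightarrow> bool"
  where "add_subgroup S \<longleftrightarrow> 0 \<in> S \<and> (\<forall>a\<in>S. \<forall>b\<in>S. a - b \<in> S)"

lemma add_subgroup_0: "add_subgroup S \<Longrightarrow> 0 \<in> S"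
  by (simp add: add_subgroup_def)

lemma add_subgroup_diff: "add_subgroup S \<Longrightarrow> a \<in> S \<Longrightarrow> b \<in> S \<Longrightarrow> a - b \<in> S"
  by (simp add: add_subgroup_def)

lemma add_subgroup_minus: "add_subgroup S \<Longrightarrow> a \<in> S \<Longrightarrow> - a \<in> S"
  using add_subgroup_diff[of S 0 a] by (simp add: add_subgroup_0)

lemma add_subgroup_add: "add_subgroup S \<Longrightarrow> a \<in> S \<Longrightarrow> b \<in> S \<Longrightarrow> a + b \<in> S"
  using add_subgroup_diff[of S a "- b"] by (simp add: add_subgroup_minus)

lemma additive_group_simps [simp]:
  "carrier (additive_group S) = S" "mult (additive_group S) = (+)" "one (additive_group S) = 0"
  by (simp_all add: additive_group_def)

lemma comm_group_additive_group:
  assumes "add_subgroup S"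
  shows "comm_group (additive_group S)"
proof (rule comm_groupI)
  show "\<exists>y\<in>carrier (additive_group S). y \<otimes>\<^bsub>additive_group S\<^esub> x = \<one>\<^bsub>additive_group S\<^esub>"
    if "x \<in> carrier (additive_group S)" for x
    using that assms by (intro bexI[of _ "- x"]) (auto simp: add_subgroup_minus)
qed (use assms in \<open>auto simp: add_subgroup_0 add_subgroup_add algebra_simps\<close>)

lemma inv_additive_group_UNIV: "inv\<^bsub>additive_group UNIV\<^esub> a = - a"
proof -
  interpret comm_group "additive_group (UNIV :: 'a set)"
    by (rule comm_group_additive_group) (simp add: add_subgroup_def)
  show ?thesis by (rule inv_equality) auto
qed

lemma normal_additive_group:
  assumes Z: "add_subgroup Z" and B: "add_subgroup B" and "B \<subseteq> Z"
  shows "B \<lhd> additive_group Z"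
proof -
  interpret comm_group "additive_group Z" by (rule comm_group_additive_group[OF Z])
  have "subgroup B (additive_group Z)"
  proof (rule subgroupI)
    fix a assume a: "a \<in> B"
    then have "inv\<^bsub>additive_group Z\<^esub> a = - a"
      using assms by (intro inv_equality) (auto simp: add_subgroup_minus)
    then show "inv\<^bsub>additive_group Z\<^esub> a \<in> B" using a B by (simp add: add_subgroup_minus)
  qed (use assms in \<open>auto simp: add_subgroup_add dest: add_subgroup_0\<close>)
  then show ?thesis by (rule subgroup_imp_normal)
qed

lemma coset_of_alt: "coset_of Z B f = (\<lambda>b. b + f) ` B"
  by (auto simp: coset_of_def r_coset_def)

lemma coset_of_eq_iff:
  assumes "add_subgroup B"
  shows "coset_of Z B f = coset_of Z B g \<longleftrightarrow> f - g \<in> B"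
proof
  assume "coset_of Z B f = coset_of Z B g"
  moreover have "f \<in> coset_of Z B f"
    using add_subgroup_0[OF assms] by (force simp: coset_of_alt)
  ultimately show "f - g \<in> B" by (auto simp: coset_of_alt)
next
  assume fg: "f - g \<in> B"
  show "coset_of Z B f = coset_of Z B g"
    unfolding coset_of_alt
  proof (intro subset_antisym image_subsetI)
    fix b assume "b \<in> B"
    then show "b + f \<in> (\<lambda>b. b + g) ` B" "b + g \<in> (\<lambda>b. b + f) ` B"
      using add_subgroup_add[OF assms _ fg] add_subgroup_diff[OF assms _ fg]
      by (auto intro!: image_eqI[of "b + f" _ "b + (f - g)"] image_eqI[of "b + g" _ "b - (f - g)"])
  qed
qed

lemma mem_coset_of_iff: "f \<in> coset_of Z B g \<longleftrightarrow> f - g \<in> B"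
  by (force simp: coset_of_alt image_iff)

lemma carrier_quotient_group: "carrier (quotient_group Z B) = coset_of Z B ` Z"
  by (auto simp: quotient_group_def FactGroup_def RCOSETS_def coset_of_def)

context
  fixes Z B :: "'c::ab_group_add set"
  assumes Z: "add_subgroup Z" and B: "add_subgroup B" and BZ: "B \<subseteq> Z"
begin

lemma group_quotient_group: "group (quotient_group Z B)"
  unfolding quotient_group_def
  using normal_additive_group[OF Z B BZ] by (rule normal.factorgroup_is_group)

lemma mult_quotient_group:
  assumes "f \<in> Z" "g \<in> Z"
  shows "coset_of Z B f \<otimes>\<^bsub>quotient_group Z B\<^esub> coset_of Z B g = coset_of Z B (f + g)"
  using normal.rcos_sum[OF normal_additive_group[OF Z B BZ], of f g] assms
  by (simp add: quotient_group_def FactGroup_def coset_of_def)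

lemma one_quotient_group: "\<one>\<^bsub>quotient_group Z B\<^esub> = coset_of Z B 0"
  by (simp add: quotient_group_def FactGroup_def coset_of_alt)

end

text \<open>A map between quotients induced by a relation between the representatives; this covers both
  maps induced by homomorphisms of cochains and the connecting map.\<close>

locale induced_quotient_map =
  fixes Z B :: "'c::ab_group_add set" and Z' B' :: "'d::ab_group_add set"
    and R :: "'c \<Rightarrow> 'd \<Rightarrow> bool" and \<Phi> :: "'c set \<Rightarrow> 'd set"
  assumes Z: "add_subgroup Z" and B: "add_subgroup B" and BZ: "B \<subseteq> Z"
    and Z': "add_subgroup Z'" and B': "add_subgroup B'" and BZ': "B' \<subseteq> Z'"
    and total: "f \<in> Z \<Longrightarrow> \<exists>h. R f h"
    and target: "f \<in> Z \<Longrightarrow> R f h \<Longrightarrow> h \<in> Z'"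
    and diff: "f \<in> Z \<Longrightarrow> g \<in> Z \<Longrightarrow> R f h \<Longrightarrow> R g k \<Longrightarrow> R (f - g) (h - k)"
    and boundary: "f \<in> B \<Longrightarrow> R f h \<Longrightarrow> h \<in> B'"
    and \<Phi>: "f \<in> Z \<Longrightarrow> \<Phi> (coset_of Z B f) = the_elem {coset_of Z' B' h | h g. g \<in> coset_of Z B f \<and> R g h}"
begin

lemma coset_subset: "f \<in> Z \<Longrightarrow> g \<in> coset_of Z B f \<Longrightarrow> g \<in> Z"
  using add_subgroup_add[OF Z, of "g - f" f] BZ by (auto simp: mem_coset_of_iff)

text \<open>The set under \<open>the_elem\<close> is a singleton: if \<open>g\<close> represents the
  same class as \<open>f\<close>, then \<open>diff\<close> relates \<open>g - f\<close>, an element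
  of \<open>B\<close>, to the difference of the two values, and \<open>boundary\<close> puts that
  difference into \<open>B'\<close>.\<close>

lemma map_coset:
  assumes f: "f \<in> Z" and h: "R f h"
  shows "\<Phi> (coset_of Z B f) = coset_of Z' B' h"
proof -
  have "coset_of Z' B' k = coset_of Z' B' h" if g: "g \<in> coset_of Z B f" "R g k" for g k
    using boundary[OF _ diff[OF coset_subset[OF f g(1)] f g(2) h]] g(1)
    by (simp add: coset_of_eq_iff[OF B'] mem_coset_of_iff)
  moreover have "f \<in> coset_of Z B f"
    using add_subgroup_0[OF B] by (simp add: mem_coset_of_iff)
  ultimately have "{coset_of Z' B' h | h g. g \<in> coset_of Z B f \<and> R g h} = {coset_of Z' B' h}"
    using h by blast
  then show ?thesis using \<Phi>[OF f] by simp
qed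

text \<open>Only differences are assumed for \<open>R\<close>. Subtracting a related pair from
  itself gives \<open>R 0 0\<close>, and a sum is the difference of \<open>f\<close> and
  \<open>0 - g\<close>.\<close>

lemma relation_add:
  assumes "f \<in> Z" "g \<in> Z" "R f h" "R g k"
  shows "R (f + g) (h + k)"
proof -
  have 0: "R 0 0" using diff[OF assms(2,2,4,4)] by simp
  have "R (0 - g) (0 - k)" by (rule diff[OF add_subgroup_0[OF Z] assms(2) 0 assms(4)])
  with diff[OF assms(1) add_subgroup_diff[OF Z add_subgroup_0[OF Z] assms(2)] assms(3)]
  have "R (f - (0 - g)) (h - (0 - k))" .
  then show ?thesis by simp
qed

lemma group_hom: "group_hom (quotient_group Z B) (quotient_group Z' B') \<Phi>"
proof -
  have "\<Phi> \<in> hom (quotient_group Z B) (quotient_group Z' B')"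
  proof (rule homI)
    fix x assume "x \<in> carrier (quotient_group Z B)"
    then obtain f where f: "f \<in> Z" "x = coset_of Z B f" by (auto simp: carrier_quotient_group)
    obtain h where h: "R f h" using total[OF f(1)] by auto
    show "\<Phi> x \<in> carrier (quotient_group Z' B')"
      using map_coset[OF f(1) h] target[OF f(1) h] f by (simp add: carrier_quotient_group)
    fix y assume "y \<in> carrier (quotient_group Z B)"
    then obtain g where g: "g \<in> Z" "y = coset_of Z B g" by (auto simp: carrier_quotient_group)
    obtain k where k: "R g k" using total[OF g(1)] by auto
    show "\<Phi> (x \<otimes>\<^bsub>quotient_group Z B\<^esub> y) = \<Phi> x \<otimes>\<^bsub>quotient_group Z' B'\<^esub> \<Phi> y"
      using map_coset[OF f(1) h] map_coset[OF g(1) k]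
        map_coset[OF add_subgroup_add[OF Z f(1) g(1)] relation_add[OF f(1) g(1) h k]]
        target[OF f(1) h] target[OF g(1) k] f g
      by (simp add: mult_quotient_group[OF Z B BZ] mult_quotient_group[OF Z' B' BZ'])
  qed
  then show ?thesis
    using group_quotient_group[OF Z B BZ] group_quotient_group[OF Z' B' BZ']
    by (simp add: group_hom_def group_hom_axioms_def)
qed

lemma kernel_eq:
  "kernel (quotient_group Z B) (quotient_group Z' B') \<Phi> = coset_of Z B ` {f \<in> Z. \<exists>h\<in>B'. R f h}"
proof -
  have "\<Phi> (coset_of Z B f) = coset_of Z' B' 0 \<longleftrightarrow> (\<exists>h\<in>B'. R f h)" if f: "f \<in> Z" for f
  proof
    assume eq: "\<Phi> (coset_of Z B f) = coset_of Z' B' 0"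
    obtain h where h: "R f h" using total[OF f] by auto
    then have "h \<in> B'"
      using eq map_coset[OF f h] by (simp add: coset_of_eq_iff[OF B'])
    with h show "\<exists>h\<in>B'. R f h" by auto
  next
    assume "\<exists>h\<in>B'. R f h"
    then obtain h where "h \<in> B'" "R f h" by auto
    then show "\<Phi> (coset_of Z B f) = coset_of Z' B' 0"
      using map_coset[OF f] by (simp add: coset_of_eq_iff[OF B'])
  qed
  then show ?thesis
    unfolding kernel_def carrier_quotient_group one_quotient_group[OF Z' B' BZ'] by auto
qed

lemma image_eq:
  "\<Phi> ` carrier (quotient_group Z B) = coset_of Z' B' ` {h. \<exists>f\<in>Z. R f h}"
proof -
  have "\<exists>h. R f h \<and> \<Phi> (coset_of Z B f) = coset_of Z' B' h" if "f \<in> Z" for f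
    using total[OF that] map_coset[OF that] by blast
  then show ?thesis
    unfolding carrier_quotient_group using map_coset by (fastforce simp: image_iff)
qed

lemma inj_onI:
  assumes inj: "\<And>f h. f \<in> Z \<Longrightarrow> R f h \<Longrightarrow> h \<in> B' \<Longrightarrow> f \<in> B"
  shows "inj_on \<Phi> (carrier (quotient_group Z B))"
  unfolding carrier_quotient_group
proof (rule inj_onI, clarify)
  fix f g assume fg: "f \<in> Z" "g \<in> Z" "\<Phi> (coset_of Z B f) = \<Phi> (coset_of Z B g)"
  obtain h k where hk: "R f h" "R g k" using total fg by blast
  then have "coset_of Z' B' h = coset_of Z' B' k" using fg by (simp add: map_coset)
  then have "h - k \<in> B'" by (simp add: coset_of_eq_iff[OF B'])
  then show "coset_of Z B f = coset_of Z B g"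
    using inj[OF add_subgroup_diff[OF Z] diff] fg hk by (simp add: coset_of_eq_iff[OF B])
qed

end

text \<open>Exactness on representatives: \<open>sub\<close> expresses that the composite is
  trivial, \<open>sup\<close> that an element of the kernel is reached up to a coboundary.\<close>

lemma exact_at:
  assumes "induced_quotient_map Z1 B1 Z2 B2 R1 \<Phi>1" and "induced_quotient_map Z2 B2 Z3 B3 R2 \<Phi>2"
    and sub: "\<And>e h. e \<in> Z1 \<Longrightarrow> R1 e h \<Longrightarrow> \<exists>k\<in>B3. R2 h k"
    and sup: "\<And>f k. f \<in> Z2 \<Longrightarrow> k \<in> B3 \<Longrightarrow> R2 f k \<Longrightarrow> \<exists>e\<in>Z1. \<exists>h. R1 e h \<and> f - h \<in> B2"
  shows "kernel (quotient_group Z2 B2) (quotient_group Z3 B3) \<Phi>2 = \<Phi>1 ` carrier (quotient_group Z1 B1)"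
proof -
  interpret m1: induced_quotient_map Z1 B1 Z2 B2 R1 \<Phi>1 by fact
  interpret m2: induced_quotient_map Z2 B2 Z3 B3 R2 \<Phi>2 by fact
  show ?thesis
    unfolding m1.image_eq m2.kernel_eq
  proof (intro subset_antisym image_subsetI)
    fix f assume "f \<in> {f \<in> Z2. \<exists>h\<in>B3. R2 f h}"
    then obtain e h where "e \<in> Z1" "R1 e h" "f - h \<in> B2" using sup by blast
    then show "coset_of Z2 B2 f \<in> coset_of Z2 B2 ` {h. \<exists>f\<in>Z1. R1 f h}"
      using coset_of_eq_iff[OF m2.B] by blast
  next
    fix h assume "h \<in> {h. \<exists>f\<in>Z1. R1 f h}"
    then show "coset_of Z2 B2 h \<in> coset_of Z2 B2 ` {f \<in> Z2. \<exists>h\<in>B3. R2 f h}"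
      using sub m1.target by blast
  qed
qed

section \<open>Tuples and cochains\<close>

abbreviation empty_tuple :: "nat \<Rightarrow> 'g"
  where "empty_tuple \<equiv> \<lambda>_. undefined"

definition single :: "'g \<Rightarrow> nat \<Rightarrow> 'g"
  where "single g = (\<lambda>i\<in>{..<1}. g)"

definition pair :: "'g \<Rightarrow> 'g \<Rightarrow> nat \<Rightarrow> 'g"
  where "pair g h = (\<lambda>i\<in>{..<2}. if i = 0 then g else h)"

lemma tuples_0: "tuples 0 S = {empty_tuple}"
  by (simp add: tuples_def)

lemma single_simps [simp]: "single g 0 = g"
  by (simp add: single_def)

lemma pair_simps [simp]: "pair g h 0 = g" "pair g h (Suc 0) = h"
  by (simp_all add: pair_def)

lemma single_in_tuples [simp]: "single g \<in> tuples 1 S \<longleftrightarrow> g \<in> S" "single g \<in> tuples (Suc 0) S \<longleftrightarrow> g \<in> S"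
  unfolding tuples_def single_def One_nat_def restrict_PiE_iff by simp_all

lemma pair_in_tuples [simp]: "pair g h \<in> tuples 2 S \<longleftrightarrow> g \<in> S \<and> h \<in> S"
  unfolding tuples_def pair_def restrict_PiE_iff by (auto simp: numeral_2_eq_2 lessThan_Suc)

lemma tuples_1: "tuples 1 S = single ` S"
proof (intro subset_antisym subsetI)
  fix x assume x: "x \<in> tuples 1 S"
  then have "x = single (x 0)" "x 0 \<in> S"
    by (auto simp: tuples_def single_def PiE_iff extensional_def fun_eq_iff)
  then show "x \<in> single ` S" by blast
qed auto

lemma tuples_2: "tuples 2 S = {pair g h | g h. g \<in> S \<and> h \<in> S}"
proof (intro subset_antisym subsetI)
  fix x assume x: "x \<in> tuples 2 S"
  have "i < 2 \<longleftrightarrow> i = 0 \<or> i = Suc 0" for i :: nat by auto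
  then have "x = pair (x 0) (x 1)" "x 0 \<in> S" "x 1 \<in> S"
    using x by (auto simp: tuples_def pair_def PiE_iff extensional_def fun_eq_iff)
  then show "x \<in> {pair g h | g h. g \<in> S \<and> h \<in> S}" by blast
qed auto

lemma const_cochain_empty [simp]: "const_cochain a empty_tuple = a"
  by (simp add: const_cochain_def extend_zero_def tuples_0)

lemma group_diff_outside: "x \<notin> tuples (Suc n) (carrier G) \<Longrightarrow> group_diff G act n f x = 0"
  by (simp add: group_diff_def extend_zero_def)

text \<open>The j-th inner face of the bar complex, extracted from the body of
  \<open>group_diff\<close> so that the summands can be rewritten by name.\<close>

definition merge_entry :: "('g, 'x) monoid_scheme \<Rightarrow> nat \<Rightarrow> nat \<Rightarrow> (nat \<Rightarrow> 'g) \<Rightarrow> nat \<Rightarrow> 'g"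
  where "merge_entry G n j x = (\<lambda>i\<in>{..<n}.
    if Suc i < j then x i else if Suc i = j then x i \<otimes>\<^bsub>G\<^esub> x j else x (Suc i))"

definition triple :: "'g \<Rightarrow> 'g \<Rightarrow> 'g \<Rightarrow> nat \<Rightarrow> 'g"
  where "triple g h k = (\<lambda>i\<in>{..<3}. if i = 0 then g else if i = 1 then h else k)"

lemma triple_in_tuples [simp]: "triple g h k \<in> tuples 3 S \<longleftrightarrow> g \<in> S \<and> h \<in> S \<and> k \<in> S"
  unfolding tuples_def triple_def restrict_PiE_iff by (auto simp: numeral_3_eq_3 lessThan_Suc)

lemma tuples_3: "tuples 3 S = {triple g h k | g h k. g \<in> S \<and> h \<in> S \<and> k \<in> S}"
proof (intro subset_antisym subsetI)
  fix x assume x: "x \<in> tuples 3 S"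
  have "i < 3 \<longleftrightarrow> i = 0 \<or> i = Suc 0 \<or> i = 2" for i :: nat by auto
  then have "x = triple (x 0) (x 1) (x 2)" "x 0 \<in> S" "x 1 \<in> S" "x 2 \<in> S"
    using x by (auto simp: tuples_def triple_def PiE_iff extensional_def fun_eq_iff)
  then show "x \<in> {triple g h k | g h k. g \<in> S \<and> h \<in> S \<and> k \<in> S}" by blast
qed auto

lemma group_diff_inside:
  assumes "x \<in> tuples (Suc n) (carrier G)"
  shows "group_diff G act n f x = act (x 0) (f (\<lambda>i\<in>{..<n}. x (Suc i)))
      + (\<Sum>j = 1..n. sgn_power j (f (merge_entry G n j x))) + sgn_power (Suc n) (f (\<lambda>i\<in>{..<n}. x i))"
  using assms by (simp add: group_diff_def extend_zero_def merge_entry_def)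

lemma group_diff_0:
  assumes "g \<in> carrier G"
  shows "group_diff G act 0 f (single g) = act g (f empty_tuple) - f empty_tuple"
proof -
  have "(\<lambda>i\<in>{..<0::nat}. h i) = empty_tuple" for h :: "nat \<Rightarrow> 'a" by (simp add: restrict_def)
  then show ?thesis
    using assms by (simp add: group_diff_inside sgn_power_def del: lessThan_0)
qed

lemma group_diff_1:
  assumes "g \<in> carrier G" "h \<in> carrier G"
  shows "group_diff G act 1 f (pair g h) = act g (f (single h)) - f (single (g \<otimes>\<^bsub>G\<^esub> h)) + f (single g)"
proof -
  have "(\<lambda>i\<in>{..<1}. pair g h (Suc i)) = single h" "merge_entry G 1 1 (pair g h) = single (g \<otimes>\<^bsub>G\<^esub> h)"
    "(\<lambda>i\<in>{..<1}. pair g h i) = single g"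
    by (auto simp: single_def merge_entry_def fun_eq_iff)
  moreover have "pair g h \<in> tuples (Suc 1) (carrier G)" using assms by (simp add: numeral_2_eq_2[symmetric])
  ultimately show ?thesis
    by (simp add: group_diff_inside sgn_power_def)
qed

lemma group_diff_2:
  assumes "g \<in> carrier G" "h \<in> carrier G" "k \<in> carrier G"
  shows "group_diff G act 2 f (triple g h k) = act g (f (pair h k)) - f (pair (g \<otimes>\<^bsub>G\<^esub> h) k)
    + f (pair g (h \<otimes>\<^bsub>G\<^esub> k)) - f (pair g h)"
proof -
  have "(\<lambda>i\<in>{..<2}. triple g h k (Suc i)) = pair h k"
    "merge_entry G 2 1 (triple g h k) = pair (g \<otimes>\<^bsub>G\<^esub> h) k"
    "merge_entry G 2 2 (triple g h k) = pair g (h \<otimes>\<^bsub>G\<^esub> k)"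
    "(\<lambda>i\<in>{..<2}. triple g h k i) = pair g h"
    by (auto simp: pair_def triple_def merge_entry_def fun_eq_iff)
  moreover have "triple g h k \<in> tuples (Suc 2) (carrier G)"
    using assms by simp
  moreover have "{1..2::nat} = {1, 2}" "triple g h k 0 = g" by (auto simp: triple_def)
  ultimately show ?thesis
    by (simp add: group_diff_inside sgn_power_def)
qed

lemma cochain_eqI:
  assumes "\<And>x. x \<notin> tuples p S \<Longrightarrow> f x = 0" "\<And>x. x \<notin> tuples p S \<Longrightarrow> f' x = 0"
    and "\<And>x. x \<in> tuples p S \<Longrightarrow> f x = f' x"
  shows "f = f'"
  using assms by (metis ext)

section \<open>Smooth cochains with values in a smooth module\<close>

text \<open>Smoothness of the operations is only assumed pointwise, so that the assumptions are
  inherited by a Lie subgroup whose inclusion is smooth.\<close>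

locale smooth_module_near = group G for G :: "('g, 'x) monoid_scheme" (structure) +
  fixes MG :: "('g, 'e::locally_convex_space) manifold"
    and MA :: "('a::ab_group_add, 'f::locally_convex_space) manifold"
    and act :: "'g \<Rightarrow> 'a \<Rightarrow> 'a"
  assumes MG: "smooth_manifold MG" and topspace_MG: "topspace (topo MG) = carrier G"
    and mult_near: "\<lbrakk>g \<in> carrier G; h \<in> carrier G\<rbrakk> \<Longrightarrow>
      smooth_near (prod_manifold MG MG) MG (g, h) (\<lambda>(g, h). g \<otimes> h)"
    and A: "lie_group (additive_group (UNIV :: 'a set)) MA"
    and act_one: "act \<one> a = a"
    and act_mult: "\<lbrakk>g \<in> carrier G; h \<in> carrier G\<rbrakk> \<Longrightarrow> act (g \<otimes> h) a = act g (act h a)"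
    and act_add: "g \<in> carrier G \<Longrightarrow> act g (a + b) = act g a + act g b"
    and act_near: "g \<in> carrier G \<Longrightarrow>
      smooth_near (prod_manifold MG MA) MA (g, a) (\<lambda>(g, a). act g a)"
begin

lemma act_0: "g \<in> carrier G \<Longrightarrow> act g 0 = 0"
  using act_add[of g 0 0] by simp

lemma act_minus: "g \<in> carrier G \<Longrightarrow> act g (- a) = - act g a"
  using act_add[of g a "- a"] act_0[of g] by (simp add: eq_neg_iff_add_eq_0 add.commute)

lemma act_diff: "g \<in> carrier G \<Longrightarrow> act g (a - b) = act g a - act g b"
  using act_add[of g a "- b"] act_minus[of g b] by simp

lemma MA: "smooth_manifold MA" and topspace_MA: "topspace (topo MA) = UNIV"
  using A by (simp_all add: lie_group_def)

lemma charted_MG: "charted MG" and charted_MA: "charted MA"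
  by (rule smooth_manifold_charted[OF MG] smooth_manifold_charted[OF MA])+

lemma near_compose_pair:
  assumes M: "charted M" and "charted M1" "charted M2" "charted M3"
    and f: "smooth_near M M1 x f" and g: "smooth_near M M2 x g"
    and k: "smooth_near (prod_manifold M1 M2) M3 (f x, g x) (\<lambda>(a, b). k a b)"
  shows "smooth_near M M3 x (\<lambda>y. k (f y) (g y))"
  using smooth_near_compose[OF M charted_prod_manifold[OF assms(2,3)] charted_subspace[OF assms(4)]
      smooth_near_Pair[OF M f g] k] by simp

lemma near_add:
  assumes M: "charted M" and "smooth_near M MA x f" "smooth_near M MA x g"
  shows "smooth_near M MA x (\<lambda>y. f y + g y)"
proof (rule near_compose_pair[OF M charted_MA charted_MA charted_MA assms(2,3)])
  show "smooth_near (prod_manifold MA MA) MA (f x, g x) (\<lambda>(a, b). a + b)"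
    using A by (intro smooth_map_near) (auto simp: lie_group_def)
qed

lemma near_minus:
  assumes M: "charted M" and f: "smooth_near M MA x f"
  shows "smooth_near M MA x (\<lambda>y. - f y)"
proof (rule smooth_near_compose[OF M charted_MA charted_subspace[OF charted_MA] f])
  have "smooth_map MA MA (\<lambda>a. inv\<^bsub>additive_group UNIV\<^esub> a)"
    using A by (simp add: lie_group_def)
  then show "smooth_near MA MA (f x) uminus"
    by (intro smooth_map_near) (simp_all add: inv_additive_group_UNIV topspace_MA)
qed

lemma near_diff:
  assumes "charted M" "smooth_near M MA x f" "smooth_near M MA x g"
  shows "smooth_near M MA x (\<lambda>y. f y - g y)"
  using near_add[OF assms(1,2) near_minus[OF assms(1,3)]] by simp

lemma near_act:
  assumes "charted M" "smooth_near M MG x g" "smooth_near M MA x f"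
  shows "smooth_near M MA x (\<lambda>y. act (g y) (f y))"
  using smooth_near_range[OF assms(2)] topspace_MG
  by (intro near_compose_pair[OF assms(1) charted_MG charted_MA charted_MA assms(2,3)] act_near) simp

lemma near_mult:
  assumes "charted M" "smooth_near M MG x g" "smooth_near M MG x h"
  shows "smooth_near M MG x (\<lambda>y. g y \<otimes> h y)"
  using smooth_near_range[OF assms(2)] smooth_near_range[OF assms(3)] topspace_MG
  by (intro near_compose_pair[OF assms(1) charted_MG charted_MG charted_MG assms(2,3)] mult_near) simp_all

lemma near_const:
  assumes "charted M" "x \<in> topspace (topo M)"
  shows "smooth_near M MA x (\<lambda>_. a)"
  by (rule smooth_near_const[OF assms(1) charted_MA assms(2)]) (simp add: topspace_MA)

abbreviation cochains where "cochains \<equiv> smooth_cochains G MG MA"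

abbreviation diff where "diff \<equiv> group_diff G act"
abbreviation Z where "Z \<equiv> Z_s G MG MA act"
abbreviation B where "B \<equiv> B_s G MG MA act"

lemma topspace_power: "topspace (topo (power_manifold p MG)) = tuples p (carrier G)"
  by (simp add: tuples_def topspace_MG)

lemma cochains_outside: "f \<in> cochains p \<Longrightarrow> x \<notin> tuples p (carrier G) \<Longrightarrow> f x = 0"
  by (simp add: smooth_cochains_def)

section \<open>Normalized smooth cochains of degree at most 2 and their differentials\<close>

lemma add_subgroup_cochains: "add_subgroup (cochains p)"
proof -
  have ch: "charted (power_manifold p MG)" by (rule charted_power_manifold[OF charted_MG])
  have "(\<lambda>i\<in>{..<p}. \<one>) \<in> topspace (topo (power_manifold p MG))"
    unfolding topspace_power tuples_def by auto
  then have "(0 :: (nat \<Rightarrow> 'g) \<Rightarrow> 'a) \<in> cochains p"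
    using near_const[OF ch] by (simp add: smooth_cochains_def zero_fun_def)
  moreover have "f - g \<in> cochains p" if "f \<in> cochains p" "g \<in> cochains p" for f g
    using that near_diff[OF ch] by (auto simp: smooth_cochains_def fun_diff_def)
  ultimately show ?thesis by (auto simp: add_subgroup_def)
qed

lemma near_single:
  assumes M: "charted M" and g: "smooth_near M MG x g"
  shows "smooth_near M (power_manifold 1 MG) x (\<lambda>y. single (g y))"
  unfolding single_def
  by (rule smooth_near_tuple[OF M smooth_near_in_topspace[OF g]]) (rule g)

lemma near_coordinate:
  assumes "i < p" "x \<in> tuples p (carrier G)"
  shows "smooth_near (power_manifold p MG) MG x (\<lambda>x. x i)"
  using assms by (intro smooth_map_near smooth_map_coordinate[OF MG])
    (simp_all only: topspace_power)

lemma near_cochain_1: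
  assumes M: "charted M" and f: "f \<in> cochains 1" and g: "smooth_near M MG x g" "g x = \<one>"
  shows "smooth_near M MA x (\<lambda>y. f (single (g y)))"
  using f g(2)
  by (intro smooth_near_compose[OF M charted_power_manifold[OF charted_MG] charted_subspace[OF charted_MA]
        near_single[OF M g(1)]])
    (simp add: smooth_cochains_def single_def)

text \<open>Between \<open>MG\<close> and its first power the maps \<open>single\<close> and
  evaluation at 0 are mutually inverse and smooth, so smoothness near the identity can be tested on
  either side.\<close>

lemma cochains_1_iff:
  "f \<in> cochains 1 \<longleftrightarrow> (\<forall>x. x \<notin> tuples 1 (carrier G) \<longrightarrow> f x = 0) \<and> f (single \<one>) = 0 \<and>
    smooth_near MG MA \<one> (\<lambda>g. f (single g))"
proof (intro iffI conjI)
  assume f: "f \<in> cochains 1"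
  then show "\<forall>x. x \<notin> tuples 1 (carrier G) \<longrightarrow> f x = 0" by (simp add: smooth_cochains_def)
  show "f (single \<one>) = 0"
    using f unfolding smooth_cochains_def by (auto dest!: bspec[of _ _ "single \<one>"])
  show "smooth_near MG MA \<one> (\<lambda>g. f (single g))"
    by (intro near_cochain_1[OF charted_MG f] smooth_near_ident[OF MG]) (simp_all add: topspace_MG)
next
  assume f: "(\<forall>x. x \<notin> tuples 1 (carrier G) \<longrightarrow> f x = 0) \<and> f (single \<one>) = 0 \<and>
    smooth_near MG MA \<one> (\<lambda>g. f (single g))"
  have ch: "charted (power_manifold 1 MG)" by (rule charted_power_manifold[OF charted_MG])
  have "smooth_near (power_manifold 1 MG) MA (single \<one>) (\<lambda>x. f (single (x 0)))"
    using f by (intro smooth_near_compose[OF ch charted_MG charted_subspace[OF charted_MA]] near_coordinate) simp_all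
  then have "smooth_near (power_manifold 1 MG) MA (single \<one>) f"
    by (rule smooth_near_cong_topspace[OF ch]) (auto simp only: topspace_power tuples_1 single_simps)
  then show "f \<in> cochains 1"
    using f by (auto simp: smooth_cochains_def single_def[symmetric, unfolded One_nat_def] tuples_1[unfolded One_nat_def])
qed

lemma cochains_2I:
  assumes "\<And>x. x \<notin> tuples 2 (carrier G) \<Longrightarrow> f x = 0"
    and "\<And>g. g \<in> carrier G \<Longrightarrow> f (pair g \<one>) = 0" "\<And>g. g \<in> carrier G \<Longrightarrow> f (pair \<one> g) = 0"
    and near: "smooth_near (prod_manifold MG MG) MA (\<one>, \<one>) (\<lambda>(g, h). f (pair g h))"
  shows "f \<in> cochains 2"
proof -
  have ch: "charted (power_manifold 2 MG)" by (rule charted_power_manifold[OF charted_MG])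
  have one: "(\<lambda>i\<in>{..<2}. \<one>) = pair \<one> \<one>" by (auto simp: pair_def)
  have "smooth_near (power_manifold 2 MG) MA (pair \<one> \<one>) (\<lambda>x. f (pair (x 0) (x 1)))"
    using near by (intro near_compose_pair[OF ch charted_MG charted_MG charted_MA, of _ "\<lambda>x. x 0" "\<lambda>x. x 1"]
        near_coordinate) simp_all
  then have "smooth_near (power_manifold 2 MG) MA (pair \<one> \<one>) f"
    by (rule smooth_near_cong_topspace[OF ch]) (auto simp: topspace_power tuples_2 simp del: power_manifold_simps)
  moreover have "f x = 0" if "x \<in> tuples 2 (carrier G)" "i < 2" "x i = \<one>" for x i
  proof -
    have "i = 0 \<or> i = 1" using that(2) by auto
    then show ?thesis using that assms(2,3) by (auto simp: tuples_2)
  qed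
  ultimately show ?thesis
    using assms(1) by (auto simp: smooth_cochains_def one)
qed

text \<open>The zeroth power manifold is a single point, on which every function is constant, so no
  smoothness condition remains.\<close>

lemma cochains_0_iff: "f \<in> cochains 0 \<longleftrightarrow> (\<exists>a. f = const_cochain a)"
proof
  assume f: "f \<in> cochains 0"
  have "f = const_cochain (f empty_tuple)"
    by (rule cochain_eqI[of 0 UNIV])
      (use f in \<open>auto simp: smooth_cochains_def tuples_0 const_cochain_def extend_zero_def\<close>)
  then show "\<exists>a. f = const_cochain a" by blast
next
  assume "\<exists>a. f = const_cochain a"
  then obtain a where a: "f = const_cochain a" by auto
  have ch: "charted (power_manifold 0 MG)" by (rule charted_power_manifold[OF charted_MG])
  have e: "(\<lambda>i\<in>{..<0::nat}. \<one>) = empty_tuple" by (simp add: restrict_def)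
  have "smooth_near (power_manifold 0 MG) MA empty_tuple (\<lambda>_. a)"
    by (rule near_const[OF ch]) (simp add: topspace_power tuples_0 del: power_manifold_simps)
  then have "smooth_near (power_manifold 0 MG) MA empty_tuple f"
    by (rule smooth_near_cong_topspace[OF ch]) (simp add: topspace_power tuples_0 a del: power_manifold_simps)
  then show "f \<in> cochains 0"
    unfolding smooth_cochains_def e by (simp add: a tuples_0 const_cochain_def extend_zero_def)
qed

lemma diff_add: "diff n (f + f') = diff n f + diff n f'"
proof (rule cochain_eqI[of "Suc n" "carrier G"])
  fix x assume x: "x \<in> tuples (Suc n) (carrier G)"
  then have "x 0 \<in> carrier G" by (auto simp: tuples_def PiE_iff)
  moreover have "sgn_power j (a + b) = sgn_power j a + sgn_power j b" for j and a b :: 'a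
    by (simp add: sgn_power_def)
  ultimately show "diff n (f + f') x = (diff n f + diff n f') x"
    using x by (simp add: group_diff_inside act_add sum.distrib)
qed (simp_all add: group_diff_outside)

lemma diff_zero: "diff n 0 = 0"
  using diff_add[of n 0 0] by simp

lemma diff_diff: "diff n (f - f') = diff n f - diff n f'"
  using diff_add[of n "f - f'" f'] by (simp add: eq_diff_eq)

lemma diff_0_cochain: "f \<in> cochains 0 \<Longrightarrow> diff 0 f \<in> cochains 1"
  unfolding cochains_1_iff
proof (intro conjI allI impI)
  show "diff 0 f x = 0" if "x \<notin> tuples 1 (carrier G)" for x
    using that by (simp add: group_diff_outside)
  show "diff 0 f (single \<one>) = 0" by (simp add: group_diff_0 act_one)
  have "smooth_near MG MA \<one> (\<lambda>g. act g (f empty_tuple) - f empty_tuple)"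
    by (intro near_diff near_act near_const charted_MG smooth_near_ident[OF MG]) (simp_all add: topspace_MG)
  then show "smooth_near MG MA \<one> (\<lambda>g. diff 0 f (single g))"
    by (rule smooth_near_cong_topspace[OF charted_MG]) (simp add: topspace_MG group_diff_0)
qed

text \<open>At (\<one>, \<one>) each argument of \<open>f\<close> in the differential takes the
  value \<one>, so smoothness of \<open>f\<close> near \<one> suffices. Normalization of the result
  uses that \<open>f\<close> vanishes at \<one>.\<close>

lemma diff_1_cochain: "f \<in> cochains 1 \<Longrightarrow> diff 1 f \<in> cochains 2"
proof (rule cochains_2I)
  assume f: "f \<in> cochains 1"
  then have f1: "f (single \<one>) = 0" by (simp only: cochains_1_iff)
  show "diff 1 f x = 0" if "x \<notin> tuples 2 (carrier G)" for x
    using that by (intro group_diff_outside) (simp add: numeral_2_eq_2)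
  show "diff 1 f (pair g \<one>) = 0" "diff 1 f (pair \<one> g) = 0" if "g \<in> carrier G" for g
    using that by (simp_all add: group_diff_1[unfolded One_nat_def] f1 act_0 act_one)
  let ?M = "prod_manifold MG MG"
  have ch: "charted ?M" by (rule charted_prod_manifold[OF charted_MG charted_MG])
  have fst: "smooth_near ?M MG (\<one>, \<one>) fst" and snd: "smooth_near ?M MG (\<one>, \<one>) snd"
    by (rule smooth_map_near[OF smooth_map_fst[OF MG charted_MG]],
        simp add: topspace_MG, rule smooth_map_near[OF smooth_map_snd[OF charted_MG MG]],
        simp add: topspace_MG)
  have "smooth_near ?M MA (\<one>, \<one>)
      (\<lambda>z. act (fst z) (f (single (snd z))) - f (single (fst z \<otimes> snd z)) + f (single (fst z)))"
    by (intro near_add near_diff near_act near_cochain_1[OF _ f] near_mult ch fst snd) simp_all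
  then show "smooth_near ?M MA (\<one>, \<one>) (\<lambda>(g, h). diff 1 f (pair g h))"
    by (rule smooth_near_cong_topspace[OF ch]) (auto simp: topspace_MG group_diff_1[unfolded One_nat_def])
qed

lemma diff_1_diff_0: "diff 1 (diff 0 f) = 0"
proof (rule cochain_eqI[of 2 "carrier G"])
  fix x assume "x \<in> tuples 2 (carrier G)"
  then show "diff 1 (diff 0 f) x = 0 x"
    by (auto simp: tuples_2 group_diff_1[unfolded One_nat_def] group_diff_0 act_diff act_mult)
qed (auto intro!: group_diff_outside simp: numeral_2_eq_2)

lemma diff_2_diff_1: "diff 2 (diff 1 f) = 0"
proof (rule cochain_eqI[of 3 "carrier G"])
  fix x assume "x \<in> tuples 3 (carrier G)"
  then show "diff 2 (diff 1 f) x = 0 x"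
    by (auto simp: tuples_3 group_diff_1[unfolded One_nat_def] group_diff_2 act_diff act_add act_mult m_assoc)
qed (auto intro!: group_diff_outside simp: numeral_3_eq_3)

lemma cochain_complex:
  assumes "p = 1 \<or> p = 2"
  shows "add_subgroup (Z p)" "add_subgroup (B p)"
    "B p \<subseteq> Z p"
proof -
  show "add_subgroup (Z p)"
    using add_subgroup_cochains[of p]
    by (auto simp: Z_s_def cocycles_def add_subgroup_def diff_zero diff_diff)
  have B: "B p = diff (p - 1) ` cochains (p - 1)"
    using assms by (auto simp: B_s_def coboundaries_def)
  show "add_subgroup (B p)"
    unfolding B using add_subgroup_cochains[of "p - 1"]
    by (auto simp: add_subgroup_def diff_diff[symmetric] intro!: imageI image_eqI[of 0 _ 0] simp: diff_zero)
  show "B p \<subseteq> Z p"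
    using assms unfolding B
    by (auto simp: Z_s_def cocycles_def diff_0_cochain[unfolded One_nat_def] diff_1_cochain[unfolded One_nat_def]
        diff_1_diff_0[unfolded One_nat_def] diff_2_diff_1[unfolded One_nat_def])
qed

lemma Z_s_1_iff:
  "f \<in> Z 1 \<longleftrightarrow> f \<in> cochains 1 \<and>
    (\<forall>g\<in>carrier G. \<forall>h\<in>carrier G. f (single (g \<otimes> h)) = f (single g) + act g (f (single h)))"
proof -
  have "diff 1 f = 0 \<longleftrightarrow>
    (\<forall>g\<in>carrier G. \<forall>h\<in>carrier G. f (single (g \<otimes> h)) = f (single g) + act g (f (single h)))"
    (is "_ \<longleftrightarrow> ?C")
  proof
    assume 0: "diff 1 f = 0"
    show ?C
    proof (intro ballI)
      fix g h assume gh: "g \<in> carrier G" "h \<in> carrier G"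
      show "f (single (g \<otimes> h)) = f (single g) + act g (f (single h))"
        using fun_cong[OF 0, of "pair g h"] unfolding group_diff_1[OF gh] by (simp add: algebra_simps)
    qed
  next
    assume ?C
    then show "diff 1 f = 0"
      by (intro cochain_eqI[of 2 "carrier G"])
        (auto simp: tuples_2 group_diff_1[unfolded One_nat_def] group_diff_outside[of _ "Suc 0", folded numeral_2_eq_2])
  qed
  then show ?thesis by (simp add: Z_s_def cocycles_def)
qed

lemma B_s_1: "B 1 = range (\<lambda>a. diff 0 (const_cochain a))"
proof -
  have "cochains 0 = range const_cochain" by (auto simp: cochains_0_iff)
  then show ?thesis by (simp add: B_s_def coboundaries_def image_image)
qed

lemma B_s_2: "B 2 = diff 1 ` cochains 1"
  by (simp add: B_s_def coboundaries_def numeral_2_eq_2)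

end

section \<open>Inflation, restriction and the connecting map\<close>

context normal
begin

lemma mem_carrier: "n \<in> H \<Longrightarrow> n \<in> carrier G"
  by (rule mem_carrier)

lemma mult_conj: "g \<in> carrier G \<Longrightarrow> n \<in> H \<Longrightarrow> g \<otimes> (inv g \<otimes> n \<otimes> g) = n \<otimes> g"
  by (simp add: m_assoc[symmetric] mem_carrier)

text \<open>The quotient group is built from right cosets, while the bundle projection uses left
  cosets; normality identifies the two.\<close>

lemma carrier_Mod: "carrier (G Mod H) = (\<lambda>g. g <# H) ` carrier G"
  unfolding carrier_FactGroup using coset_eq by (intro image_cong) auto

lemma mult_Mod: "g \<in> carrier G \<Longrightarrow> h \<in> carrier G \<Longrightarrow> (g <# H) \<otimes>\<^bsub>G Mod H\<^esub> (h <# H) = (g \<otimes> h) <# H"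
  using rcos_sum[of g h] coset_eq by simp

lemma coset_mult: "g \<in> carrier G \<Longrightarrow> n \<in> H \<Longrightarrow> (g \<otimes> n) <# H = g <# H"
  using lcos_m_assoc[OF subset, of g n] lcos_mult_one coset_join3[OF mem_carrier subgroup_axioms, of n]
  by (simp add: mem_carrier)

lemma coset_eqD:
  assumes "g \<in> carrier G" "h \<in> carrier G" "g <# H = h <# H"
  obtains n where "n \<in> H" "h = g \<otimes> n"
proof -
  have "h \<in> h <# H" using assms(2) one_closed by (force simp: l_coset_def)
  then have "h \<in> g <# H" using assms(3) by simp
  then show ?thesis using that by (auto simp: l_coset_def)
qed

end

text \<open>\<open>s\<close> is a section of \<open>G \<rightarrow> G/N\<close>, viewed as a function on \<open>G\<close> that is constant on
  cosets, with \<open>s \<one> = \<one>\<close> and smooth near \<open>\<one>\<close>; it need not be smooth elsewhere.\<close>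

locale lie_extension =
  smooth_module_near G MG MA act + normal N G + N: smooth_module_near "G\<lparr>carrier := N\<rparr>" MN MA act
  for G :: "('g, 'x) monoid_scheme" (structure)
    and MG :: "('g, 'e::locally_convex_space) manifold"
    and MA :: "('a::ab_group_add, 'f::locally_convex_space) manifold"
    and act :: "'g \<Rightarrow> 'a \<Rightarrow> 'a"
    and N :: "'g set"
    and MN :: "('g, 'h::locally_convex_space) manifold" +
  fixes s :: "'g \<Rightarrow> 'g"
  assumes incl_near: "smooth_near MN MG \<one> (\<lambda>n. n)"
    and s_closed: "g \<in> carrier G \<Longrightarrow> s g \<in> carrier G"
    and fibre_closed: "g \<in> carrier G \<Longrightarrow> inv (s g) \<otimes> g \<in> N"
    and s_coset: "g \<in> carrier G \<Longrightarrow> n \<in> N \<Longrightarrow> s (g \<otimes> n) = s g"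
    and s_one: "s \<one> = \<one>"
    and s_near: "smooth_near MG MG \<one> s"
    and fibre_near: "smooth_near MG MN \<one> (\<lambda>g. inv (s g) \<otimes> g)"
begin

subsection \<open>Cochains on the quotient\<close>

abbreviation quot_diff where "quot_diff \<equiv> group_diff (G Mod N) (quot_act act)"
abbreviation quot where "quot \<equiv> quot_cochains G MG MA act N"
abbreviation ZQ where "ZQ \<equiv> Z_s_quot G MG MA act N"
abbreviation BQ where "BQ \<equiv> B_s_quot G MG MA act N"
abbreviation pull :: "nat \<Rightarrow> ((nat \<Rightarrow> 'g set) \<Rightarrow> 'a) \<Rightarrow> (nat \<Rightarrow> 'g) \<Rightarrow> 'a"
  where "pull \<equiv> pullback G N"

text \<open>By normality n g = g (inv g n g), and the conjugate in parentheses fixes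
  \<open>a\<close>.\<close>

lemma fixed_act: "a \<in> fixed_points act N \<Longrightarrow> g \<in> carrier G \<Longrightarrow> act g a \<in> fixed_points act N"
proof -
  assume a: "a \<in> fixed_points act N" and g: "g \<in> carrier G"
  have "act n (act g a) = act g a" if n: "n \<in> N" for n
  proof -
    have "act n (act g a) = act (g \<otimes> (inv g \<otimes> n \<otimes> g)) a"
      using g n by (simp add: mult_conj act_mult mem_carrier)
    also have "\<dots> = act g (act (inv g \<otimes> n \<otimes> g) a)"
      using g n by (simp add: act_mult mem_carrier)
    also have "act (inv g \<otimes> n \<otimes> g) a = a"
      using a g n inv_op_closed1 by (simp add: fixed_points_def)
    finally show ?thesis .
  qed
  then show ?thesis by (simp add: fixed_points_def)
qed

lemma add_subgroup_fixed: "add_subgroup (fixed_points act N)"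
  by (auto simp: add_subgroup_def fixed_points_def act_0 act_diff mem_carrier)

lemma quot_act_coset:
  assumes g: "g \<in> carrier G" and a: "a \<in> fixed_points act N"
  shows "quot_act act (g <# N) a = act g a"
proof -
  have "g \<in> g <# N" using g one_closed by (force simp: l_coset_def)
  then have "(SOME h. h \<in> g <# N) \<in> g <# N" by (rule someI)
  then obtain n where n: "n \<in> N" "(SOME h. h \<in> g <# N) = g \<otimes> n" by (auto simp: l_coset_def)
  then show ?thesis
    using g a by (simp add: quot_act_def act_mult mem_carrier fixed_points_def)
qed

lemma quot_outside: "f \<in> quot p \<Longrightarrow> y \<notin> tuples p (carrier (G Mod N)) \<Longrightarrow> f y = 0"
  by (simp add: quot_cochains_def)

lemma quot_fixed: "f \<in> quot p \<Longrightarrow> f y \<in> fixed_points act N"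
  using add_subgroup_0[OF add_subgroup_fixed] by (cases "y \<in> tuples p (carrier (G Mod N))") (auto simp: quot_cochains_def)

lemma quot_pull: "f \<in> quot p \<Longrightarrow> pull p f \<in> cochains p"
  by (simp add: quot_cochains_def)

lemma pull_outside: "x \<notin> tuples p (carrier G) \<Longrightarrow> pull p f x = 0"
  by (simp add: pullback_def extend_zero_def)

lemma pull_inside: "x \<in> tuples p (carrier G) \<Longrightarrow> pull p f x = f (\<lambda>i\<in>{..<p}. x i <# N)"
  by (simp add: pullback_def extend_zero_def)

lemma pull_diff: "pull p (f - f') = pull p f - pull p f'"
  by (auto simp: pullback_def extend_zero_def fun_eq_iff)

lemma pull_zero: "pull p 0 = 0"
  by (auto simp: pullback_def extend_zero_def)

lemma pull_single: "g \<in> carrier G \<Longrightarrow> pull 1 f (single g) = f (single (g <# N))"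
  by (subst pull_inside) (auto simp: single_def fun_eq_iff tuples_def intro!: arg_cong[of _ _ f])

lemma pull_pair: "g \<in> carrier G \<Longrightarrow> h \<in> carrier G \<Longrightarrow> pull 2 f (pair g h) = f (pair (g <# N) (h <# N))"
  by (subst pull_inside) (auto simp: pair_def fun_eq_iff tuples_def intro!: arg_cong[of _ _ f])

text \<open>Every tuple of cosets has a tuple of representatives. Identities between cochains on G/N
  are therefore proved after pulling them back to G.\<close>

lemma pull_inj:
  assumes f: "\<And>y. y \<notin> tuples p (carrier (G Mod N)) \<Longrightarrow> f y = 0"
    and f': "\<And>y. y \<notin> tuples p (carrier (G Mod N)) \<Longrightarrow> f' y = 0" and eq: "pull p f = pull p f'"
  shows "f = f'"
proof (rule cochain_eqI[OF f f'])
  fix y assume y: "y \<in> tuples p (carrier (G Mod N))"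
  then have "\<forall>i. \<exists>g. i < p \<longrightarrow> g \<in> carrier G \<and> y i = g <# N"
    by (auto simp: tuples_def carrier_Mod PiE_iff image_iff)
  then obtain x where x: "\<And>i. i < p \<Longrightarrow> x i \<in> carrier G" "\<And>i. i < p \<Longrightarrow> y i = x i <# N" by metis
  have "restrict x {..<p} \<in> tuples p (carrier G)" using x(1) by (auto simp: tuples_def)
  moreover have "(\<lambda>i\<in>{..<p}. restrict x {..<p} i <# N) = y"
    using x(2) y by (auto simp: tuples_def PiE_iff extensional_def fun_eq_iff)
  ultimately show "f y = f' y"
    using fun_cong[OF eq, of "restrict x {..<p}"] by (simp add: pull_inside)
qed

text \<open>The inner faces commute with the projection because cosets are multiplied by
  representatives. In the first term the values lie in the N-fixed points, where the representative
  chosen inside \<open>quot_act\<close> may be replaced by \<open>x 0\<close>.\<close>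

lemma pull_quot_diff:
  assumes f: "f \<in> quot p"
  shows "pull (Suc p) (quot_diff p f) = diff p (pull p f)"
proof (rule cochain_eqI[OF pull_outside group_diff_outside])
  fix x assume x: "x \<in> tuples (Suc p) (carrier G)"
  then have xi: "x i \<in> carrier G" if "i \<le> p" for i using that by (auto simp: tuples_def PiE_iff)
  define y where "y = (\<lambda>i\<in>{..<Suc p}. x i <# N)"
  have y: "y \<in> tuples (Suc p) (carrier (G Mod N))"
    using xi by (auto simp: y_def tuples_def carrier_Mod)
  have pull: "f z' = pull p f z"
    if "z \<in> tuples p (carrier G)" "\<And>i. i < p \<Longrightarrow> z' i = z i <# N" "z' \<in> extensional {..<p}" for z z'
  proof -
    have "z' = (\<lambda>i\<in>{..<p}. z i <# N)"
      using that(2,3) by (auto simp: extensional_def fun_eq_iff)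
    then show ?thesis using that(1) by (simp add: pull_inside)
  qed
  have 1: "f (\<lambda>i\<in>{..<p}. y (Suc i)) = pull p f (\<lambda>i\<in>{..<p}. x (Suc i))"
    by (rule pull) (use xi in \<open>auto simp: y_def tuples_def\<close>)
  have 2: "f (merge_entry (G Mod N) p j y) = pull p f (merge_entry G p j x)" if "j \<in> {1..p}" for j
    by (rule pull) (use xi that in \<open>auto simp: y_def tuples_def merge_entry_def mult_Mod simp del: mult_FactGroup\<close>)
  have 3: "f (\<lambda>i\<in>{..<p}. y i) = pull p f (\<lambda>i\<in>{..<p}. x i)"
    by (rule pull) (use xi in \<open>auto simp: y_def tuples_def\<close>)
  have 0: "quot_act act (y 0) (f z) = act (x 0) (f z)" for z
    using quot_act_coset[OF xi[of 0] quot_fixed[OF f]] by (simp add: y_def)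
  have "pull (Suc p) (quot_diff p f) x = quot_diff p f y"
    by (simp only: pull_inside[OF x] y_def)
  also have "\<dots> = act (x 0) (pull p f (\<lambda>i\<in>{..<p}. x (Suc i)))
      + (\<Sum>j = 1..p. sgn_power j (pull p f (merge_entry G p j x)))
      + sgn_power (Suc p) (pull p f (\<lambda>i\<in>{..<p}. x i))"
    unfolding group_diff_inside[OF y] 0 by (simp only: 1 2 3 cong: sum.cong)
  also have "\<dots> = diff p (pull p f) x"
    by (simp only: group_diff_inside[OF x])
  finally show "pull (Suc p) (quot_diff p f) x = diff p (pull p f) x" .
qed

lemma sgn_power_in: "add_subgroup S \<Longrightarrow> a \<in> S \<Longrightarrow> sgn_power j a \<in> S"
  by (simp add: sgn_power_def add_subgroup_minus)

lemma quot_diff_fixed: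
  assumes f: "f \<in> quot p" and y: "y \<in> tuples (Suc p) (carrier (G Mod N))"
  shows "quot_diff p f y \<in> fixed_points act N"
proof -
  note S = add_subgroup_fixed and v = quot_fixed[OF f]
  have "y 0 \<in> carrier (G Mod N)" using y by (auto simp: tuples_def PiE_iff)
  then have "quot_act act (y 0) (f z) \<in> fixed_points act N" for z
    using v by (auto simp: carrier_Mod quot_act_coset fixed_act)
  moreover have "(\<Sum>j\<in>J. sgn_power j (f (z j))) \<in> fixed_points act N" for J z
    by (induction J rule: infinite_finite_induct)
      (auto intro!: add_subgroup_0[OF S] add_subgroup_add[OF S] sgn_power_in[OF S] v)
  ultimately show ?thesis
    unfolding group_diff_inside[OF y] by (intro add_subgroup_add[OF S] sgn_power_in[OF S] v)
qed

lemma quot_diff_cochain: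
  assumes f: "f \<in> quot p" and p: "p = 0 \<or> p = 1"
  shows "quot_diff p f \<in> quot (Suc p)"
proof -
  have "diff p (pull p f) \<in> cochains (Suc p)"
    using p quot_pull[OF f] diff_0_cochain diff_1_cochain by (auto simp: numeral_2_eq_2)
  then show ?thesis
    using quot_diff_fixed[OF f] by (simp add: quot_cochains_def pull_quot_diff[OF f] group_diff_outside)
qed

lemma add_subgroup_quot: "add_subgroup (quot p)"
  unfolding add_subgroup_def quot_cochains_def
  using add_subgroup_0[OF add_subgroup_cochains] add_subgroup_diff[OF add_subgroup_cochains]
    add_subgroup_0[OF add_subgroup_fixed] add_subgroup_diff[OF add_subgroup_fixed]
  by (auto simp: pull_zero pull_diff)

lemma quot_diff_diff:
  assumes "f \<in> quot p" "f' \<in> quot p"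
  shows "quot_diff p (f - f') = quot_diff p f - quot_diff p f'"
  by (rule pull_inj[of "Suc p"])
    (simp_all add: group_diff_outside pull_diff pull_quot_diff assms add_subgroup_diff[OF add_subgroup_quot] diff_diff)

lemma quot_diff_zero: "quot_diff p 0 = 0"
  using quot_diff_diff[OF add_subgroup_0 add_subgroup_0, OF add_subgroup_quot add_subgroup_quot, of p] by simp

lemma Z_s_quot_iff: "f \<in> ZQ p \<longleftrightarrow> f \<in> quot p \<and> diff p (pull p f) = 0"
proof -
  have "quot_diff p f = 0 \<longleftrightarrow> diff p (pull p f) = 0" if f: "f \<in> quot p"
  proof
    assume "diff p (pull p f) = 0"
    then have "pull (Suc p) (quot_diff p f) = pull (Suc p) 0"
      by (simp add: pull_quot_diff[OF f] pull_zero)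
    then show "quot_diff p f = 0"
      by (rule pull_inj[rotated 2]) (simp_all add: group_diff_outside)
  qed (simp add: pull_quot_diff[OF f, symmetric] pull_zero)
  then show ?thesis by (auto simp: Z_s_quot_def cocycles_def)
qed

lemma B_s_quot_Suc: "BQ (Suc p) = quot_diff p ` quot p"
  by (simp add: B_s_quot_def coboundaries_def)

lemma quot_complex:
  assumes "p = 1 \<or> p = 2"
  shows "add_subgroup (ZQ p)" "add_subgroup (BQ p)"
    "BQ p \<subseteq> ZQ p"
proof -
  show "add_subgroup (ZQ p)"
    using add_subgroup_quot[of p]
    by (auto simp: Z_s_quot_iff add_subgroup_def pull_zero pull_diff diff_zero diff_diff)
  obtain q where q: "p = Suc q" "q = 0 \<or> q = 1" using assms by (auto simp: numeral_2_eq_2)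
  have B: "BQ p = quot_diff q ` quot q"
    unfolding q(1) by (rule B_s_quot_Suc)
  show "add_subgroup (BQ p)"
    unfolding add_subgroup_def B
  proof (intro conjI ballI)
    show "0 \<in> quot_diff q ` quot q"
      by (rule image_eqI[of _ _ 0]) (simp_all add: quot_diff_zero add_subgroup_0[OF add_subgroup_quot])
    fix a b assume "a \<in> quot_diff q ` quot q" "b \<in> quot_diff q ` quot q"
    then obtain f f' where "f \<in> quot q" "f' \<in> quot q" "a = quot_diff q f" "b = quot_diff q f'" by auto
    then show "a - b \<in> quot_diff q ` quot q"
      by (intro image_eqI[of _ _ "f - f'"]) (simp_all add: quot_diff_diff add_subgroup_diff[OF add_subgroup_quot])
  qed
  have dd: "diff p (diff q f) = 0" for f
    using q diff_1_diff_0[of f] diff_2_diff_1[of f] by (auto simp: numeral_2_eq_2)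
  have "quot_diff q f \<in> quot p" "pull p (quot_diff q f) = diff q (pull q f)" if "f \<in> quot q" for f
    unfolding q(1) using that q(2) by (simp_all only: quot_diff_cochain pull_quot_diff)
  then show "BQ p \<subseteq> ZQ p"
    unfolding B by (auto simp: Z_s_quot_iff dd)
qed

text \<open>The representatives may be chosen arbitrarily: smoothness of a cochain on G/N is a
  condition on its pull-back, and the pull-back is again \<open>c\<close>. Descent thus requires no
  smooth section.\<close>

lemma factor_cochain:
  assumes c: "c \<in> cochains p" and fixed: "\<And>x. c x \<in> fixed_points act N"
    and const: "\<And>x x'. x \<in> tuples p (carrier G) \<Longrightarrow> x' \<in> tuples p (carrier G) \<Longrightarrow>
      (\<And>i. i < p \<Longrightarrow> x i <# N = x' i <# N) \<Longrightarrow> c x = c x'"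
  obtains h where "h \<in> quot p" "pull p h = c"
proof
  define rep where "rep y = (\<lambda>i\<in>{..<p}. SOME g. g \<in> carrier G \<and> y i = g <# N)" for y :: "nat \<Rightarrow> 'g set"
  define h where "h = extend_zero (tuples p (carrier (G Mod N))) (\<lambda>y. c (rep y))"
  have rep: "rep y i \<in> carrier G \<and> y i = rep y i <# N" if "y \<in> tuples p (carrier (G Mod N))" "i < p" for y i
  proof -
    have "\<exists>g. g \<in> carrier G \<and> y i = g <# N"
      using that by (auto simp: tuples_def carrier_Mod PiE_iff)
    from someI_ex[OF this] show ?thesis using that(2) by (simp add: rep_def)
  qed
  show pull_h: "pull p h = c"
  proof (rule cochain_eqI[OF pull_outside cochains_outside[OF c]])
    fix x assume x: "x \<in> tuples p (carrier G)"
    let ?y = "\<lambda>i\<in>{..<p}. x i <# N"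
    have y: "?y \<in> tuples p (carrier (G Mod N))" using x by (auto simp: tuples_def carrier_Mod PiE_iff)
    have "c (rep ?y) = c x"
    proof (rule const[OF _ x])
      show "rep ?y \<in> tuples p (carrier G)" using rep[OF y] by (auto simp: tuples_def rep_def)
      show "rep ?y i <# N = x i <# N" if "i < p" for i using rep[OF y that] that by simp
    qed
    then show "pull p h x = c x" using y by (simp add: pull_inside[OF x] h_def extend_zero_def)
  qed
  show "h \<in> quot p"
    using c fixed add_subgroup_0[OF add_subgroup_fixed] pull_h by (simp add: quot_cochains_def h_def extend_zero_def)
qed

lemma factor_cochain_1:
  assumes c: "c \<in> cochains 1"
    and right: "\<And>g n. g \<in> carrier G \<Longrightarrow> n \<in> N \<Longrightarrow> c (single (g \<otimes> n)) = c (single g)"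
    and fixed: "\<And>g n. g \<in> carrier G \<Longrightarrow> n \<in> N \<Longrightarrow> act n (c (single g)) = c (single g)"
  obtains h where "h \<in> quot 1" "pull 1 h = c"
proof (rule factor_cochain[OF c])
  show "c x \<in> fixed_points act N" for x
    using fixed cochains_outside[OF c, of x]
    by (cases "x \<in> tuples 1 (carrier G)") (auto simp: fixed_points_def tuples_1[unfolded One_nat_def] act_0 mem_carrier)
  fix x x' assume "x \<in> tuples 1 (carrier G)" "x' \<in> tuples 1 (carrier G)" and eq: "\<And>i. i < 1 \<Longrightarrow> x i <# N = x' i <# N"
  then obtain g g' where g: "x = single g" "x' = single g'" "g \<in> carrier G" "g' \<in> carrier G"
    by (auto simp: tuples_1[unfolded One_nat_def])
  then obtain n where "n \<in> N" "g' = g \<otimes> n" using eq[of 0] coset_eqD[of g g'] by auto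
  then show "c x = c x'" using right g by simp
qed (rule that)

subsection \<open>Restriction and invariant cocycles\<close>

abbreviation res :: "((nat \<Rightarrow> 'g) \<Rightarrow> 'a) \<Rightarrow> (nat \<Rightarrow> 'g) \<Rightarrow> 'a"
  where "res \<equiv> extend_zero (tuples 1 N)"

text \<open>The equation d_N (t g) = g.f - f evaluated at n, with 0-cochains read as elements of the
  module.\<close>

definition invariant_by :: "('g \<Rightarrow> 'a) \<Rightarrow> ((nat \<Rightarrow> 'g) \<Rightarrow> 'a) \<Rightarrow> bool"
  where "invariant_by t f \<longleftrightarrow> (\<forall>g\<in>carrier G. \<forall>n\<in>N.
    act n (t g) - t g = act g (f (single (inv g \<otimes> n \<otimes> g))) - f (single n))"

lemma res_single: "n \<in> N \<Longrightarrow> res f (single n) = f (single n)"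
  by (simp add: extend_zero_def)

lemma res_outside: "x \<notin> tuples 1 N \<Longrightarrow> res f x = 0"
  by (simp add: extend_zero_def)

lemma res_cochain:
  assumes f: "f \<in> cochains 1"
  shows "res f \<in> N.cochains 1"
  unfolding N.cochains_1_iff
proof (intro conjI allI impI)
  have "smooth_near MN MA \<one> (\<lambda>n. f (single n))"
    by (rule near_cochain_1[OF N.charted_MG f incl_near]) simp
  then have "smooth_near MN MA \<one> (\<lambda>n. res f (single n))"
    by (rule smooth_near_cong_topspace[OF N.charted_MG])
      (simp add: N.topspace_MG res_single[unfolded One_nat_def])
  then show "smooth_near MN MA \<one>\<^bsub>G\<lparr>carrier := N\<rparr>\<^esub> (\<lambda>n. res f (single n))" by simp
  show "res f (single \<one>\<^bsub>G\<lparr>carrier := N\<rparr>\<^esub>) = 0"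
    using f unfolding cochains_1_iff by (simp add: extend_zero_def)
qed (simp add: res_outside del: One_nat_def)

lemma invariant_by_iff:
  assumes "\<forall>x. x \<notin> tuples 1 N \<longrightarrow> f x = 0"
  shows "(\<forall>g\<in>carrier G. N.diff 0 (const_cochain (t g)) = conj_act G N act 1 g f - f) \<longleftrightarrow> invariant_by t f"
proof -
  have "N.diff 0 (const_cochain (t g)) = conj_act G N act 1 g f - f \<longleftrightarrow>
    (\<forall>n\<in>N. act n (t g) - t g = act g (f (single (inv g \<otimes> n \<otimes> g))) - f (single n))" if "g \<in> carrier G" for g
  proof -
    have 1: "N.diff 0 (const_cochain (t g)) (single n) = act n (t g) - t g" if "n \<in> N" for n
      using that by (subst group_diff_0) simp_all
    have "(\<lambda>i\<in>{..<1}. inv g \<otimes> single n i \<otimes> g) = single (inv g \<otimes> n \<otimes> g)" for n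
      by (auto simp: single_def)
    then have 2: "(conj_act G N act 1 g f - f) (single n) = act g (f (single (inv g \<otimes> n \<otimes> g))) - f (single n)"
      if "n \<in> N" for n
      using that by (simp add: conj_act_def extend_zero_def)
    show ?thesis
    proof
      assume eq: "N.diff 0 (const_cochain (t g)) = conj_act G N act 1 g f - f"
      show "\<forall>n\<in>N. act n (t g) - t g = act g (f (single (inv g \<otimes> n \<otimes> g))) - f (single n)"
        using fun_cong[OF eq] 1 2 by metis
    next
      assume eq: "\<forall>n\<in>N. act n (t g) - t g = act g (f (single (inv g \<otimes> n \<otimes> g))) - f (single n)"
      show "N.diff 0 (const_cochain (t g)) = conj_act G N act 1 g f - f"
      proof (rule cochain_eqI[of 1 N])
        show "N.diff 0 (const_cochain (t g)) x = (conj_act G N act 1 g f - f) x" if "x \<in> tuples 1 N" for x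
          using that eq 1 2 by (auto simp only: tuples_1)
      qed (use assms in \<open>simp_all add: group_diff_outside conj_act_def extend_zero_def\<close>)
    qed
  qed
  then show ?thesis by (simp add: invariant_by_def)
qed

abbreviation ZN where "ZN \<equiv> N.Z 1"
abbreviation BN where "BN \<equiv> N.B 1"
abbreviation connecting where "connecting \<equiv> connecting_cochains G MG MA act N"
abbreviation ZI where "ZI \<equiv> Z_s_inv G MG MA act N MN 1"

lemma ZN_iff: "f \<in> ZN \<longleftrightarrow> f \<in> N.cochains 1 \<and>
    (\<forall>m\<in>N. \<forall>n\<in>N. f (single (m \<otimes> n)) = f (single m) + act m (f (single n)))"
  unfolding N.Z_s_1_iff by simp

lemma N_outside: "f \<in> N.cochains 1 \<Longrightarrow> x \<notin> tuples 1 N \<Longrightarrow> f x = 0"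
  using N.cochains_outside[of f 1 x] by simp

lemma ZN_outside: "f \<in> ZN \<Longrightarrow> \<forall>x. x \<notin> tuples 1 N \<longrightarrow> f x = 0"
  using N_outside unfolding ZN_iff by blast

text \<open>In degree 1 the cochains \<open>\<theta> g\<close> have degree 0, so they are elements
  of the module, and the second factor of the product manifold is a point. Joint smoothness thereby
  reduces to smoothness of one function on G near \<one>.\<close>

lemma ZI_iff: "f \<in> ZI \<longleftrightarrow> f \<in> ZN \<and> (\<exists>t. invariant_by t f \<and> smooth_near MG MA \<one> t)"
proof -
  let ?P = "prod_manifold MG (power_manifold 0 MN)"
  have ch0: "charted (power_manifold 0 MN)" by (rule charted_power_manifold[OF N.charted_MG])
  have ch: "charted ?P" by (rule charted_prod_manifold[OF charted_MG ch0])
  have top: "topspace (topo (power_manifold 0 MN)) = {empty_tuple}"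
    unfolding N.topspace_power tuples_0 ..
  have e: "(\<lambda>i\<in>{..<1 - 1::nat}. \<one>) = empty_tuple" by (simp add: restrict_def)
  have near: "smooth_near ?P MA (\<one>, empty_tuple) (\<lambda>(g, x). \<theta> g x) \<longleftrightarrow> smooth_near MG MA \<one> (\<lambda>g. \<theta> g empty_tuple)" for \<theta>
  proof
    assume "smooth_near ?P MA (\<one>, empty_tuple) (\<lambda>(g, x). \<theta> g x)"
    then show "smooth_near MG MA \<one> (\<lambda>g. \<theta> g empty_tuple)"
      by (intro near_compose_pair[OF charted_MG charted_MG ch0 charted_MA smooth_near_ident[OF MG]
            smooth_near_const[OF charted_MG ch0]])
        (simp_all add: topspace_MG top del: power_manifold_simps)
  next
    assume "smooth_near MG MA \<one> (\<lambda>g. \<theta> g empty_tuple)"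
    moreover have "smooth_near ?P MG (\<one>, empty_tuple) fst"
      by (rule smooth_map_near[OF smooth_map_fst[OF MG ch0]])
        (simp add: topspace_MG top del: power_manifold_simps)
    ultimately have "smooth_near ?P MA (\<one>, empty_tuple) (\<lambda>z. \<theta> (fst z) empty_tuple)"
      by (intro smooth_near_compose[OF ch charted_MG charted_subspace[OF charted_MA]]) simp_all
    then show "smooth_near ?P MA (\<one>, empty_tuple) (\<lambda>(g, x). \<theta> g x)"
      by (rule smooth_near_cong_topspace[OF ch]) (auto simp: top simp del: power_manifold_simps)
  qed
  show ?thesis
  proof
    assume "f \<in> ZI"
    then obtain \<theta> where f: "f \<in> ZN" and \<theta>: "\<And>g. g \<in> carrier G \<Longrightarrow> \<theta> g \<in> N.cochains 0"
        "\<And>g. g \<in> carrier G \<Longrightarrow> N.diff 0 (\<theta> g) = conj_act G N act 1 g f - f"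
        "smooth_near MG MA \<one> (\<lambda>g. \<theta> g empty_tuple)"
      unfolding Z_s_inv_def e using near by auto
    have "\<theta> g = const_cochain (\<theta> g empty_tuple)" if "g \<in> carrier G" for g
      using \<theta>(1)[OF that] by (auto simp: N.cochains_0_iff)
    then have "invariant_by (\<lambda>g. \<theta> g empty_tuple) f"
      using \<theta>(2) invariant_by_iff[OF ZN_outside[OF f], where t = "\<lambda>g. \<theta> g empty_tuple"] by simp
    then show "f \<in> ZN \<and> (\<exists>t. invariant_by t f \<and> smooth_near MG MA \<one> t)" using f \<theta>(3) by blast
  next
    assume "f \<in> ZN \<and> (\<exists>t. invariant_by t f \<and> smooth_near MG MA \<one> t)"
    then obtain t where f: "f \<in> ZN" and t: "invariant_by t f" "smooth_near MG MA \<one> t" by blast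
    have "\<forall>g\<in>carrier G. N.diff 0 (const_cochain (t g)) = conj_act G N act 1 g f - f"
      using t(1) invariant_by_iff[OF ZN_outside[OF f], where t = t] by blast
    moreover have "smooth_near ?P MA (\<one>, empty_tuple) (\<lambda>(g, x). const_cochain (t g) x)"
      using t(2) by (simp only: near const_cochain_empty)
    moreover have "const_cochain (t g) \<in> N.cochains 0" for g
      using N.cochains_0_iff by blast
    ultimately show "f \<in> ZI"
      using f unfolding Z_s_inv_def e by (auto intro!: exI[of _ "\<lambda>g. const_cochain (t g)"])
  qed
qed

lemma invariant_by_diff:
  assumes "invariant_by t f" "invariant_by t' f'"
  shows "invariant_by (\<lambda>g. t g - t' g) (f - f')"
  unfolding invariant_by_def
proof (intro ballI)
  fix g n assume gn: "g \<in> carrier G" "n \<in> N"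
  have "act n (t g - t' g) - (t g - t' g) = (act n (t g) - t g) - (act n (t' g) - t' g)"
    using gn by (simp add: act_diff mem_carrier)
  also have "\<dots> = (act g (f (single (inv g \<otimes> n \<otimes> g))) - f (single n)) -
      (act g (f' (single (inv g \<otimes> n \<otimes> g))) - f' (single n))"
    using assms gn unfolding invariant_by_def by metis
  also have "\<dots> = act g ((f - f') (single (inv g \<otimes> n \<otimes> g))) - (f - f') (single n)"
    using gn by (simp add: act_diff)
  finally show "act n (t g - t' g) - (t g - t' g) =
      act g ((f - f') (single (inv g \<otimes> n \<otimes> g))) - (f - f') (single n)" .
qed

lemma add_subgroup_ZI: "add_subgroup ZI"
  unfolding add_subgroup_def
proof (intro conjI ballI)
  have "invariant_by (\<lambda>_. 0) 0" by (simp add: invariant_by_def act_0 mem_carrier)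
  moreover have "smooth_near MG MA \<one> (\<lambda>_. 0)"
    by (rule near_const[OF charted_MG]) (simp add: topspace_MG)
  ultimately show "0 \<in> ZI"
    using add_subgroup_0[OF N.cochain_complex(1)[of 1]] unfolding ZI_iff by blast
  fix f f' assume "f \<in> ZI" "f' \<in> ZI"
  then obtain t t' where *: "f \<in> ZN" "f' \<in> ZN" "invariant_by t f" "invariant_by t' f'"
      "smooth_near MG MA \<one> t" "smooth_near MG MA \<one> t'" unfolding ZI_iff by blast
  then show "f - f' \<in> ZI"
    using add_subgroup_diff[OF N.cochain_complex(1)[of 1]] invariant_by_diff near_diff[OF charted_MG]
    unfolding ZI_iff by blast
qed

lemma connecting_iff:
  assumes "\<forall>x. x \<notin> tuples 1 N \<longrightarrow> f x = 0"
  shows "a \<in> connecting f \<longleftrightarrow> a \<in> cochains 1 \<and>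
    invariant_by (\<lambda>g. a (single g)) f \<and>
    (\<forall>g\<in>carrier G. \<forall>n\<in>N. a (single (g \<otimes> n)) = a (single g) + act g (f (single n)))"
  unfolding connecting_cochains_def mem_Collect_eq single_def[symmetric]
  using invariant_by_iff[OF assms, where t = "\<lambda>g. a (single g)"] by blast

text \<open>The assumptions \<open>right\<close> and \<open>left\<close> say that d_G a vanishes
  when one of its arguments lies in N. Equating the two rules for n g = g (inv g n g) yields
  invariance, with \<open>a\<close> itself as the required function on G. They are satisfied by
  cocycles on G and by cochains whose boundary is inflated from G/N.\<close>

lemma res_invariant:
  assumes a: "a \<in> cochains 1"
    and right: "\<And>g n. g \<in> carrier G \<Longrightarrow> n \<in> N \<Longrightarrow> a (single (g \<otimes> n)) = a (single g) + act g (a (single n))"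
    and left: "\<And>g n. g \<in> carrier G \<Longrightarrow> n \<in> N \<Longrightarrow> a (single (n \<otimes> g)) = a (single n) + act n (a (single g))"
  shows "res a \<in> ZI" and "a \<in> connecting (res a)"
proof -
  have inv: "invariant_by (\<lambda>g. a (single g)) (res a)"
    unfolding invariant_by_def
  proof (intro ballI)
    fix g n assume g: "g \<in> carrier G" and n: "n \<in> N"
    note c = inv_op_closed1[OF g n]
    have "a (single n) + act n (a (single g)) = a (single g) + act g (a (single (inv g \<otimes> n \<otimes> g)))"
      using right[OF g c] left[OF g n] by (simp add: mult_conj g n)
    then show "act n (a (single g)) - a (single g) = act g (res a (single (inv g \<otimes> n \<otimes> g))) - res a (single n)"
      using n c by (simp add: res_single[unfolded One_nat_def] algebra_simps)
  qed
  have "res a \<in> ZN"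
    unfolding ZN_iff using right by (simp add: res_cochain[OF a, unfolded One_nat_def] res_single[unfolded One_nat_def] mem_carrier)
  moreover have "smooth_near MG MA \<one> (\<lambda>g. a (single g))" using a unfolding cochains_1_iff by blast
  ultimately show "res a \<in> ZI" using inv unfolding ZI_iff by blast
  show "a \<in> connecting (res a)"
    using a inv right connecting_iff[of "res a" a] by (simp add: res_single res_outside del: One_nat_def)
qed

subsection \<open>The connecting map\<close>

text \<open>In this locale \<open>one_closed\<close> and \<open>m_closed\<close> speak about the subgroup \<open>N\<close>.\<close>

lemmas G_one_closed = monoid.one_closed[OF is_monoid]
lemmas G_m_closed = monoid.m_closed[OF is_monoid]

lemma ex_connecting_cochain:
  assumes f: "f \<in> ZI"
  shows "\<exists>a. a \<in> connecting f"
proof -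
  obtain t where fN: "f \<in> ZN" and t: "invariant_by t f" "smooth_near MG MA \<one> t"
    using f unfolding ZI_iff by blast
  have f_coch: "f \<in> N.cochains 1"
    and cocycle: "\<And>m n. m \<in> N \<Longrightarrow> n \<in> N \<Longrightarrow> f (single (m \<otimes> n)) = f (single m) + act m (f (single n))"
    using fN unfolding ZN_iff by auto
  have f_one: "f (single \<one>) = 0"
    using f_coch unfolding N.cochains_1_iff by simp
  \<comment> \<open>A cochain has to vanish at \<one>, which is not guaranteed for
    \<open>t\<close>.\<close>
  define t0 where "t0 g = t g - t \<one>" for g
  \<comment> \<open>Invariance at g = \<one> reads n.t(\<one>) - t(\<one>) = f n - f n. So t(\<one>)
    is fixed by N, and subtracting it leaves the invariance equation intact.\<close>
  have t_one: "act n (t \<one>) = t \<one>" if "n \<in> N" for n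
    using t(1)[unfolded invariant_by_def, rule_format, OF G_one_closed that] that by (simp add: act_one mem_carrier)
  have inv0: "act n (t0 g) - t0 g = act g (f (single (inv g \<otimes> n \<otimes> g))) - f (single n)"
    if "g \<in> carrier G" "n \<in> N" for g n
    using t(1)[unfolded invariant_by_def, rule_format, OF that] that
    by (simp add: t0_def act_diff mem_carrier t_one)
  define m where "m g = inv (s g) \<otimes> g" for g
  have m: "m g \<in> N" "s g \<otimes> m g = g" "s g \<in> carrier G" if "g \<in> carrier G" for g
    using fibre_closed[OF that] s_closed[OF that] that by (simp_all add: m_def m_assoc[symmetric])
  have m_mult: "m (g \<otimes> n) = m g \<otimes> n" if "g \<in> carrier G" "n \<in> N" for g n
    using that s_closed[of g] by (simp add: m_def s_coset m_assoc mem_carrier)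
  define a where "a = extend_zero (tuples 1 (carrier G))
    (\<lambda>x. t0 (s (x 0)) + act (s (x 0)) (f (single (m (x 0)))))"
  have a_single: "a (single g) = t0 (s g) + act (s g) (f (single (m g)))" if "g \<in> carrier G" for g
    using that by (simp add: a_def extend_zero_def)
  have "a \<in> cochains 1"
    unfolding cochains_1_iff
  proof (intro conjI allI impI)
    show "a x = 0" if "x \<notin> tuples 1 (carrier G)" for x
      using that by (simp add: a_def extend_zero_def)
    show "a (single \<one>) = 0"
      by (simp add: a_single m_def s_one t0_def f_one act_0)
    have one_top: "\<one> \<in> topspace (topo MG)" by (simp add: topspace_MG)
    have "smooth_near MG MA (s \<one>) t0"
      unfolding t0_def s_one by (intro near_diff near_const charted_MG t(2) one_top)
    then have "smooth_near MG MA \<one> (\<lambda>g. t0 (s g))"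
      by (rule smooth_near_compose[OF charted_MG charted_MG charted_subspace[OF charted_MA] s_near])
    moreover have "smooth_near MG MA \<one> (\<lambda>g. f (single (m g)))"
      unfolding m_def by (rule N.near_cochain_1[OF charted_MG f_coch fibre_near]) (simp add: s_one)
    ultimately have "smooth_near MG MA \<one> (\<lambda>g. t0 (s g) + act (s g) (f (single (m g))))"
      by (intro near_add near_act charted_MG s_near)
    then show "smooth_near MG MA \<one> (\<lambda>g. a (single g))"
      by (rule smooth_near_cong_topspace[OF charted_MG]) (simp add: topspace_MG a_single)
  qed
  moreover have "invariant_by (\<lambda>g. a (single g)) f"
    unfolding invariant_by_def
  proof (intro ballI)
    fix g n assume g: "g \<in> carrier G" and n: "n \<in> N"
    let ?\<sigma> = "s g" and ?m = "m g" and ?n = "inv (s g) \<otimes> n \<otimes> s g"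
    note mg = m[OF g]
    have mG: "?m \<in> carrier G" using mg(1) by (rule mem_carrier)
    have n': "?n \<in> N" using inv_op_closed1[OF mg(3) n] .
    \<comment> \<open>Conjugation by g is split along g = s(g) m: the part belonging to s(g) is
      governed by \<open>t0\<close>, the part belonging to m takes place inside N and is governed by
      the cocycle identity.\<close>
    have conj: "inv g \<otimes> n \<otimes> g = inv ?m \<otimes> ?n \<otimes> ?m"
    proof -
      have "inv g = inv ?m \<otimes> inv ?\<sigma>"
        using inv_mult_group[OF mg(3) mG] mg(2) by simp
      then have "inv g \<otimes> n \<otimes> g = inv ?m \<otimes> inv ?\<sigma> \<otimes> n \<otimes> (?\<sigma> \<otimes> ?m)"
        using mg(2) by simp
      then show ?thesis using mg(3) mG n by (simp add: m_assoc mem_carrier)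
    qed
    have c: "inv ?m \<otimes> ?n \<otimes> ?m \<in> N"
      using inv_op_closed1[OF mG n'] .
    \<comment> \<open>The product is also \<open>?m\<close> times the conjugate of \<open>?n\<close>
      by \<open>?m\<close>. Comparing this expansion with the direct one isolates the conjugated
      value of \<open>f\<close>.\<close>
    have "f (single (?n \<otimes> ?m)) = f (single ?m) + act ?m (f (single (inv ?m \<otimes> ?n \<otimes> ?m)))"
      using cocycle[OF mg(1) c] by (simp add: mult_conj[OF mG n'])
    then have "act ?m (f (single (inv g \<otimes> n \<otimes> g))) = f (single ?n) + act ?n (f (single ?m)) - f (single ?m)"
      using cocycle[OF n' mg(1)] by (simp add: conj algebra_simps)
    then have "act ?\<sigma> (act ?m (f (single (inv g \<otimes> n \<otimes> g)))) =
        act ?\<sigma> (f (single ?n)) + act ?\<sigma> (act ?n (f (single ?m))) - act ?\<sigma> (f (single ?m))"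
      using mg(3) by (simp add: act_add act_diff)
    moreover have "act ?\<sigma> (act ?m b) = act g b" for b
      using act_mult[OF mg(3) mG, of b] mg(2) by simp
    moreover have "act ?\<sigma> (act ?n b) = act n (act ?\<sigma> b)" for b
      using act_mult[OF mg(3) mem_carrier[OF n'], of b] act_mult[OF mem_carrier[OF n] mg(3), of b]
        mult_conj[OF mg(3) n] by simp
    ultimately have "act g (f (single (inv g \<otimes> n \<otimes> g))) =
        act ?\<sigma> (f (single ?n)) + act n (act ?\<sigma> (f (single ?m))) - act ?\<sigma> (f (single ?m))" by simp
    then show "act n (a (single g)) - a (single g) = act g (f (single (inv g \<otimes> n \<otimes> g))) - f (single n)"
      using inv0[OF mg(3) n] g n by (simp add: a_single act_add mem_carrier algebra_simps)
  qed
  moreover have "a (single (g \<otimes> n)) = a (single g) + act g (f (single n))" if g: "g \<in> carrier G" and n: "n \<in> N" for g n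
  proof -
    have "act (s g) (act (m g) b) = act g b" for b
      using act_mult[OF m(3)[OF g] mem_carrier[OF m(1)[OF g]], of b] m(2)[OF g] by simp
    then show ?thesis
      using g n m[OF g] by (simp add: a_single mem_carrier s_coset m_mult cocycle act_add add.assoc)
  qed
  ultimately show ?thesis
    using connecting_iff[OF ZN_outside[OF fN], of a] by blast
qed

section \<open>Boundaries of connecting cochains and their descent to the quotient\<close>

context
  fixes a f
  assumes fN: "f \<in> ZN" and a: "a \<in> connecting f"
begin

lemma connecting_cochain: "a \<in> cochains 1"
  using a connecting_iff[OF ZN_outside[OF fN]] by blast

lemma connecting_right:
  "g \<in> carrier G \<Longrightarrow> n \<in> N \<Longrightarrow> a (single (g \<otimes> n)) = a (single g) + act g (f (single n))"
  using a connecting_iff[OF ZN_outside[OF fN]] by blast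

text \<open>Writing n g = g (inv g n g) makes the right rule applicable; invariance then trades the
  conjugated value of \<open>f\<close> for the translate of \<open>a\<close> by n.\<close>

lemma connecting_left:
  assumes "g \<in> carrier G" "n \<in> N"
  shows "a (single (n \<otimes> g)) = f (single n) + act n (a (single g))"
proof -
  have "invariant_by (\<lambda>g. a (single g)) f"
    using a connecting_iff[OF ZN_outside[OF fN]] by blast
  then have "act n (a (single g)) - a (single g) = act g (f (single (inv g \<otimes> n \<otimes> g))) - f (single n)"
    using assms unfolding invariant_by_def by blast
  moreover have "a (single (n \<otimes> g)) = a (single g) + act g (f (single (inv g \<otimes> n \<otimes> g)))"
    using connecting_right[OF assms(1) inv_op_closed1[OF assms]] by (simp add: mult_conj[OF assms])
  ultimately show ?thesis by (simp add: algebra_simps)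
qed

text \<open>This is the right rule at g = \<one>, where \<open>a\<close> vanishes.\<close>

lemma connecting_on_N:
  assumes "n \<in> N"
  shows "a (single n) = f (single n)"
proof -
  have "a (single \<one>) = 0" using connecting_cochain unfolding cochains_1_iff by blast
  then show ?thesis using connecting_right[OF G_one_closed assms] assms by (simp add: mem_carrier act_one)
qed

lemma connecting_factors:
  obtains h where "h \<in> ZQ 2" "pull 2 h = diff 1 a"
proof -
  let ?c = "diff 1 a"
  note D = group_diff_1
  have c: "?c \<in> cochains 2" by (rule diff_1_cochain[OF connecting_cochain])
  have right1: "?c (pair g (h \<otimes> n)) = ?c (pair g h)" if "g \<in> carrier G" "h \<in> carrier G" "n \<in> N" for g h n
  proof -
    have "a (single (g \<otimes> (h \<otimes> n))) = a (single (g \<otimes> h)) + act g (act h (f (single n)))"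
      using connecting_right[of "g \<otimes> h" n] that by (simp add: m_assoc mem_carrier act_mult)
    then show ?thesis
      unfolding D[OF that(1,2)] D[OF that(1) G_m_closed[OF that(2) mem_carrier[OF that(3)]]]
      using that by (simp add: connecting_right act_add)
  qed
  \<comment> \<open>The factor n between g and h is moved to the right end by n h = h (inv h n h).
    The extra terms cancel once the two expansions of \<open>a\<close> at n h, from the right and
    the left rule, are equated.\<close>
  have right0: "?c (pair (g \<otimes> n) h) = ?c (pair g h)" if "g \<in> carrier G" "h \<in> carrier G" "n \<in> N" for g h n
  proof -
    let ?n = "inv h \<otimes> n \<otimes> h"
    have n': "?n \<in> N" by (rule inv_op_closed1[OF that(2,3)])
    have gh: "(g \<otimes> n) \<otimes> h = (g \<otimes> h) \<otimes> ?n"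
      using mult_conj[OF that(2,3)] that by (simp add: m_assoc mem_carrier)
    have 1: "a (single ((g \<otimes> n) \<otimes> h)) = a (single (g \<otimes> h)) + act g (act h (f (single ?n)))"
      unfolding gh using connecting_right[of "g \<otimes> h" ?n] n' that by (simp add: act_mult)
    have "a (single h) + act h (f (single ?n)) = f (single n) + act n (a (single h))"
      using connecting_right[OF that(2) n'] connecting_left[OF that(2,3)] by (simp add: mult_conj that)
    then have "act n (a (single h)) = a (single h) + act h (f (single ?n)) - f (single n)"
      by (simp add: algebra_simps)
    then have 2: "act (g \<otimes> n) (a (single h)) = act g (a (single h)) + act g (act h (f (single ?n))) - act g (f (single n))"
      using that by (simp add: act_mult mem_carrier act_add act_diff)
    show ?thesis
      unfolding D[OF that(1,2)] D[OF G_m_closed[OF that(1) mem_carrier[OF that(3)]] that(2)] 1 2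
      using that by (simp add: connecting_right)
  qed
  \<comment> \<open>By normality a left factor of g is a right factor: n g = g (inv g n g).\<close>
  have left: "?c (pair (n \<otimes> g) h) = ?c (pair g h)" if "g \<in> carrier G" "h \<in> carrier G" "n \<in> N" for g h n
    using right0[OF that(1,2) inv_op_closed1[OF that(1,3)]] by (simp add: mult_conj that)
  have fixed: "act n (?c (pair g h)) = ?c (pair g h)" if "g \<in> carrier G" "h \<in> carrier G" "n \<in> N" for g h n
  proof -
    have n: "n \<in> carrier G" by (rule mem_carrier[OF that(3)])
    have "act n (?c (pair g h)) = act (n \<otimes> g) (a (single h)) - act n (a (single (g \<otimes> h))) + act n (a (single g))"
      unfolding D[OF that(1,2)] using that n by (simp add: act_add act_diff act_mult)
    also have "\<dots> = ?c (pair (n \<otimes> g) h)"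
      unfolding D[OF G_m_closed[OF n that(1)] that(2)]
      using that n connecting_left[of g n] connecting_left[of "g \<otimes> h" n] by (simp add: m_assoc)
    also have "\<dots> = ?c (pair g h)" by (rule left[OF that])
    finally show ?thesis .
  qed
  obtain h where h: "h \<in> quot 2" "pull 2 h = ?c"
  proof (rule factor_cochain[OF c])
    show "?c x \<in> fixed_points act N" for x
    proof (cases "x \<in> tuples 2 (carrier G)")
      case True
      then show ?thesis using fixed by (auto simp del: One_nat_def simp: tuples_2 fixed_points_def)
    next
      case False
      then show ?thesis using cochains_outside[OF c] add_subgroup_0[OF add_subgroup_fixed] by simp
    qed
    fix x x' assume x: "x \<in> tuples 2 (carrier G)" "x' \<in> tuples 2 (carrier G)"
      and eq: "\<And>i. i < 2 \<Longrightarrow> x i <# N = x' i <# N"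
    obtain g h where gh: "x = pair g h" "g \<in> carrier G" "h \<in> carrier G" using x(1) by (auto simp: tuples_2)
    obtain g' h' where gh': "x' = pair g' h'" "g' \<in> carrier G" "h' \<in> carrier G" using x(2) by (auto simp: tuples_2)
    obtain n where n: "n \<in> N" "g' = g \<otimes> n" using coset_eqD[of g g'] eq[of 0] gh gh' by auto
    obtain n' where n': "n' \<in> N" "h' = h \<otimes> n'" using coset_eqD[of h h'] eq[of 1] gh gh' by auto
    show "?c x = ?c x'"
      unfolding gh(1) gh'(1) n(2) n'(2)
      using right1[of "g \<otimes> n" h n'] right0[of g h n] gh n(1) n'(1) mem_carrier by simp
  qed (rule that)
  moreover have "h \<in> ZQ 2"
    using h by (simp only: Z_s_quot_iff diff_2_diff_1)
  ultimately show ?thesis using that by blast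
qed

end

text \<open>A relation rather than a function, since \<open>a\<close> is determined by
  \<open>f\<close> only up to 1-cochains pulled back from G/N.\<close>

definition connecting_rel :: "((nat \<Rightarrow> 'g) \<Rightarrow> 'a) \<Rightarrow> ((nat \<Rightarrow> 'g set) \<Rightarrow> 'a) \<Rightarrow> bool"
  where "connecting_rel f h \<longleftrightarrow> h \<in> ZQ 2 \<and>
    (\<exists>a. a \<in> connecting f \<and> pull 2 h = diff 1 a)"

subsection \<open>The induced maps\<close>

lemma Z_s_iff: "f \<in> Z p \<longleftrightarrow> f \<in> cochains p \<and> diff p f = 0"
  by (simp add: Z_s_def cocycles_def)

lemma diff_const_single:
  "g \<in> carrier G \<Longrightarrow> diff 0 (const_cochain b) (single g) = act g b - b"
  by (simp add: group_diff_0)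

lemma N_diff_const_single:
  "n \<in> N \<Longrightarrow> N.diff 0 (const_cochain b) (single n) = act n b - b"
  by (subst group_diff_0) simp_all

lemma res_diff_const: "res (diff 0 (const_cochain b)) = N.diff 0 (const_cochain b)"
proof (rule cochain_eqI[OF res_outside])
  show "N.diff 0 (const_cochain b) x = 0" if "x \<notin> tuples 1 N" for x
    using that by (intro group_diff_outside) simp
  show "res (diff 0 (const_cochain b)) x = N.diff 0 (const_cochain b) x" if x: "x \<in> tuples 1 N" for x
  proof -
    obtain n where "n \<in> N" "x = single n" using x unfolding tuples_1 by auto
    then show ?thesis
      by (simp only: res_single N_diff_const_single diff_const_single[OF mem_carrier])
  qed
qed

text \<open>For f = d_N b the function g.b - b of g is a witness: n.(g.b) equals g.((inv g n g).b),
  and it is smooth near \<one> because the action is.\<close>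

lemma BN_subset_ZI: "BN \<subseteq> ZI"
proof
  fix f assume f: "f \<in> BN"
  then obtain b where b: "f = N.diff 0 (const_cochain b)" unfolding N.B_s_1 by auto
  have fN: "f \<in> ZN" using f N.cochain_complex(3)[of 1] by blast
  let ?t = "\<lambda>g. act g b - b"
  have "invariant_by ?t f"
    unfolding invariant_by_def
  proof (intro ballI)
    fix g n assume g: "g \<in> carrier G" and n: "n \<in> N"
    have "act g (act (inv g \<otimes> n \<otimes> g) b) = act n (act g b)"
      using act_mult[OF g mem_carrier[OF inv_op_closed1[OF g n]], of b] act_mult[OF mem_carrier[OF n] g, of b]
      by (simp add: mult_conj g n)
    then show "act n (act g b - b) - (act g b - b) =
        act g (f (single (inv g \<otimes> n \<otimes> g))) - f (single n)"
      unfolding b N_diff_const_single[OF n] N_diff_const_single[OF inv_op_closed1[OF g n]]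
      using g n by (simp add: act_diff mem_carrier)
  qed
  moreover have "smooth_near MG MA \<one> ?t"
    by (intro near_diff near_act near_const charted_MG smooth_near_ident[OF MG]) (simp_all add: topspace_MG)
  ultimately show "f \<in> ZI" unfolding ZI_iff using fN by blast
qed

lemma cocycle_res:
  assumes "f \<in> Z 1"
  shows "res f \<in> ZI" "f \<in> connecting (res f)"
  using assms unfolding Z_s_1_iff by (auto intro!: res_invariant simp: mem_carrier simp del: One_nat_def)

lemma res_diff: "res (f - f') = res f - res f'"
  by (auto simp: extend_zero_def fun_eq_iff)

lemma pull_Z:
  "f \<in> ZQ p \<Longrightarrow> pull p f \<in> Z p"
  by (simp add: Z_s_quot_iff Z_s_iff quot_pull)

lemma pull_B:
  assumes "f \<in> BQ p" "p = 1 \<or> p = 2"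
  shows "pull p f \<in> B p"
proof -
  obtain q where q: "p = Suc q" using assms(2) by auto
  then obtain b where b: "b \<in> quot q" "f = quot_diff q b"
    using assms(1) unfolding q B_s_quot_Suc by auto
  then show ?thesis
    using quot_pull[OF b(1)] unfolding q b(2) pull_quot_diff[OF b(1)] by (simp add: B_s_def coboundaries_def)
qed

text \<open>Brings the definitions of inflation and restriction into the relational shape of
  \<open>induced_quotient_map\<close>.\<close>

lemma the_elem_image_rel:
  "the_elem ((\<lambda>f. k (\<phi> f)) ` c) = the_elem {k h | h g. g \<in> c \<and> h = \<phi> g}"
  by (rule arg_cong[of _ _ the_elem]) auto

lemma induced_inflation:
  assumes p: "p = 1 \<or> p = 2"
  shows "induced_quotient_map (ZQ p) (BQ p)
    (Z p) (B p) (\<lambda>f h. h = pull p f) (inflation G MG MA act N p)"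
proof
  show "inflation G MG MA act N p (coset_of (ZQ p) (BQ p) f) =
    the_elem {coset_of (Z p) (B p) h | h g.
      g \<in> coset_of (ZQ p) (BQ p) f \<and> h = pull p g}" for f
    unfolding inflation_def by (rule the_elem_image_rel)
qed (use quot_complex[OF p] cochain_complex[OF p] pull_Z pull_B p in \<open>auto simp: pull_diff\<close>)

lemma induced_restriction:
  "induced_quotient_map (Z 1) (B 1) ZI BN (\<lambda>f h. h = res f)
    (restriction G MG MA act N MN 1)"
proof
  show "restriction G MG MA act N MN 1 (coset_of (Z 1) (B 1) f) =
    the_elem {coset_of ZI BN h | h g. g \<in> coset_of (Z 1) (B 1) f \<and> h = res g}" for f
    unfolding restriction_def by (rule the_elem_image_rel)
  show "h \<in> BN" if "f \<in> B 1" "h = res f" for f h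
    using that unfolding B_s_1 N.B_s_1 by (auto simp only: res_diff_const)
  show "add_subgroup (Z 1)" "add_subgroup (B 1)"
    "B 1 \<subseteq> Z 1" "add_subgroup BN"
    using cochain_complex[of 1] N.cochain_complex[of 1] by simp_all
qed (simp_all add: add_subgroup_ZI[unfolded One_nat_def] BN_subset_ZI[unfolded One_nat_def]
    cocycle_res[unfolded One_nat_def] res_diff[unfolded One_nat_def])

lemma connecting_cochains_diff:
  assumes "f \<in> ZN" "f' \<in> ZN" "a \<in> connecting f" "a' \<in> connecting f'"
  shows "a - a' \<in> connecting (f - f')"
proof -
  have ff': "f - f' \<in> ZN" by (rule add_subgroup_diff[OF N.cochain_complex(1)[of 1] assms(1,2)]) simp
  have *: "a \<in> cochains 1" "invariant_by (\<lambda>g. a (single g)) f" "a' \<in> cochains 1" "invariant_by (\<lambda>g. a' (single g)) f'"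
    using assms connecting_iff[OF ZN_outside[OF assms(1)]] connecting_iff[OF ZN_outside[OF assms(2)]] by blast+
  have "invariant_by (\<lambda>g. (a - a') (single g)) (f - f')"
    using invariant_by_diff[OF *(2,4)] by simp
  moreover have "a - a' \<in> cochains 1" by (rule add_subgroup_diff[OF add_subgroup_cochains *(1,3)])
  ultimately show ?thesis
    unfolding connecting_iff[OF ZN_outside[OF ff']]
    by (simp add: connecting_right[OF assms(1,3)] connecting_right[OF assms(2,4)] act_diff)
qed

text \<open>Makes the connecting map well defined. If f = d_N b, then a - d_G b is constant on
  cosets with N-fixed values, hence pulled back from some \<beta> on G/N; the differential of
  \<beta> is h because d_G d_G b = 0.\<close>

lemma connecting_boundary:
  assumes f: "f \<in> BN" and h: "connecting_rel f h"
  shows "h \<in> BQ 2"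
proof -
  have fN: "f \<in> ZN" using f N.cochain_complex(3)[of 1] by blast
  obtain b where b: "f = N.diff 0 (const_cochain b)" using f unfolding N.B_s_1 by auto
  have f_single: "f (single n) = act n b - b" if "n \<in> N" for n
    unfolding b by (rule N_diff_const_single[OF that])
  obtain a where a: "a \<in> connecting f" "pull 2 h = diff 1 a" and hZ: "h \<in> ZQ 2"
    using h unfolding connecting_rel_def by auto
  define a' where "a' = a - diff 0 (const_cochain b)"
  have a'_single: "a' (single g) = a (single g) - (act g b - b)" if "g \<in> carrier G" for g
    using that by (simp add: a'_def diff_const_single)
  have "diff 0 (const_cochain b) \<in> cochains 1"
    by (rule diff_0_cochain) (use cochains_0_iff in blast)
  then have a': "a' \<in> cochains 1"
    unfolding a'_def by (rule add_subgroup_diff[OF add_subgroup_cochains connecting_cochain[OF fN a(1)]])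
  have right: "a' (single (g \<otimes> n)) = a' (single g)" if g: "g \<in> carrier G" and n: "n \<in> N" for g n
    unfolding a'_single[OF g] a'_single[OF G_m_closed[OF g mem_carrier[OF n]]] connecting_right[OF fN a(1) g n] f_single[OF n]
    using g n by (simp add: act_diff act_mult mem_carrier)
  obtain \<beta> where \<beta>: "\<beta> \<in> quot 1" "pull 1 \<beta> = a'"
  proof (rule factor_cochain_1[OF a' right])
    fix g n assume g: "g \<in> carrier G" and n: "n \<in> N"
    have nG: "n \<in> carrier G" using n by (rule mem_carrier)
    have "a (single (n \<otimes> g)) = act n b - b + act n (a (single g))"
      using connecting_left[OF fN a(1) g n] f_single[OF n] by simp
    then have "act n (a' (single g)) = a' (single (n \<otimes> g))"
      unfolding a'_single[OF g] a'_single[OF G_m_closed[OF nG g]]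
      using g nG by (simp add: act_diff act_mult)
    also have "\<dots> = a' (single g)"
      using right[OF g inv_op_closed1[OF g n]] by (simp add: mult_conj g n)
    finally show "act n (a' (single g)) = a' (single g)" .
  qed (auto intro: that)
  have "pull 2 (quot_diff 1 \<beta>) = diff 1 a'"
    using pull_quot_diff[OF \<beta>(1)] \<beta>(2) by (simp add: numeral_2_eq_2)
  also have "\<dots> = pull 2 h"
    unfolding a'_def diff_diff diff_1_diff_0 a(2) by simp
  finally have "quot_diff 1 \<beta> = h"
    by (rule pull_inj[rotated 2])
      (use hZ quot_outside in \<open>auto simp: Z_s_quot_iff numeral_2_eq_2 group_diff_outside\<close>)
  then show ?thesis
    using \<beta>(1) B_s_quot_Suc[of 1] by (auto simp: numeral_2_eq_2)
qed

lemma ZI_subset_ZN: "f \<in> ZI \<Longrightarrow> f \<in> ZN"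
  unfolding ZI_iff by blast

lemma induced_connecting:
  "induced_quotient_map ZI BN (ZQ 2) (BQ 2) connecting_rel
    (connecting_map G MG MA act N)"
proof
  show "\<exists>h. connecting_rel f h" if f: "f \<in> ZI" for f
  proof -
    obtain a where a: "a \<in> connecting f" using ex_connecting_cochain[OF f] by auto
    obtain h where "h \<in> ZQ 2" "pull 2 h = diff 1 a"
      by (rule connecting_factors[OF ZI_subset_ZN[OF f] a])
    then show ?thesis using a unfolding connecting_rel_def by blast
  qed
  show "connecting_rel (f - g) (h - k)" if fg: "f \<in> ZI" "g \<in> ZI" and rel: "connecting_rel f h" "connecting_rel g k" for f g h k
  proof -
    obtain a where a: "a \<in> connecting f" "pull 2 h = diff 1 a"
      using rel(1) unfolding connecting_rel_def by blast
    obtain a' where a': "a' \<in> connecting g" "pull 2 k = diff 1 a'"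
      using rel(2) unfolding connecting_rel_def by blast
    have hk: "h \<in> ZQ 2" "k \<in> ZQ 2"
      using rel unfolding connecting_rel_def by blast+
    have "a - a' \<in> connecting (f - g)" "pull 2 (h - k) = diff 1 (a - a')"
      using connecting_cochains_diff[OF fg[THEN ZI_subset_ZN] a(1) a'(1)]
      by (simp_all only: pull_diff diff_diff a(2) a'(2))
    moreover have "h - k \<in> ZQ 2"
      by (rule add_subgroup_diff[OF quot_complex(1) hk]) simp
    ultimately show ?thesis unfolding connecting_rel_def by blast
  qed
  show "connecting_map G MG MA act N (coset_of ZI BN f) =
    the_elem {coset_of (ZQ 2) (BQ 2) h | h g.
      g \<in> coset_of ZI BN f \<and> connecting_rel g h}" for f
    unfolding connecting_map_def connecting_rel_def by (rule arg_cong[of _ _ the_elem]) blast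
  show "h \<in> ZQ 2" if "connecting_rel f h" for f h
    using that unfolding connecting_rel_def by blast
  show "add_subgroup ZI" "BN \<subseteq> ZI" by (rule add_subgroup_ZI BN_subset_ZI)+
  show "add_subgroup BN" using N.cochain_complex(2)[of 1] by simp
  show "h \<in> BQ 2" if "f \<in> BN" "connecting_rel f h" for f h
    by (rule connecting_boundary[OF that])
qed (use quot_complex[of 2] in simp_all)

subsection \<open>Exactness\<close>

text \<open>A pulled-back function is constant on N, and normalization makes its value at \<one>
  zero.\<close>

lemma pull_1_on_N:
  assumes "f \<in> quot 1" "n \<in> N"
  shows "pull 1 f (single n) = 0"
proof -
  have "pull 1 f (single n) = pull 1 f (single \<one>)"
    using coset_mult[OF G_one_closed assms(2)] assms(2) by (simp add: pull_single[unfolded One_nat_def] mem_carrier)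
  then show ?thesis using quot_pull[OF assms(1)] unfolding cochains_1_iff by simp
qed

text \<open>If a pulled-back cocycle equals d_G b, its vanishing on N says that n.b = b. So b is
  N-fixed and already a 0-cochain on G/N.\<close>

lemma inflation_inj: "inj_on (inflation G MG MA act N 1) (carrier (H_s_quot G MG MA act N 1))"
proof -
  interpret I: induced_quotient_map "ZQ 1" "BQ 1"
    "Z 1" "B 1" "\<lambda>f h. h = pull 1 f" "inflation G MG MA act N 1"
    by (rule induced_inflation) simp
  show ?thesis
    unfolding H_s_quot_def
  proof (rule I.inj_onI)
    fix f h assume f: "f \<in> ZQ 1" and "h = pull 1 f" "h \<in> B 1"
    then obtain b where b: "pull 1 f = diff 0 (const_cochain b)" unfolding B_s_1 by auto
    have fq: "f \<in> quot 1" using f by (simp only: Z_s_quot_iff)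
    have "act n b = b" if "n \<in> N" for n
      using pull_1_on_N[OF fq that] diff_const_single[OF mem_carrier[OF that]] unfolding b by simp
    then have b_fixed: "b \<in> fixed_points act N" by (simp add: fixed_points_def)
    let ?k = "const_cochain b :: (nat \<Rightarrow> 'g set) \<Rightarrow> 'a"
    have pull_k: "pull 0 ?k = const_cochain b"
      by (auto simp: pullback_def const_cochain_def extend_zero_def tuples_0 restrict_def fun_eq_iff)
    have "?k \<in> quot 0"
      unfolding quot_cochains_def mem_Collect_eq pull_k cochains_0_iff
      using b_fixed by (auto simp: const_cochain_def extend_zero_def tuples_0)
    moreover from this have "quot_diff 0 ?k = f"
    proof (intro pull_inj[of 1])
      show "pull 1 (quot_diff 0 ?k) = pull 1 f"
        using pull_quot_diff[OF \<open>?k \<in> quot 0\<close>] unfolding b pull_k by simp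
    qed (use quot_outside[OF fq] in \<open>simp_all add: group_diff_outside\<close>)
    ultimately show "f \<in> BQ 1"
      using B_s_quot_Suc[of 0] by auto
  qed
qed

text \<open>A cocycle that restricts to d_N b becomes, after subtracting d_G b, a cocycle vanishing
  on N. The cocycle identity then makes it constant on cosets with N-fixed values, so it is
  inflated.\<close>

lemma exact_at_H1:
  "kernel (H_s G MG MA act 1) (H_s_inv G MG MA act N MN 1) (restriction G MG MA act N MN 1)
    = inflation G MG MA act N 1 ` carrier (H_s_quot G MG MA act N 1)"
  unfolding H_s_def H_s_inv_def H_s_quot_def
proof (rule exact_at[OF induced_inflation induced_restriction])
  fix e h assume e: "e \<in> ZQ 1" "h = pull 1 e"
  then have "e \<in> quot 1" by (simp only: Z_s_quot_iff)
  then have "res h (single n) = 0" if "n \<in> N" for n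
    using pull_1_on_N[OF _ that] unfolding res_single[OF that] e(2) by blast
  then have "res h x = 0 x" if "x \<in> tuples 1 N" for x
    using that unfolding tuples_1 by auto
  then have "res h = 0" by (intro cochain_eqI[of 1 N]) (use res_outside in auto)
  then show "\<exists>k\<in>BN. k = res h" using add_subgroup_0[OF N.cochain_complex(2)[of 1]] by auto
next
  fix f k assume f: "f \<in> Z 1" and k: "k \<in> BN" "k = res f"
  then obtain b where b: "res f = N.diff 0 (const_cochain b)" unfolding N.B_s_1 by auto
  let ?b = "diff 0 (const_cochain b)"
  define f' where "f' = f - ?b"
  have bB: "?b \<in> B 1" unfolding B_s_1 by auto
  then have f': "f' \<in> Z 1"
    unfolding f'_def using f cochain_complex[of 1] by (intro add_subgroup_diff) auto
  then have f'c: "f' \<in> cochains 1"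
    and mult: "\<And>g h. g \<in> carrier G \<Longrightarrow> h \<in> carrier G \<Longrightarrow> f' (single (g \<otimes> h)) = f' (single g) + act g (f' (single h))"
    unfolding Z_s_1_iff by auto
  have f'N: "f' (single n) = 0" if "n \<in> N" for n
    using fun_cong[OF b, of "single n"] that
    unfolding res_single[OF that] N_diff_const_single[OF that]
    by (simp add: f'_def diff_const_single mem_carrier)
  have right: "f' (single (g \<otimes> n)) = f' (single g)" if "g \<in> carrier G" "n \<in> N" for g n
    using mult[OF that(1) mem_carrier[OF that(2)]] that by (simp add: f'N act_0)
  obtain e where e: "e \<in> quot 1" "pull 1 e = f'"
  proof (rule factor_cochain_1[OF f'c right])
    fix g n assume g: "g \<in> carrier G" and n: "n \<in> N"
    have "f' (single (n \<otimes> g)) = f' (single g)"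
      using right[OF g inv_op_closed1[OF g n]] by (simp add: mult_conj g n)
    then show "act n (f' (single g)) = f' (single g)"
      using mult[OF mem_carrier[OF n] g] f'N[OF n] by simp
  qed (auto intro: that)
  have "e \<in> ZQ 1"
    using e f' by (simp only: Z_s_quot_iff Z_s_iff)
  moreover have "f - f' \<in> B 1" using bB by (simp add: f'_def)
  ultimately show "\<exists>e\<in>ZQ 1. \<exists>h. h = pull 1 e \<and> f - h \<in> B 1"
    using e(2) by blast
qed simp

text \<open>A cocycle on G is a connecting cochain of its own restriction, with boundary 0.
  Conversely, if d_G a is the pull-back of a coboundary d b, then a minus the pull-back of b is a
  cocycle on G; it still restricts to f because pulled-back 1-cochains vanish on N.\<close>

lemma exact_at_H1_inv:
  "kernel (H_s_inv G MG MA act N MN 1) (H_s_quot G MG MA act N 2) (connecting_map G MG MA act N)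
    = restriction G MG MA act N MN 1 ` carrier (H_s G MG MA act 1)"
  unfolding H_s_def H_s_inv_def H_s_quot_def
proof (rule exact_at[OF induced_restriction induced_connecting])
  fix e h assume e: "e \<in> Z 1" "h = res e"
  have "diff 1 e = 0" using e(1) by (simp only: Z_s_iff)
  moreover have "0 \<in> ZQ 2" "0 \<in> BQ 2"
    using quot_complex[of 2] by (auto intro: add_subgroup_0)
  ultimately show "\<exists>k\<in>BQ 2. connecting_rel h k"
    using cocycle_res(2)[OF e(1)] unfolding connecting_rel_def e(2)
    by (intro bexI[of _ 0] conjI exI[of _ e]) (simp_all only: pull_zero)
next
  fix f k assume f: "f \<in> ZI" and k: "k \<in> BQ 2" "connecting_rel f k"
  note fN = ZI_subset_ZN[OF f]
  obtain a where a: "a \<in> connecting f" "pull 2 k = diff 1 a"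
    using k(2) unfolding connecting_rel_def by auto
  obtain b where b: "b \<in> quot 1" "k = quot_diff 1 b"
    using k(1) B_s_quot_Suc[of 1] by (auto simp: numeral_2_eq_2)
  define e where "e = a - pull 1 b"
  have "diff 1 (pull 1 b) = diff 1 a"
    using pull_quot_diff[OF b(1)] a(2) b(2) by (simp add: numeral_2_eq_2)
  then have "diff 1 e = 0" unfolding e_def diff_diff by simp
  moreover have "e \<in> cochains 1"
    unfolding e_def by (rule add_subgroup_diff[OF add_subgroup_cochains connecting_cochain[OF fN a(1)] quot_pull[OF b(1)]])
  ultimately have "e \<in> Z 1" unfolding Z_s_iff by blast
  moreover have "f = res e"
  proof (rule cochain_eqI[of 1 N])
    show "f x = res e x" if "x \<in> tuples 1 N" for x
    proof -
      obtain n where n: "n \<in> N" "x = single n" using \<open>x \<in> tuples 1 N\<close> unfolding tuples_1 by auto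
      then show ?thesis
        using pull_1_on_N[OF b(1) n(1)] connecting_on_N[OF fN a(1) n(1)] res_single[OF n(1), of e]
        by (simp add: e_def)
    qed
  qed (use ZN_outside[OF fN] res_outside in auto)
  ultimately show "\<exists>e\<in>Z 1. \<exists>h. h = res e \<and> f - h \<in> BN"
    using add_subgroup_0[OF N.cochain_complex(2)[of 1]]
    by (intro bexI[of _ e] exI[of _ "res e"]) simp_all
qed

text \<open>When the pull-back of f is d_G a, normalization gives d_G a = 0 on pairs with an entry
  in N. Then \<open>a\<close> is a connecting cochain of its restriction to N, and f itself, not
  only its class, is the resulting cocycle.\<close>

lemma exact_at_H2_quot:
  "kernel (H_s_quot G MG MA act N 2) (H_s G MG MA act 2) (inflation G MG MA act N 2)
    = connecting_map G MG MA act N ` carrier (H_s_inv G MG MA act N MN 1)"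
  unfolding H_s_def H_s_inv_def H_s_quot_def
proof (rule exact_at[OF induced_connecting induced_inflation])
  fix e h assume e: "e \<in> ZI" "connecting_rel e h"
  then obtain a where "a \<in> connecting e" "pull 2 h = diff 1 a"
    unfolding connecting_rel_def by auto
  then show "\<exists>k\<in>B 2. k = pull 2 h"
    using connecting_cochain[OF ZI_subset_ZN[OF e(1)]] unfolding B_s_2 by auto
next
  fix f k assume f: "f \<in> ZQ 2" and k: "k \<in> B 2" "k = pull 2 f"
  then obtain a where a: "a \<in> cochains 1" "pull 2 f = diff 1 a" unfolding B_s_2 by auto
  have c: "pull 2 f \<in> cochains 2" using f by (simp only: Z_s_quot_iff quot_pull)
  have zero: "pull 2 f (pair g \<one>) = 0" "pull 2 f (pair \<one> g) = 0" if "g \<in> carrier G" for g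
  proof -
    have "pull 2 f x = 0" if "x \<in> tuples 2 (carrier G)" "i < 2" "x i = \<one>" for x i
      using c that unfolding smooth_cochains_def by blast
    from this[of _ 1] this[of _ 0] show "pull 2 f (pair g \<one>) = 0" "pull 2 f (pair \<one> g) = 0"
      using that by (simp_all add: G_one_closed)
  qed
  have eqs: "a (single (g \<otimes> n)) = a (single g) + act g (a (single n))"
    "a (single (n \<otimes> g)) = a (single n) + act n (a (single g))" if g: "g \<in> carrier G" and n: "n \<in> N" for g n
  proof -
    note nG = mem_carrier[OF n]
    \<comment> \<open>A pulled-back cochain cannot distinguish an entry in N from the entry
      \<one>.\<close>
    have N1: "n <# N = \<one> <# N" using coset_mult[OF G_one_closed n] nG by simp
    have "pull 2 f (pair g n) = 0" "pull 2 f (pair n g) = 0"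
      using zero[OF g] g nG by (simp_all add: pull_pair N1)
    then show "a (single (g \<otimes> n)) = a (single g) + act g (a (single n))"
      "a (single (n \<otimes> g)) = a (single n) + act n (a (single g))"
      unfolding a(2) group_diff_1[OF g nG] group_diff_1[OF nG g] by (simp_all add: algebra_simps)
  qed
  have "res a \<in> ZI" "connecting_rel (res a) f"
    using res_invariant[OF a(1) eqs] f a(2) unfolding connecting_rel_def by blast+
  then show "\<exists>e\<in>ZI. \<exists>h. connecting_rel e h \<and> f - h \<in> BQ 2"
    using add_subgroup_0[OF quot_complex(2)[of 2]] by (intro bexI[of _ "res a"] exI[of _ f]) auto
qed simp

end

subsection \<open>Split Lie subgroups\<close>

lemma smooth_module_near_lie_group:
  assumes G: "lie_group G MG" and A: "smooth_module G MG MA act"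
  shows "smooth_module_near G MG MA act"
proof -
  interpret group G using G by (simp add: lie_group_def)
  show ?thesis
  proof
    show "smooth_manifold MG" "topspace (topo MG) = carrier G" using G by (simp_all add: lie_group_def)
    show "smooth_near (prod_manifold MG MG) MG (g, h) (\<lambda>(g, h). g \<otimes>\<^bsub>G\<^esub> h)"
      if "g \<in> carrier G" "h \<in> carrier G" for g h
      using G that by (intro smooth_map_near) (simp_all add: lie_group_def)
    show A': "lie_group (additive_group UNIV) MA" using A by (simp add: smooth_module_def)
    show "smooth_near (prod_manifold MG MA) MA (g, a) (\<lambda>(g, a). act g a)" if "g \<in> carrier G" for g a
      using G A A' that by (intro smooth_map_near) (simp_all add: lie_group_def smooth_module_def)
  qed (use A in \<open>simp_all add: smooth_module_def\<close>)
qed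

text \<open>One local trivialization around the identity coset yields the section and, through its
  inverse, a smooth N-component; the smooth right action yields the smooth inclusion of N.\<close>

lemma split_lie_subgroup_extension:
  fixes G :: "('g, 'x) monoid_scheme" (structure)
  assumes G: "lie_group G MG" and A: "smooth_module G MG MA act" and N: "N \<lhd> G"
    and split: "split_lie_subgroup G MG N MN MQ"
  obtains s where "lie_extension G MG MA act N MN s"
proof -
  interpret smooth_module_near G MG MA act by (rule smooth_module_near_lie_group[OF G A])
  interpret normal N G by (rule N)
  let ?N = "G\<lparr>carrier := N\<rparr>" and ?q = "\<lambda>g. g <# N"
  note G_one = monoid.one_closed[OF is_monoid] and G_mult = monoid.m_closed[OF is_monoid]
  have lieN: "lie_group ?N MN" and topQ: "topspace (topo MQ) = ?q ` carrier G"
    and bundle_N: "smooth_principal_bundle MG MQ ?q ?N MN (\<lambda>g n. g \<otimes> n)"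
    using split unfolding split_lie_subgroup_def by auto
  have MN: "smooth_manifold MN" and topN: "topspace (topo MN) = N"
    using lieN by (simp_all add: lie_group_def)
  have MQ: "smooth_manifold MQ" and q_smooth: "smooth_map MG MQ ?q"
    and ract: "smooth_map (prod_manifold MG MN) MG (\<lambda>(g, n). g \<otimes> n)"
    using bundle_N unfolding smooth_principal_bundle_def by auto
  note chN = smooth_manifold_charted[OF MN] and chQ = smooth_manifold_charted[OF MQ]
  \<comment> \<open>The inclusion is the orbit map of \<one> under the right action of N on G, and
    that action is smooth by assumption.\<close>
  have incl: "smooth_near MN MG n (\<lambda>n. n)" if n: "n \<in> N" for n
  proof -
    have "smooth_near MN MG n (\<lambda>n. \<one> \<otimes> n)"
      by (rule near_compose_pair[where f = "\<lambda>_. \<one>" and g = "\<lambda>n. n" and k = "mult G",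
            OF chN charted_MG chN charted_MG smooth_near_const[OF chN charted_MG] smooth_near_ident[OF MN]
              smooth_map_near[OF ract]])
        (simp_all add: n topN topspace_MG)
    then show ?thesis
      by (rule smooth_near_cong_topspace[OF chN]) (simp add: topN mem_carrier)
  qed
  interpret N: smooth_module_near ?N MN MA act
  proof -
    interpret N: group ?N using lieN by (simp add: lie_group_def)
    show "smooth_module_near ?N MN MA act"
    proof
      show "smooth_near (prod_manifold MN MN) MN (m, n) (\<lambda>(m, n). m \<otimes>\<^bsub>?N\<^esub> n)"
        if "m \<in> carrier ?N" "n \<in> carrier ?N" for m n
        using lieN that by (intro smooth_map_near) (simp_all add: lie_group_def)
      show "smooth_near (prod_manifold MN MA) MA (n, a) (\<lambda>(n, a). act n a)" if n: "n \<in> carrier ?N" for n a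
      proof -
        let ?P = "prod_manifold MN MA"
        have ch: "charted ?P" by (rule charted_prod_manifold[OF chN charted_MA])
        have top: "(n, a) \<in> topspace (topo ?P)" using n by (simp add: topN topspace_MA)
        have fst: "smooth_near ?P MN (n, a) fst"
          by (rule smooth_map_near[OF smooth_map_fst[OF MN charted_MA] top])
        have snd: "smooth_near ?P MA (n, a) snd"
          by (rule smooth_map_near[OF smooth_map_snd[OF chN MA] top])
        have "smooth_near MN MG (fst (n, a)) (\<lambda>n. n)" using n by (intro incl) simp
        from smooth_near_compose[OF ch chN charted_subspace[OF charted_MG] fst this]
        have "smooth_near ?P MA (n, a) (\<lambda>z. act (fst z) (snd z))"
          by (rule near_act[OF ch _ snd])
        then show ?thesis by (simp add: case_prod_unfold)
      qed
    qed (use MN topN A in \<open>simp_all add: act_one act_mult act_add mem_carrier smooth_module_def\<close>)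
  qed
  have qN: "?q \<one> = N" using lcos_mult_one subset by simp
  have "N \<in> topspace (topo MQ)" unfolding topQ using qN G_one by blast
  then obtain U \<sigma> where U: "openin (topo MQ) U" "N \<in> U" and \<sigma>: "smooth_map_on MQ MG U \<sigma>"
    and q\<sigma>: "\<And>u. u \<in> U \<Longrightarrow> ?q (\<sigma> u) = u"
    and triv: "diffeomorphism_on (prod_manifold MQ MN) (U \<times> N) MG {x \<in> topspace (topo MG). ?q x \<in> U}
        (\<lambda>(u, n). \<sigma> u \<otimes> n)"
    using bundle_N unfolding smooth_principal_bundle_def by auto
  have \<sigma>_closed: "\<sigma> u \<in> carrier G" if "u \<in> U" for u
    using \<sigma> that openin_subset[OF U(1)] unfolding smooth_map_on_def continuous_map_def topspace_MG
    by (auto simp: topspace_subtopology)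
  have fibre: "inv g \<otimes> h \<in> N" if gh: "g \<in> carrier G" "h \<in> carrier G" "?q g = ?q h" for g h
  proof -
    obtain n where "n \<in> N" "h = g \<otimes> n" by (rule coset_eqD[OF gh])
    then show ?thesis using gh(1) by (simp add: m_assoc[symmetric] mem_carrier)
  qed
  \<comment> \<open>The value of \<sigma> at the identity coset lies in N but may differ from
    \<one>. Right multiplication by its inverse normalizes the section and stays inside the
    fibres.\<close>
  define n0 where "n0 = inv (\<sigma> N)"
  have n0: "n0 \<in> N"
    using fibre[OF \<sigma>_closed[OF U(2)] G_one] q\<sigma>[OF U(2)] qN \<sigma>_closed[OF U(2)] by (simp add: n0_def)
  \<comment> \<open>Off the trivializing set any representative is taken; the choice refers to the
    coset only, which makes \<open>s\<close> constant on cosets everywhere.\<close>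
  define s where "s g = (if ?q g \<in> U then \<sigma> (?q g) \<otimes> n0 else SOME x. x \<in> carrier G \<and> ?q x = ?q g)" for g
  have s: "s g \<in> carrier G" "?q (s g) = ?q g" if g: "g \<in> carrier G" for g
  proof -
    have "(SOME x. x \<in> carrier G \<and> ?q x = ?q g) \<in> carrier G \<and> ?q (SOME x. x \<in> carrier G \<and> ?q x = ?q g) = ?q g"
      by (rule someI[of _ g]) (simp add: g)
    then show "s g \<in> carrier G" "?q (s g) = ?q g"
      using \<sigma>_closed q\<sigma> coset_mult[OF _ n0] n0 by (simp_all add: s_def mem_carrier)
  qed
  define V where "V = {g \<in> carrier G. ?q g \<in> U}"
  have V: "openin (topo MG) V" "\<one> \<in> V"
    using triv U(2) qN G_one by (simp_all add: V_def diffeomorphism_on_def topspace_MG)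
  have q_near: "smooth_near MG MQ \<one> ?q"
    by (rule smooth_map_near[OF q_smooth]) (simp add: topspace_MG)
  have one_top: "\<one> \<in> topspace (topo MG)" by (simp add: topspace_MG)
  have "smooth_near MQ MG (?q \<one>) \<sigma>" unfolding qN by (rule smooth_nearI[OF U \<sigma>])
  then have "smooth_near MG MG \<one> (\<lambda>g. \<sigma> (?q g))"
    by (rule smooth_near_compose[OF charted_MG chQ charted_subspace[OF charted_MG] q_near])
  then have "smooth_near MG MG \<one> (\<lambda>g. \<sigma> (?q g) \<otimes> n0)"
    by (intro near_mult charted_MG smooth_near_const one_top) (simp_all add: topspace_MG mem_carrier n0)
  then have s_near: "smooth_near MG MG \<one> s"
    by (rule smooth_near_cong[OF charted_MG _ V]) (simp add: V_def s_def)
  let ?\<Phi> = "\<lambda>(u, n). \<sigma> u \<otimes> n" and ?P = "prod_manifold MQ MN"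
  \<comment> \<open>With the inverse trivialization made explicit, its second component is seen to
    be the N-component of g relative to \<sigma>, and it is smooth as a map into
    \<open>MN\<close>.\<close>
  have inv_\<Phi>: "inv_into (U \<times> N) ?\<Phi> g = (?q g, inv (\<sigma> (?q g)) \<otimes> g)" if g: "g \<in> V" for g
  proof (rule inv_into_f_eq)
    show "inj_on ?\<Phi> (U \<times> N)" using triv by (auto simp: diffeomorphism_on_def bij_betw_def)
    have "?q g \<in> U" "g \<in> carrier G" using g by (auto simp: V_def)
    note this \<sigma>_closed[OF this(1)] q\<sigma>[OF this(1)]
    then show "(?q g, inv (\<sigma> (?q g)) \<otimes> g) \<in> U \<times> N"
      "?\<Phi> (?q g, inv (\<sigma> (?q g)) \<otimes> g) = g"
      by (simp_all add: fibre m_assoc[symmetric])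
  qed
  have "smooth_map_on MG ?P V (inv_into (U \<times> N) ?\<Phi>)"
    using triv by (simp add: diffeomorphism_on_def V_def topspace_MG)
  then have "smooth_near MG ?P \<one> (inv_into (U \<times> N) ?\<Phi>)"
    by (rule smooth_nearI[OF V])
  then have inv_near: "smooth_near MG ?P \<one> (\<lambda>g. (?q g, inv (\<sigma> (?q g)) \<otimes> g))"
    by (rule smooth_near_cong[OF charted_MG _ V inv_\<Phi>])
  have "smooth_near MG MN \<one> (\<lambda>g. snd (?q g, inv (\<sigma> (?q g)) \<otimes> g))"
    by (rule smooth_near_compose[OF charted_MG charted_prod_manifold[OF chQ chN] charted_subspace[OF chN] inv_near])
      (rule smooth_map_near[OF smooth_map_snd[OF chQ MN] smooth_near_range[OF inv_near]])
  then have "smooth_near MG MN \<one> (\<lambda>g. inv (\<sigma> (?q g)) \<otimes> g)" by simp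
  \<comment> \<open>Passing from \<sigma> to \<open>s\<close> multiplies the N-component by a fixed
    element of N, which is smooth with respect to \<open>MN\<close>.\<close>
  then have "smooth_near MG MN \<one> (\<lambda>g. inv n0 \<otimes>\<^bsub>?N\<^esub> (inv (\<sigma> (?q g)) \<otimes> g))"
    by (intro N.near_mult charted_MG smooth_near_const chN one_top) (simp_all add: topN n0)
  then have fibre_near: "smooth_near MG MN \<one> (\<lambda>g. inv (s g) \<otimes> g)"
  proof (rule smooth_near_cong[OF charted_MG _ V])
    fix g assume "g \<in> V"
    then have "?q g \<in> U" "g \<in> carrier G" by (auto simp: V_def)
    then show "inv n0 \<otimes>\<^bsub>?N\<^esub> (inv (\<sigma> (?q g)) \<otimes> g) = inv (s g) \<otimes> g"
      using \<sigma>_closed n0 by (simp add: s_def inv_mult_group mem_carrier m_assoc)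
  qed
  have "lie_extension G MG MA act N MN s"
  proof
    show "smooth_near MN MG \<one> (\<lambda>n. n)" by (rule incl) simp
    show "inv (s g) \<otimes> g \<in> N" if "g \<in> carrier G" for g
      using fibre[OF s(1)[OF that] that s(2)[OF that]] .
    show "s (g \<otimes> n) = s g" if "g \<in> carrier G" "n \<in> N" for g n
      using coset_mult[OF that] by (simp add: s_def)
    show "s \<one> = \<one>"
      using U(2) \<sigma>_closed[OF U(2)] by (simp add: s_def qN n0_def)
  qed (use s s_near fibre_near in auto)
  then show ?thesis by (rule that)
qed

section \<open>The inflation-restriction sequence\<close>

theorem propositionD8:
  fixes G :: "'g monoid"
    and MG :: "('g, 'e::locally_convex_space) manifold"
    and MA :: "('a::ab_group_add, 'f::locally_convex_space) manifold"
    and act :: "'g \<Rightarrow> 'a \<Rightarrow> 'a"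
    and N :: "'g set"
    and MN :: "('g, 'h::locally_convex_space) manifold"
    and MQ :: "('g set, 'k::locally_convex_space) manifold"
  assumes "lie_group G MG"
    and "smooth_module G MG MA act"
    and "N \<lhd> G"
    and "split_lie_subgroup G MG N MN MQ"
  shows "group_hom (H_s_quot G MG MA act N 1) (H_s G MG MA act 1) (inflation G MG MA act N 1) \<and>
    group_hom (H_s G MG MA act 1) (H_s_inv G MG MA act N MN 1) (restriction G MG MA act N MN 1) \<and>
    group_hom (H_s_inv G MG MA act N MN 1) (H_s_quot G MG MA act N 2) (connecting_map G MG MA act N) \<and>
    group_hom (H_s_quot G MG MA act N 2) (H_s G MG MA act 2) (inflation G MG MA act N 2) \<and>
    inj_on (inflation G MG MA act N 1) (carrier (H_s_quot G MG MA act N 1)) \<and>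
    kernel (H_s G MG MA act 1) (H_s_inv G MG MA act N MN 1) (restriction G MG MA act N MN 1)
      = inflation G MG MA act N 1 ` carrier (H_s_quot G MG MA act N 1) \<and>
    kernel (H_s_inv G MG MA act N MN 1) (H_s_quot G MG MA act N 2) (connecting_map G MG MA act N)
      = restriction G MG MA act N MN 1 ` carrier (H_s G MG MA act 1) \<and>
    kernel (H_s_quot G MG MA act N 2) (H_s G MG MA act 2) (inflation G MG MA act N 2)
      = connecting_map G MG MA act N ` carrier (H_s_inv G MG MA act N MN 1)"
proof -
  obtain s where "lie_extension G MG MA act N MN s"
    by (rule split_lie_subgroup_extension[OF assms])
  then interpret lie_extension G MG MA act N MN s .
  have inflation: "group_hom (H_s_quot G MG MA act N p) (H_s G MG MA act p) (inflation G MG MA act N p)"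
    if "p = 1 \<or> p = 2" for p
    unfolding H_s_quot_def H_s_def by (rule induced_quotient_map.group_hom[OF induced_inflation[OF that]])
  show ?thesis
    using inflation[of 1] inflation[of 2] inflation_inj exact_at_H1 exact_at_H1_inv exact_at_H2_quot
      induced_quotient_map.group_hom[OF induced_restriction, folded H_s_def H_s_inv_def]
      induced_quotient_map.group_hom[OF induced_connecting, folded H_s_inv_def H_s_quot_def]
    by blast
qed

end
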